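(* Let $(M,g)$ be an oriented Riemannian surface with Gaussian curvature $K$, and let $H\colon M\to\mathbb{R}$ be a smooth function satisfying $\mathrm{Hess}\,H=H(H^2-K)\,\mathrm{Id}$ and $2K-3H^2=\alpha$ for some constant $\alpha\in\mathbb{R}$. Let $p\in M$ be a regular critical point of $H$ and let $(r,e^{i\varphi})\colon V\to\,]0,R[\,\times S^1$ be geodesic polar coordinates around $p$. Then, locally (on a sufficiently small punctured neighbourhood of $p$), the metric is given by $$g=dr^2+\left(\frac{L}{2\pi}\right)^2d\varphi^2,$$ where $L$ is the length of the geodesic circle of radius $r$ around $p$. Moreover, $L$ and $H$ depend only on $r$, and $L(r)=c\,H'(r)$ for some constant $c\neq 0$.
   Context: $\mathrm{Hess}\,H=\nabla\,\mathrm{grad}\,H$ is viewed as an endomorphism field of $TM$. A critical point of $H$ is called regular if the Hessian of $H$ there is non-degenerate, and singular otherwise. The geodesic polar coordinates $(r,e^{i\varphi})$ around $p$ are the composition of the inverse of the exponential map at $p$ with the Euclidean polar coordinates of $T_pM$ with respect to some orthonormal basis; thus $r=d(\cdot,p)$ is the distance to $p$. Here $H'$ denotes the derivative of $H$ with respect to $r$. *)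

theory Defs
  imports "HOL-Analysis.Analysis"
begin

section \<open>Smooth maps between normed spaces\<close>

text \<open>Intended for open sets \<open>S\<close> in finite-dimensional spaces.\<close>

primrec Ck_on :: "nat \<Rightarrow> ('a::real_normed_vector \<Rightarrow> 'b::real_normed_vector) \<Rightarrow> 'a set \<Rightarrow> bool" where
  "Ck_on 0 f S \<longleftrightarrow> continuous_on S f"
| "Ck_on (Suc k) f S \<longleftrightarrow> (\<forall>x\<in>S. f differentiable (at x)) \<and>
     (\<forall>v. Ck_on k (\<lambda>x. frechet_derivative f (at x) v) S)"

definition smooth_on :: "('a::real_normed_vector \<Rightarrow> 'b::real_normed_vector) \<Rightarrow> 'a set \<Rightarrow> bool" where
  "smooth_on f S \<longleftrightarrow> (\<forall>k. Ck_on k f S)"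


section \<open>Oriented smooth surfaces\<close>

text \<open>The points of the surface are the elements of the type \<open>'m\<close>. The smooth structure and the
  orientation are given by an atlas, which need not be maximal.\<close>

type_synonym 'm chart = "'m set \<times> ('m \<Rightarrow> real ^ 2)"

abbreviation chart_dom :: "'m chart \<Rightarrow> 'm set" where
  "chart_dom \<equiv> fst"

abbreviation chart_map :: "'m chart \<Rightarrow> 'm \<Rightarrow> real ^ 2" where
  "chart_map \<equiv> snd"

definition chart_inv :: "'m chart \<Rightarrow> real ^ 2 \<Rightarrow> 'm" where
  "chart_inv c = inv_into (chart_dom c) (chart_map c)"

definition is_chart :: "'m::topological_space chart \<Rightarrow> bool" where
  "is_chart c \<longleftrightarrow> open (chart_dom c) \<and> open (chart_map c ` chart_dom c) \<and>
     homeomorphism (chart_dom c) (chart_map c ` chart_dom c) (chart_map c) (chart_inv c)"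

definition transition :: "'m chart \<Rightarrow> 'm chart \<Rightarrow> real ^ 2 \<Rightarrow> real ^ 2" where
  "transition c d = chart_map d \<circ> chart_inv c"

definition jacobian :: "(real ^ 2 \<Rightarrow> real ^ 2) \<Rightarrow> real ^ 2 \<Rightarrow> real ^ 2 ^ 2" where
  "jacobian f y = matrix (frechet_derivative f (at y))"

definition oriented_smooth_surface ::
  "'m::{second_countable_topology,t2_space} chart set \<Rightarrow> bool" where
  "oriented_smooth_surface A \<longleftrightarrow>
     (\<forall>c\<in>A. is_chart c) \<and> (\<Union>c\<in>A. chart_dom c) = UNIV \<and>
     (\<forall>c\<in>A. \<forall>d\<in>A. smooth_on (transition c d) (chart_map c ` (chart_dom c \<inter> chart_dom d)) \<and>
        (\<forall>y \<in> chart_map c ` (chart_dom c \<inter> chart_dom d). det (jacobian (transition c d) y) > 0))"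

definition smooth_from ::
  "'m::topological_space chart set \<Rightarrow> ('m \<Rightarrow> 'b::real_normed_vector) \<Rightarrow> 'm set \<Rightarrow> bool" where
  "smooth_from A f W \<longleftrightarrow> (\<forall>c\<in>A. smooth_on (f \<circ> chart_inv c) (chart_map c ` (chart_dom c \<inter> W)))"

definition smooth_into ::
  "'m::topological_space chart set \<Rightarrow> ('a::real_normed_vector \<Rightarrow> 'm) \<Rightarrow> 'a set \<Rightarrow> bool" where
  "smooth_into A E S \<longleftrightarrow> continuous_on S E \<and>
     (\<forall>c\<in>A. smooth_on (chart_map c \<circ> E) (S \<inter> E -` chart_dom c))"

text \<open>A tangent vector at a point \<open>q\<close> is represented by its components in a chart around \<open>q\<close>.
  The differential is taken in the direction of the tangent vector at \<open>q\<close> with components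
  \<open>v\<close> in the chart \<open>c\<close>.\<close>

definition differential ::
  "('m \<Rightarrow> 'b::real_normed_vector) \<Rightarrow> 'm chart \<Rightarrow> 'm \<Rightarrow> real ^ 2 \<Rightarrow> 'b" where
  "differential f c q v = frechet_derivative (f \<circ> chart_inv c) (at (chart_map c q)) v"


section \<open>Riemannian metrics\<close>

text \<open>A metric assigns to each chart its Gram matrix, as a function of the coordinates.\<close>

type_synonym 'm metric = "'m chart \<Rightarrow> real ^ 2 \<Rightarrow> real ^ 2 ^ 2"

definition riemannian_metric :: "'m::topological_space chart set \<Rightarrow> 'm metric \<Rightarrow> bool" where
  "riemannian_metric A g \<longleftrightarrow>
     (\<forall>c\<in>A. smooth_on (g c) (chart_map c ` chart_dom c) \<and>
        (\<forall>y \<in> chart_map c ` chart_dom c.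
           transpose (g c y) = g c y \<and> (\<forall>v. v \<noteq> 0 \<longrightarrow> v \<bullet> (g c y *v v) > 0))) \<and>
     (\<forall>c\<in>A. \<forall>d\<in>A. \<forall>y \<in> chart_map c ` (chart_dom c \<inter> chart_dom d).
        g c y = transpose (jacobian (transition c d) y) ** g d (transition c d y)
                  ** jacobian (transition c d) y)"

definition oriented_riemannian_surface ::
  "'m::{second_countable_topology,t2_space} chart set \<Rightarrow> 'm metric \<Rightarrow> bool" where
  "oriented_riemannian_surface A g \<longleftrightarrow> oriented_smooth_surface A \<and> riemannian_metric A g"

definition metric_at :: "'m metric \<Rightarrow> 'm chart \<Rightarrow> 'm \<Rightarrow> real ^ 2 \<Rightarrow> real ^ 2 \<Rightarrow> real" where
  "metric_at g c q v w = v \<bullet> (g c (chart_map c q) *v w)"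


section \<open>Levi-Civita connection, curvature and Hessian in a chart\<close>

text \<open>Throughout this section \<open>G\<close> is the Gram matrix of the metric in a fixed chart.\<close>

definition partial :: "2 \<Rightarrow> (real ^ 2 \<Rightarrow> real) \<Rightarrow> real ^ 2 \<Rightarrow> real" where
  "partial i f y = frechet_derivative f (at y) (axis i 1)"

definition christoffel :: "(real ^ 2 \<Rightarrow> real ^ 2 ^ 2) \<Rightarrow> 2 \<Rightarrow> 2 \<Rightarrow> 2 \<Rightarrow> real ^ 2 \<Rightarrow> real" where
  "christoffel G k i j y = (1/2) * (\<Sum>l\<in>UNIV. matrix_inv (G y) $ k $ l *
     (partial i (\<lambda>z. G z $ j $ l) y + partial j (\<lambda>z. G z $ i $ l) y - partial l (\<lambda>z. G z $ i $ j) y))"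

text \<open>The \<open>l\<close>-th component of \<open>R(\<partial>\<^sub>i, \<partial>\<^sub>j) \<partial>\<^sub>k\<close>, where
  \<open>R(X, Y) Z = \<nabla>\<^sub>X \<nabla>\<^sub>Y Z - \<nabla>\<^sub>Y \<nabla>\<^sub>X Z - \<nabla>\<^bsub>[X, Y]\<^esub> Z\<close>.\<close>

definition curvature_tensor ::
  "(real ^ 2 \<Rightarrow> real ^ 2 ^ 2) \<Rightarrow> 2 \<Rightarrow> 2 \<Rightarrow> 2 \<Rightarrow> 2 \<Rightarrow> real ^ 2 \<Rightarrow> real" where
  "curvature_tensor G l i j k y =
     partial i (christoffel G l j k) y - partial j (christoffel G l i k) y +
     (\<Sum>m\<in>UNIV. christoffel G m j k y * christoffel G l i m y
              - christoffel G m i k y * christoffel G l j m y)"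

text \<open>\<open>K = g(R(\<partial>\<^sub>1, \<partial>\<^sub>2) \<partial>\<^sub>2, \<partial>\<^sub>1) / det g\<close>\<close>

definition gauss_curvature_chart :: "(real ^ 2 \<Rightarrow> real ^ 2 ^ 2) \<Rightarrow> real ^ 2 \<Rightarrow> real" where
  "gauss_curvature_chart G y =
     (\<Sum>l\<in>UNIV. G y $ l $ 1 * curvature_tensor G l 1 2 2 y) / det (G y)"

definition gauss_curvature ::
  "'m::topological_space chart set \<Rightarrow> 'm metric \<Rightarrow> ('m \<Rightarrow> real) \<Rightarrow> bool" where
  "gauss_curvature A g K \<longleftrightarrow>
     (\<forall>c\<in>A. \<forall>q\<in>chart_dom c. K q = gauss_curvature_chart (g c) (chart_map c q))"

definition grad_chart :: "(real ^ 2 \<Rightarrow> real ^ 2 ^ 2) \<Rightarrow> (real ^ 2 \<Rightarrow> real) \<Rightarrow> real ^ 2 \<Rightarrow> real ^ 2" where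
  "grad_chart G h y = matrix_inv (G y) *v (\<chi> i. partial i h y)"

text \<open>The matrix of the endomorphism \<open>v \<mapsto> \<nabla>\<^sub>v X\<close>.\<close>

definition covariant_derivative ::
  "(real ^ 2 \<Rightarrow> real ^ 2 ^ 2) \<Rightarrow> (real ^ 2 \<Rightarrow> real ^ 2) \<Rightarrow> real ^ 2 \<Rightarrow> real ^ 2 ^ 2" where
  "covariant_derivative G X y =
     (\<chi> i j. partial j (\<lambda>z. X z $ i) y + (\<Sum>k\<in>UNIV. christoffel G i j k y * X y $ k))"

definition hessian :: "'m metric \<Rightarrow> ('m \<Rightarrow> real) \<Rightarrow> 'm chart \<Rightarrow> 'm \<Rightarrow> real ^ 2 ^ 2" where
  "hessian g H c q =
     covariant_derivative (g c) (grad_chart (g c) (H \<circ> chart_inv c)) (chart_map c q)"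

definition critical_point :: "'m::topological_space chart set \<Rightarrow> ('m \<Rightarrow> real) \<Rightarrow> 'm \<Rightarrow> bool" where
  "critical_point A H p \<longleftrightarrow> (\<forall>c\<in>A. p \<in> chart_dom c \<longrightarrow> (\<forall>v. differential H c p v = 0))"

definition regular_critical_point ::
  "'m::topological_space chart set \<Rightarrow> 'm metric \<Rightarrow> ('m \<Rightarrow> real) \<Rightarrow> 'm \<Rightarrow> bool" where
  "regular_critical_point A g H p \<longleftrightarrow> critical_point A H p \<and>
     (\<forall>c\<in>A. p \<in> chart_dom c \<longrightarrow> invertible (hessian g H c p))"


section \<open>Curves, geodesics and the exponential map\<close>

definition curve_speed :: "'m chart set \<Rightarrow> 'm metric \<Rightarrow> (real \<Rightarrow> 'm) \<Rightarrow> real \<Rightarrow> real" where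
  "curve_speed A g \<gamma> t =
     (let c = (SOME c. c \<in> A \<and> \<gamma> t \<in> chart_dom c);
          v = vector_derivative (chart_map c \<circ> \<gamma>) (at t)
      in sqrt (metric_at g c (\<gamma> t) v v))"

definition curve_length :: "'m chart set \<Rightarrow> 'm metric \<Rightarrow> (real \<Rightarrow> 'm) \<Rightarrow> real \<Rightarrow> real \<Rightarrow> real" where
  "curve_length A g \<gamma> a b = integral {a..b} (curve_speed A g \<gamma>)"

definition geodesic_on ::
  "'m::topological_space chart set \<Rightarrow> 'm metric \<Rightarrow> (real \<Rightarrow> 'm) \<Rightarrow> real set \<Rightarrow> bool" where
  "geodesic_on A g \<gamma> I \<longleftrightarrow> continuous_on I \<gamma> \<and>
     (\<forall>c\<in>A. \<forall>t\<in>I. \<gamma> t \<in> chart_dom c \<longrightarrow>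
        (let \<sigma> = chart_map c \<circ> \<gamma>; v = vector_derivative \<sigma> (at t)
         in \<sigma> differentiable (at t) \<and>
            ((\<lambda>s. vector_derivative \<sigma> (at s)) has_vector_derivative
               (\<chi> k. - (\<Sum>i\<in>UNIV. \<Sum>j\<in>UNIV. christoffel (g c) k i j (\<sigma> t) * v $ i * v $ j))) (at t)))"

text \<open>\<open>q = exp\<^sub>p v\<close>, for the tangent vector at \<open>p\<close> with components \<open>v\<close> in the chart \<open>c\<close> around \<open>p\<close>.\<close>

definition is_exp ::
  "'m::topological_space chart set \<Rightarrow> 'm metric \<Rightarrow> 'm chart \<Rightarrow> 'm \<Rightarrow> real ^ 2 \<Rightarrow> 'm \<Rightarrow> bool" where
  "is_exp A g c p v q \<longleftrightarrow>
     (\<exists>\<gamma> a b. a < 0 \<and> 1 < b \<and> geodesic_on A g \<gamma> {a<..<b} \<and> \<gamma> 0 = p \<and>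
        ((chart_map c \<circ> \<gamma>) has_vector_derivative v) (at 0) \<and> \<gamma> 1 = q)"

definition exp_domain ::
  "'m::topological_space chart set \<Rightarrow> 'm metric \<Rightarrow> 'm chart \<Rightarrow> 'm \<Rightarrow> (real ^ 2) set" where
  "exp_domain A g c p = {v. \<exists>q. is_exp A g c p v q}"

definition exp_map ::
  "'m::topological_space chart set \<Rightarrow> 'm metric \<Rightarrow> 'm chart \<Rightarrow> 'm \<Rightarrow> real ^ 2 \<Rightarrow> 'm" where
  "exp_map A g c p v = (THE q. is_exp A g c p v q)"


section \<open>Geodesic polar coordinates\<close>

definition orthonormal_basis_at ::
  "'m metric \<Rightarrow> 'm chart \<Rightarrow> 'm \<Rightarrow> real ^ 2 \<Rightarrow> real ^ 2 \<Rightarrow> bool" where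
  "orthonormal_basis_at g c p e1 e2 \<longleftrightarrow>
     metric_at g c p e1 e1 = 1 \<and> metric_at g c p e2 e2 = 1 \<and> metric_at g c p e1 e2 = 0"

text \<open>An orthonormal basis of the tangent plane at \<open>p\<close> identifies this plane with \<open>\<complex>\<close>, so that the
  Euclidean polar coordinates of \<open>z\<close> become \<open>(cmod z, sgn z)\<close>.\<close>

definition exp_frame ::
  "'m::topological_space chart set \<Rightarrow> 'm metric \<Rightarrow> 'm chart \<Rightarrow> 'm \<Rightarrow> real ^ 2 \<Rightarrow> real ^ 2 \<Rightarrow> complex \<Rightarrow> 'm" where
  "exp_frame A g c p e1 e2 z = exp_map A g c p (Re z *\<^sub>R e1 + Im z *\<^sub>R e2)"

text \<open>The exponential map is a diffeomorphism from the ball of radius \<open>R\<close> in the tangent plane onto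
  an open neighbourhood of \<open>p\<close>; the coordinate domain \<open>V\<close> is that neighbourhood without \<open>p\<close>.
  The map \<open>u\<close> is the angular coordinate \<open>e\<^sup>i\<^sup>\<phi>\<close>.\<close>

definition geodesic_polar_coordinates ::
  "'m::topological_space chart set \<Rightarrow> 'm metric \<Rightarrow> 'm chart \<Rightarrow> 'm \<Rightarrow> real ^ 2 \<Rightarrow> real ^ 2 \<Rightarrow>
   real \<Rightarrow> 'm set \<Rightarrow> ('m \<Rightarrow> real) \<Rightarrow> ('m \<Rightarrow> complex) \<Rightarrow> bool" where
  "geodesic_polar_coordinates A g c p e1 e2 R V r u \<longleftrightarrow>
     (let E = exp_frame A g c p e1 e2; B = ball 0 R in
        0 < R \<and>
        (\<forall>z\<in>B. Re z *\<^sub>R e1 + Im z *\<^sub>R e2 \<in> exp_domain A g c p) \<and>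
        inj_on E B \<and> open (E ` B) \<and> smooth_into A E B \<and> smooth_from A (inv_into B E) (E ` B) \<and>
        V = E ` (B - {0}) \<and>
        (\<forall>z \<in> B - {0}. r (E z) = cmod z \<and> u (E z) = sgn z))"

text \<open>Since \<open>u = e\<^sup>i\<^sup>\<phi>\<close> satisfies \<open>du = \<i> u d\<phi>\<close> for every local choice of \<open>\<phi>\<close>, the globally defined
  one-form \<open>d\<phi>\<close> is the imaginary part of \<open>cnj u du\<close>.\<close>

definition angle_form :: "('m \<Rightarrow> complex) \<Rightarrow> 'm chart \<Rightarrow> 'm \<Rightarrow> real ^ 2 \<Rightarrow> real" where
  "angle_form u c q v = Im (cnj (u q) * differential u c q v)"

definition geodesic_circle_length ::
  "'m::topological_space chart set \<Rightarrow> 'm metric \<Rightarrow> 'm chart \<Rightarrow> 'm \<Rightarrow> real ^ 2 \<Rightarrow> real ^ 2 \<Rightarrow> real \<Rightarrow> real" where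
  "geodesic_circle_length A g c p e1 e2 \<rho> =
     curve_length A g (\<lambda>\<theta>. exp_frame A g c p e1 e2 (complex_of_real \<rho> * cis \<theta>)) 0 (2 * pi)"

end

theory Submission
  imports Defs
begin

text \<open>Eliminating \<open>K\<close> turns the first hypothesis into \<open>Hess H = F(H) Id\<close> for a polynomial \<open>F\<close>, and
  \<open>F(H(p)) \<noteq> 0\<close> since \<open>p\<close> is regular. Along every unit speed geodesic from \<open>p\<close> the function \<open>H\<close> solves
  \<open>k'' = F(k)\<close> with initial values \<open>k(0) = H(p)\<close> and \<open>k'(0) = 0\<close>, so that \<open>H = k(r)\<close> with the same \<open>k\<close> in
  all directions. As \<open>\<bar>grad H\<bar>\<^sup>2\<close> and \<open>k'\<^sup>2\<close> have the same derivative along the geodesic and both vanish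
  at \<open>p\<close>, they agree, which forces \<open>grad H = k' \<partial>\<^sub>r\<close>. Hence \<open>\<partial>\<^sub>r\<close> is orthogonal to \<open>Y = \<partial>\<^sub>\<phi>\<close>, as \<open>Y\<close> is
  tangent to the level sets of \<open>H\<close>. Finally \<open>\<nabla>\<^sub>r Y = \<nabla>\<^sub>Y \<partial>\<^sub>r = (k''/k') Y\<close>, so that \<open>\<bar>Y\<bar>/\<bar>k'\<bar>\<close> is constant
  along the geodesic, equal to its limit \<open>1/\<bar>F(H(p))\<bar>\<close> at \<open>p\<close>.\<close>

section \<open>Differential calculus and ordinary differential equations\<close>

text \<open>Differential equations enter through uniqueness only: the polar coordinates already
  supply a smooth exponential map on a ball, and uniqueness identifies all points exp(s v) with
  points of one geodesic and the profiles of H in different directions with each other. The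
  commutation of \<nabla>_r and \<nabla>_Y rests on the symmetry of the second derivatives of the
  exponential map in a chart and of the Christoffel symbols, so the Hessian equation takes the place
  of the Jacobi equation. The centre is delicate, because polar coordinates degenerate there. Its
  limit is computed after division by r: k'/r tends to k''(0) = F(H(p)), and |Y|/r tends to 1
  because the differential of the exponential map at 0 is the identity. A sign fixes the final
  radius: close to p the quotient k'/F(H(p)) is positive, so L = 2 pi |Y| equals c k' with c = 2 pi
  / F(H(p)), without absolute values. The computation takes place in a single chart around p; all
  other charts are reached through the invariance of the metric.\<close>

lemma has_derivative_frechet:
  "f differentiable (at x) \<Longrightarrow> (f has_derivative frechet_derivative f (at x)) (at x)"
  by (simp add: frechet_derivative_works)

lemma frechet_derivative_eqI:
  "(f has_derivative f') (at x) \<Longrightarrow> frechet_derivative f (at x) v = f' v"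
  using frechet_derivative_at by metis

section \<open>Closure properties of the class \<open>Ck_on\<close>\<close>

lemma Ck_on_cong:
  assumes "open S" "\<And>x. x \<in> S \<Longrightarrow> f x = g x" "Ck_on k f S"
  shows "Ck_on k g S"
  using assms(2,3)
proof (induction k arbitrary: f g)
  case 0
  then show ?case by (simp cong: continuous_on_cong)
next
  case (Suc k)
  have d: "g differentiable (at x)" "frechet_derivative f (at x) = frechet_derivative g (at x)"
    if "x \<in> S" for x
  proof -
    have "f differentiable (at x)" using Suc.prems that by simp
    then show "g differentiable (at x)"
      using assms(1) that Suc.prems(1) has_derivative_transform_within_open
      by (metis differentiable_def)
    show "frechet_derivative f (at x) = frechet_derivative g (at x)"
      using frechet_derivative_transform_within_open \<open>f differentiable (at x)\<close> assms(1) that Suc.prems(1)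
      by blast
  qed
  have "Ck_on k (\<lambda>x. frechet_derivative g (at x) v) S" for v
    by (rule Suc.IH[of "\<lambda>x. frechet_derivative f (at x) v"]) (use Suc.prems(2) d in auto)
  then show ?case using d by auto
qed

lemma Ck_on_Suc_imp: "Ck_on (Suc k) f S \<Longrightarrow> Ck_on k f S"
proof (induction k arbitrary: f)
  case 0
  then show ?case
    by (auto intro!: differentiable_imp_continuous_on differentiable_at_imp_differentiable_on)
next
  case (Suc k)
  then show ?case by (metis Ck_on.simps(2))
qed

lemma Ck_on_subset: "Ck_on k f S \<Longrightarrow> T \<subseteq> S \<Longrightarrow> Ck_on k f T"
  by (induction k arbitrary: f) (auto intro: continuous_on_subset)

lemma Ck_on_const: "Ck_on k (\<lambda>x. c) S"
  by (induction k arbitrary: c) auto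

lemma Ck_on_bounded_linear:
  assumes "open S" "bounded_linear L" "Ck_on k f S"
  shows "Ck_on k (\<lambda>x. L (f x)) S"
  using assms(3)
proof (induction k arbitrary: f)
  case 0
  then show ?case using assms(2) by (simp add: bounded_linear.continuous_on)
next
  case (Suc k)
  have d: "((\<lambda>x. L (f x)) has_derivative (\<lambda>v. L (frechet_derivative f (at x) v))) (at x)"
    if "x \<in> S" for x
    using Suc.prems that by (auto intro!: bounded_linear.has_derivative[OF assms(2)] has_derivative_frechet)
  have "Ck_on k (\<lambda>x. L (frechet_derivative f (at x) v)) S" for v
    using Suc.prems by (intro Suc.IH) auto
  then have "Ck_on k (\<lambda>x. frechet_derivative (\<lambda>x. L (f x)) (at x) v) S" for v
    by (rule Ck_on_cong[OF assms(1), rotated]) (simp add: frechet_derivative_eqI[OF d])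
  then show ?case using d by (auto simp: differentiable_def)
qed

lemma Ck_on_compose_linear:
  assumes "open S" "bounded_linear L" "Ck_on k f S" "open T" "L ` T \<subseteq> S"
  shows "Ck_on k (\<lambda>x. f (L x)) T"
  using assms(3)
proof (induction k arbitrary: f)
  case 0
  then show ?case using assms(2,5)
    by (auto intro!: continuous_on_compose2[of S f] simp: linear_continuous_on)
next
  case (Suc k)
  have d: "((\<lambda>x. f (L x)) has_derivative (\<lambda>v. frechet_derivative f (at (L x)) (L v))) (at x)"
    if "x \<in> T" for x
  proof -
    have "(f has_derivative frechet_derivative f (at (L x))) (at (L x))"
      using Suc.prems that assms(5) by (auto intro!: has_derivative_frechet)
    then show ?thesis
      using bounded_linear_imp_has_derivative[OF assms(2)]
      by (metis has_derivative_compose)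
  qed
  have "Ck_on k (\<lambda>x. frechet_derivative f (at (L x)) (L v)) T" for v
    using Suc.prems by (intro Suc.IH) auto
  then have "Ck_on k (\<lambda>x. frechet_derivative (\<lambda>x. f (L x)) (at x) v) T" for v
    by (rule Ck_on_cong[OF assms(4), rotated]) (simp add: frechet_derivative_eqI[OF d])
  then show ?case using d by (auto simp: differentiable_def)
qed

lemma Ck_on_linear:
  assumes "open S" "bounded_linear L"
  shows "Ck_on k L S"
proof (cases k)
  case 0
  then show ?thesis using assms by (simp add: linear_continuous_on)
next
  case (Suc n)
  have "frechet_derivative L (at x) v = L v" for x v
    using bounded_linear_imp_has_derivative[OF assms(2)] frechet_derivative_eqI by blast
  then show ?thesis
    using Suc assms by (auto simp: Ck_on_const bounded_linear_imp_differentiable)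
qed

lemma Ck_on_add:
  assumes "open S" "Ck_on k f S" "Ck_on k g S"
  shows "Ck_on k (\<lambda>x. f x + g x) S"
  using assms(2,3)
proof (induction k arbitrary: f g)
  case 0
  then show ?case by (simp add: continuous_on_add)
next
  case (Suc k)
  have d: "((\<lambda>x. f x + g x) has_derivative
      (\<lambda>v. frechet_derivative f (at x) v + frechet_derivative g (at x) v)) (at x)"
    if "x \<in> S" for x
    using Suc.prems that by (auto intro!: has_derivative_add has_derivative_frechet)
  have "Ck_on k (\<lambda>x. frechet_derivative f (at x) v + frechet_derivative g (at x) v) S" for v
    using Suc.prems by (intro Suc.IH) auto
  then have "Ck_on k (\<lambda>x. frechet_derivative (\<lambda>x. f x + g x) (at x) v) S" for v
    by (rule Ck_on_cong[OF assms(1), rotated]) (simp add: frechet_derivative_eqI[OF d])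
  then show ?case using d by (auto simp: differentiable_def)
qed

lemma Ck_on_sum:
  assumes "open S" "\<And>i. i \<in> I \<Longrightarrow> Ck_on k (f i) S"
  shows "Ck_on k (\<lambda>x. \<Sum>i\<in>I. f i x) S"
  using assms(2)
  by (induction I rule: infinite_finite_induct) (auto intro: Ck_on_const Ck_on_add[OF assms(1)])

lemma Ck_on_mult:
  fixes f g :: "'a::real_normed_vector \<Rightarrow> real"
  assumes "open S" "Ck_on k f S" "Ck_on k g S"
  shows "Ck_on k (\<lambda>x. f x * g x) S"
  using assms(2,3)
proof (induction k arbitrary: f g)
  case 0
  then show ?case by (simp add: continuous_on_mult)
next
  case (Suc k)
  have d: "((\<lambda>x. f x * g x) has_derivative
      (\<lambda>v. f x * frechet_derivative g (at x) v + frechet_derivative f (at x) v * g x)) (at x)"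
    if "x \<in> S" for x
    using Suc.prems that by (auto intro!: has_derivative_mult has_derivative_frechet)
  have "Ck_on k (\<lambda>x. f x * frechet_derivative g (at x) v + frechet_derivative f (at x) v * g x) S" for v
    using Suc.prems Ck_on_Suc_imp[OF Suc.prems(1)] Ck_on_Suc_imp[OF Suc.prems(2)]
    by (intro Ck_on_add assms(1) Suc.IH) auto
  then have "Ck_on k (\<lambda>x. frechet_derivative (\<lambda>x. f x * g x) (at x) v) S" for v
    by (rule Ck_on_cong[OF assms(1), rotated]) (simp add: frechet_derivative_eqI[OF d])
  then show ?case using d by (auto simp: differentiable_def)
qed

text \<open>The derivative of 1/f is a product of Df with two copies of 1/f itself, so the induction
  keeps \<open>f\<close> fixed and feeds on the previous level for the same function.\<close>

lemma Ck_on_inverse: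
  fixes f :: "'a::real_normed_vector \<Rightarrow> real"
  assumes "open S" "Ck_on k f S" "\<And>x. x \<in> S \<Longrightarrow> f x \<noteq> 0"
  shows "Ck_on k (\<lambda>x. inverse (f x)) S"
  using assms(2)
proof (induction k)
  case 0
  then show ?case using assms(3) by (simp add: continuous_on_inverse)
next
  case (Suc k)
  have d: "((\<lambda>x. inverse (f x)) has_derivative
      (\<lambda>v. - (inverse (f x) * frechet_derivative f (at x) v * inverse (f x)))) (at x)"
    if "x \<in> S" for x
    using Suc.prems that assms(3) by (intro Deriv.has_derivative_inverse has_derivative_frechet) auto
  have "Ck_on k (\<lambda>x. - (inverse (f x) * frechet_derivative f (at x) v * inverse (f x))) S" for v
    using Suc Ck_on_Suc_imp[OF Suc.prems]
    by (intro Ck_on_bounded_linear[OF assms(1), of uminus] bounded_linear_minus bounded_linear_ident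
        Ck_on_mult assms(1)) auto
  then have "Ck_on k (\<lambda>x. frechet_derivative (\<lambda>x. inverse (f x)) (at x) v) S" for v
    by (intro Ck_on_cong[OF assms(1) frechet_derivative_eqI[OF d, symmetric]])
  then show ?case using d by (auto simp: differentiable_def)
qed

section \<open>Uniqueness of solutions of ordinary differential equations\<close>

lemma C1_imp_lipschitz_on_cball:
  fixes F :: "'a::euclidean_space \<Rightarrow> 'b::real_normed_vector"
  assumes "Ck_on 1 F S" "cball x e \<subseteq> S"
  shows "\<exists>M\<ge>0. \<forall>y\<in>cball x e. \<forall>z\<in>cball x e. norm (F y - F z) \<le> M * norm (y - z)"
proof -
  let ?D = "\<lambda>y. frechet_derivative F (at y)"
  have diff: "(F has_derivative ?D y) (at y)" if "y \<in> cball x e" for y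
    using assms that by (auto intro!: has_derivative_frechet)
  \<comment> \<open>\<open>Ck_on\<close> gives continuity of the derivative in each fixed direction
    only; the operator norm is therefore bounded by summing bounds over the basis.\<close>
  have "\<exists>M. \<forall>y\<in>cball x e. norm (?D y b) \<le> M" for b
  proof -
    have "continuous_on (cball x e) (\<lambda>y. ?D y b)"
      using assms by (auto intro: continuous_on_subset)
    then have "bounded ((\<lambda>y. ?D y b) ` cball x e)"
      by (intro compact_imp_bounded compact_continuous_image) auto
    then show ?thesis by (auto simp: bounded_iff)
  qed
  then obtain M where M: "\<And>b y. y \<in> cball x e \<Longrightarrow> norm (?D y b) \<le> M b" by metis
  define B where "B = (\<Sum>b\<in>Basis. \<bar>M b\<bar>)"
  have B: "onorm (?D y) \<le> B" if y: "y \<in> cball x e" for y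
  proof (rule onorm_bound)
    show "0 \<le> B" by (simp add: B_def sum_nonneg)
    fix v :: 'a
    have lin: "linear (?D y)" using diff[OF y] has_derivative_linear by blast
    have "?D y v = ?D y (\<Sum>b\<in>Basis. (v \<bullet> b) *\<^sub>R b)" by (simp add: euclidean_representation)
    also have "\<dots> = (\<Sum>b\<in>Basis. (v \<bullet> b) *\<^sub>R ?D y b)"
      using lin by (simp add: linear_sum linear_scale)
    finally have "norm (?D y v) \<le> (\<Sum>b\<in>Basis. norm ((v \<bullet> b) *\<^sub>R ?D y b))"
      by (metis norm_sum)
    also have "\<dots> \<le> (\<Sum>b\<in>Basis. \<bar>M b\<bar> * norm v)"
    proof (rule sum_mono)
      fix b :: 'a assume "b \<in> Basis"
      then have "\<bar>v \<bullet> b\<bar> \<le> norm v" by (simp add: Basis_le_norm)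
      moreover have "norm (?D y b) \<le> \<bar>M b\<bar>" using M[OF y, of b] by linarith
      ultimately have "\<bar>v \<bullet> b\<bar> * norm (?D y b) \<le> norm v * \<bar>M b\<bar>"
        by (intro mult_mono) auto
      then show "norm ((v \<bullet> b) *\<^sub>R ?D y b) \<le> \<bar>M b\<bar> * norm v" by (simp add: mult.commute)
    qed
    finally show "norm (?D y v) \<le> B * norm v" by (simp add: B_def sum_distrib_right)
  qed
  have "norm (F y - F z) \<le> B * norm (y - z)" if "y \<in> cball x e" "z \<in> cball x e" for y z
    by (rule differentiable_bound[OF convex_cball _ B])
      (use diff that in \<open>auto intro: has_derivative_at_withinI\<close>)
  moreover have "B \<ge> 0" by (simp add: B_def sum_nonneg)
  ultimately show ?thesis by blast
qed

text \<open>The squared distance \<open>e\<close> of two solutions satisfies \<open>e' \<le> 2 M e\<close>, so that \<open>e exp (- 2 M t)\<close> is nonincreasing.\<close>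

lemma ode_unique_lipschitz:
  fixes F :: "'a::real_inner \<Rightarrow> 'a"
  assumes lip: "\<And>y z. y \<in> S \<Longrightarrow> z \<in> S \<Longrightarrow> norm (F y - F z) \<le> M * norm (y - z)"
    and x: "\<And>t. t \<in> {a..b} \<Longrightarrow> (x has_vector_derivative F (x t)) (at t)" "\<And>t. t \<in> {a..b} \<Longrightarrow> x t \<in> S"
    and y: "\<And>t. t \<in> {a..b} \<Longrightarrow> (y has_vector_derivative F (y t)) (at t)" "\<And>t. t \<in> {a..b} \<Longrightarrow> y t \<in> S"
    and init: "x a = y a" and t: "t \<in> {a..b}"
  shows "x t = y t"
proof -
  define w where "w s = ((x s - y s) \<bullet> (x s - y s)) * exp (- 2 * M * s)" for s
  have "w t \<le> w a"
  proof (rule DERIV_nonpos_imp_nonincreasing[of a t w])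
    show "a \<le> t" using t by simp
    fix s assume s: "a \<le> s" "s \<le> t"
    then have s': "s \<in> {a..b}" using t by auto
    let ?d = "x s - y s" and ?D = "F (x s) - F (y s)"
    have "((\<lambda>s. (x s - y s) \<bullet> (x s - y s)) has_derivative (\<lambda>h. ?d \<bullet> (h *\<^sub>R F (x s) - h *\<^sub>R F (y s)) +
        (h *\<^sub>R F (x s) - h *\<^sub>R F (y s)) \<bullet> ?d)) (at s)"
      using x(1)[OF s'] y(1)[OF s'] unfolding has_vector_derivative_def
      by (intro has_derivative_inner has_derivative_diff)
    then have d1: "((\<lambda>s. (x s - y s) \<bullet> (x s - y s)) has_real_derivative 2 * (?d \<bullet> ?D)) (at s)"
      unfolding has_field_derivative_def
      by (rule has_derivative_eq_rhs) (auto simp: fun_eq_iff inner_diff algebra_simps inner_commute)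
    have "(w has_real_derivative
        (2 * (?d \<bullet> ?D)) * exp (- 2 * M * s) + (exp (- 2 * M * s) * (- 2 * M)) * (?d \<bullet> ?d)) (at s)"
      unfolding w_def by (rule DERIV_mult[OF d1]) (auto intro!: derivative_eq_intros)
    moreover have "?d \<bullet> ?D \<le> M * (?d \<bullet> ?d)"
    proof -
      have "?d \<bullet> ?D \<le> norm ?d * norm ?D" by (rule norm_cauchy_schwarz)
      also have "\<dots> \<le> norm ?d * (M * norm ?d)"
        using lip x(2)[OF s'] y(2)[OF s'] by (intro mult_left_mono) auto
      finally show ?thesis by (simp add: dot_square_norm power2_eq_square algebra_simps)
    qed
    then have "exp (- 2 * M * s) * (2 * (?d \<bullet> ?D) - 2 * M * (?d \<bullet> ?d)) \<le> 0"
      by (simp add: mult_le_0_iff)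
    then have "(2 * (?d \<bullet> ?D)) * exp (- 2 * M * s) + (exp (- 2 * M * s) * (- 2 * M)) * (?d \<bullet> ?d) \<le> 0"
      by (simp add: algebra_simps)
    ultimately show "\<exists>y. (w has_real_derivative y) (at s) \<and> y \<le> 0" by blast
  qed
  then have "w t \<le> 0" using init by (simp add: w_def)
  then have "(x t - y t) \<bullet> (x t - y t) \<le> 0" by (auto simp: w_def mult_le_0_iff)
  then show ?thesis by (metis inner_gt_zero_iff not_less eq_iff_diff_eq_0)
qed

text \<open>A C1 field is Lipschitz on balls only, but both trajectories over a compact interval lie
  in a common ball.\<close>

lemma ode_unique_UNIV:
  fixes F :: "'a::euclidean_space \<Rightarrow> 'a"
  assumes F: "Ck_on 1 F UNIV"
    and x: "\<And>t. t \<in> {a..b} \<Longrightarrow> (x has_vector_derivative F (x t)) (at t)"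
    and y: "\<And>t. t \<in> {a..b} \<Longrightarrow> (y has_vector_derivative F (y t)) (at t)"
    and init: "x a = y a" and t: "t \<in> {a..b}"
  shows "x t = y t"
proof -
  have "continuous_on {a..b} x" "continuous_on {a..b} y"
    using x y by (meson continuous_at_imp_continuous_on has_vector_derivative_continuous)+
  then have "bounded (x ` {a..b} \<union> y ` {a..b})"
    by (simp add: compact_imp_bounded compact_continuous_image)
  then obtain e z where e: "x ` {a..b} \<union> y ` {a..b} \<subseteq> cball z e"
    by (metis bounded_subset_cball)
  obtain M where "\<And>u v. u \<in> cball z e \<Longrightarrow> v \<in> cball z e \<Longrightarrow> norm (F u - F v) \<le> M * norm (u - v)"
    using C1_imp_lipschitz_on_cball[OF F, of z e] by blast
  then show ?thesis
    by (rule ode_unique_lipschitz[of "cball z e" F M a b x y]) (use x y init t e in \<open>auto simp: image_subset_iff\<close>)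
qed

text \<open>Here the field is controlled only on \<open>S\<close>, which the solutions may leave;
  continuity at \<open>a\<close> traps both in a small ball inside \<open>S\<close> for a short
  time.\<close>

lemma ode_unique_local:
  fixes F :: "'a::euclidean_space \<Rightarrow> 'a"
  assumes F: "Ck_on 1 F S" "open S" "x a \<in> S" and ab: "a < b"
    and x: "\<And>t. t \<in> {a..b} \<Longrightarrow> (x has_vector_derivative F (x t)) (at t)"
    and y: "\<And>t. t \<in> {a..b} \<Longrightarrow> (y has_vector_derivative F (y t)) (at t)"
    and init: "x a = y a"
  shows "\<exists>\<delta>>0. \<forall>t\<in>{a..a+\<delta>}. x t = y t"
proof -
  obtain e where e: "e > 0" "cball (x a) e \<subseteq> S"
    using F open_contains_cball by blast
  obtain M where M: "\<And>u w. u \<in> cball (x a) e \<Longrightarrow> w \<in> cball (x a) e \<Longrightarrow> norm (F u - F w) \<le> M * norm (u - w)"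
    using C1_imp_lipschitz_on_cball[OF F(1) e(2)] by blast
  have "isCont x a" "isCont y a"
    using x[of a] y[of a] ab by (auto intro: has_vector_derivative_continuous)
  then have "\<forall>\<^sub>F t in at a. dist (x t) (x a) < e" "\<forall>\<^sub>F t in at a. dist (y t) (y a) < e"
    using e(1) by (auto simp: isCont_def tendsto_iff)
  then have "\<forall>\<^sub>F t in at a. dist (x t) (x a) < e \<and> dist (y t) (y a) < e"
    by (rule eventually_conj)
  then obtain d where d: "d > 0" "\<And>t. t \<noteq> a \<Longrightarrow> dist t a < d \<Longrightarrow> dist (x t) (x a) < e \<and> dist (y t) (y a) < e"
    unfolding eventually_at by blast
  \<comment> \<open>Halving \<open>d\<close> turns the strict bound on the distance to
    \<open>a\<close> into one that holds on a closed interval.\<close>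
  define \<delta> where "\<delta> = min (d/2) (b - a)"
  have in_ball: "x t \<in> cball (x a) e" "y t \<in> cball (x a) e" if "t \<in> {a..a+\<delta>}" for t
    using d(2)[of t] that d(1) init e(1)
    by (cases "t = a"; auto simp: \<delta>_def dist_real_def dist_commute less_imp_le)+
  have "\<delta> > 0" using d ab by (simp add: \<delta>_def)
  moreover have "x t = y t" if "t \<in> {a..a+\<delta>}" for t
    by (rule ode_unique_lipschitz[of "cball (x a) e" F M a "a + \<delta>" x y])
      (use M x y init that in_ball in \<open>auto simp: \<delta>_def\<close>)
  ultimately show ?thesis by blast
qed

section \<open>Symmetry of second derivatives\<close>

lemma has_real_derivative_along:
  fixes f :: "'a::real_normed_vector \<Rightarrow> real"
  assumes "(f has_derivative f') (at (x + s *\<^sub>R u))"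
  shows "((\<lambda>s. f (x + s *\<^sub>R u)) has_real_derivative f' u) (at s)"
proof -
  have "((\<lambda>s. x + s *\<^sub>R u) has_derivative (\<lambda>h. h *\<^sub>R u)) (at s)"
    by (auto intro!: derivative_eq_intros)
  from has_derivative_compose[OF this assms]
  have "((\<lambda>s. f (x + s *\<^sub>R u)) has_derivative (\<lambda>h. f' (h *\<^sub>R u))) (at s)" .
  then show ?thesis
    using has_derivative_linear[OF assms] unfolding has_field_derivative_def
    by (simp add: linear_scale mult_commute_abs)
qed

text \<open>Both iterated derivatives are limits of second differences, by two applications of the mean
  value theorem.\<close>

lemma second_difference_mean_value:
  fixes f :: "'a::real_normed_vector \<Rightarrow> real"
  assumes C2: "Ck_on 2 f S" and s: "s > 0"
    and S: "\<And>a b. a \<in> {0..s} \<Longrightarrow> b \<in> {0..s} \<Longrightarrow> x + a *\<^sub>R u + b *\<^sub>R v \<in> S"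
  shows "\<exists>a\<in>{0..s}. \<exists>b\<in>{0..s}. f (x + s *\<^sub>R u + s *\<^sub>R v) - f (x + s *\<^sub>R u) - f (x + s *\<^sub>R v) + f x =
    s\<^sup>2 * frechet_derivative (\<lambda>y. frechet_derivative f (at y) u) (at (x + a *\<^sub>R u + b *\<^sub>R v)) v"
proof -
  let ?D = "\<lambda>y. frechet_derivative f (at y) u"
  have d1: "(f has_derivative frechet_derivative f (at y)) (at y)" if "y \<in> S" for y
    using C2 that by (auto intro!: has_derivative_frechet simp: numeral_2_eq_2)
  have d2: "(?D has_derivative frechet_derivative ?D (at y)) (at y)" if "y \<in> S" for y
    using C2 that by (auto intro!: has_derivative_frechet simp: numeral_2_eq_2)
  define g where "g a = f (x + s *\<^sub>R v + a *\<^sub>R u) - f (x + a *\<^sub>R u)" for a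
  have "(g has_real_derivative ?D (x + s *\<^sub>R v + a *\<^sub>R u) - ?D (x + a *\<^sub>R u)) (at a)"
    if "0 \<le> a" "a \<le> s" for a
    unfolding g_def using S[of a s] S[of a 0] that s
    by (intro DERIV_diff has_real_derivative_along d1) (auto simp: algebra_simps)
  from MVT2[OF s this] obtain a where a: "0 < a" "a < s"
    "g s - g 0 = (s - 0) * (?D (x + s *\<^sub>R v + a *\<^sub>R u) - ?D (x + a *\<^sub>R u))" by blast
  define k where "k b = ?D (x + a *\<^sub>R u + b *\<^sub>R v)" for b
  have "(k has_real_derivative frechet_derivative ?D (at (x + a *\<^sub>R u + b *\<^sub>R v)) v) (at b)"
    if "0 \<le> b" "b \<le> s" for b
    unfolding k_def using S[of a b] that s a
    by (intro has_real_derivative_along d2) auto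
  from MVT2[OF s this] obtain b where b: "0 < b" "b < s"
    "k s - k 0 = (s - 0) * frechet_derivative ?D (at (x + a *\<^sub>R u + b *\<^sub>R v)) v" by blast
  have "f (x + s *\<^sub>R u + s *\<^sub>R v) - f (x + s *\<^sub>R u) - f (x + s *\<^sub>R v) + f x = g s - g 0"
    by (simp add: g_def algebra_simps)
  also have "\<dots> = s * (k s - k 0)" using a by (simp add: k_def algebra_simps)
  also have "\<dots> = s\<^sup>2 * frechet_derivative ?D (at (x + a *\<^sub>R u + b *\<^sub>R v)) v"
    using b by (simp add: power2_eq_square)
  finally show ?thesis using a b by (meson atLeastAtMost_iff less_imp_le)
qed

lemma symmetric_second_derivative_real:
  fixes f :: "'a::real_normed_vector \<Rightarrow> real"
  assumes S: "open S" "x \<in> S" and C2: "Ck_on 2 f S"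
  shows "frechet_derivative (\<lambda>y. frechet_derivative f (at y) u) (at x) v =
    frechet_derivative (\<lambda>y. frechet_derivative f (at y) v) (at x) u"
proof -
  let ?D = "\<lambda>u v y. frechet_derivative (\<lambda>y. frechet_derivative f (at y) u) (at y) v"
  have "\<bar>?D u v x - ?D v u x\<bar> \<le> \<epsilon>" if "\<epsilon> > 0" for \<epsilon>
  proof -
    have "\<exists>e>0. \<forall>y. dist y x < e \<longrightarrow> \<bar>?D u v y - ?D u v x\<bar> < \<epsilon>/2" for u v
    proof -
      have "continuous_on S (?D u v)" using C2 by (simp add: numeral_2_eq_2)
      then have "isCont (?D u v) x" using S by (simp add: continuous_on_eq_continuous_at)
      then have "\<exists>e>0. \<forall>y. dist y x < e \<longrightarrow> dist (?D u v y) (?D u v x) < \<epsilon>/2"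
        using \<open>\<epsilon> > 0\<close> unfolding continuous_at_eps_delta by (metis half_gt_zero)
      then show ?thesis by (simp add: dist_real_def)
    qed
    then obtain e1 e2 where e: "e1 > 0" "e2 > 0"
      "\<And>y. dist y x < e1 \<Longrightarrow> \<bar>?D u v y - ?D u v x\<bar> < \<epsilon>/2"
      "\<And>y. dist y x < e2 \<Longrightarrow> \<bar>?D v u y - ?D v u x\<bar> < \<epsilon>/2" by metis
    obtain e3 where e3: "e3 > 0" "ball x e3 \<subseteq> S" using S open_contains_ball by blast
    define e where "e = min e3 (min e1 e2)"
    \<comment> \<open>With this side length the whole parallelogram spanned by s u and s v stays
      within e/2 of \<open>x\<close>; the summand 1 keeps the denominator positive for u = v =
      0.\<close>
    define s where "s = e / (2 * (1 + norm u + norm v))"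
    have pos: "1 + norm u + norm v > 0" by (simp add: add_pos_nonneg)
    have "e > 0" using e e3 by (simp add: e_def)
    then have s: "s > 0" using pos by (simp add: s_def)
    have near: "dist (x + a *\<^sub>R u + b *\<^sub>R v) x < e" if "a \<in> {0..s}" "b \<in> {0..s}" for a b
    proof -
      have "norm (a *\<^sub>R u + b *\<^sub>R v) \<le> a * norm u + b * norm v"
        using that norm_triangle_ineq[of "a *\<^sub>R u" "b *\<^sub>R v"] by simp
      also have "\<dots> \<le> s * norm u + s * norm v"
        using that by (intro add_mono mult_right_mono) auto
      also have "\<dots> \<le> s * (1 + norm u + norm v)" using s by (simp add: algebra_simps)
      also have "\<dots> = e / 2" using pos by (simp add: s_def field_simps)
      finally show ?thesis using \<open>e > 0\<close> by (simp add: dist_norm add.assoc)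
    qed
    have inS: "x + a *\<^sub>R u + b *\<^sub>R v \<in> S" if "a \<in> {0..s}" "b \<in> {0..s}" for a b
      using near[OF that] e3 by (auto simp: e_def dist_commute subset_iff)
    obtain P where P: "dist P x < e"
      "f (x + s *\<^sub>R u + s *\<^sub>R v) - f (x + s *\<^sub>R u) - f (x + s *\<^sub>R v) + f x = s\<^sup>2 * ?D u v P"
      using second_difference_mean_value[OF C2 s, of x u v] inS near by blast
    have inS': "x + a *\<^sub>R v + b *\<^sub>R u \<in> S" and near': "dist (x + a *\<^sub>R v + b *\<^sub>R u) x < e"
      if "a \<in> {0..s}" "b \<in> {0..s}" for a b
      using inS[OF that(2,1)] near[OF that(2,1)] by (simp_all add: add_ac)
    obtain Q where Q: "dist Q x < e"
      "f (x + s *\<^sub>R v + s *\<^sub>R u) - f (x + s *\<^sub>R v) - f (x + s *\<^sub>R u) + f x = s\<^sup>2 * ?D v u Q"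
      using second_difference_mean_value[OF C2 s, of x v u] inS' near' by blast
    have "f (x + s *\<^sub>R u + s *\<^sub>R v) - f (x + s *\<^sub>R u) - f (x + s *\<^sub>R v) + f x =
        f (x + s *\<^sub>R v + s *\<^sub>R u) - f (x + s *\<^sub>R v) - f (x + s *\<^sub>R u) + f x"
      by (simp add: add_ac)
    then have "s\<^sup>2 * ?D u v P = s\<^sup>2 * ?D v u Q" unfolding P(2) Q(2) .
    moreover have "s\<^sup>2 \<noteq> 0" using s by simp
    ultimately have eq: "?D u v P = ?D v u Q"
      by (rule mult_left_cancel[THEN iffD1, rotated])
    have "dist P x < e1" "dist Q x < e2" using P(1) Q(1) by (simp_all add: e_def)
    note e(3)[OF this(1)] e(4)[OF this(2)]
    moreover have "\<bar>A - B\<bar> \<le> \<epsilon>" if "\<bar>C - A\<bar> < \<epsilon>/2" "\<bar>C' - B\<bar> < \<epsilon>/2" "C = C'" for A B C C' :: real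
      using that by linarith
    ultimately show ?thesis using eq by blast
  qed
  then have "\<bar>?D u v x - ?D v u x\<bar> \<le> 0 + \<epsilon>" if "\<epsilon> > 0" for \<epsilon>
    using that by (metis add_0)
  then have "\<bar>?D u v x - ?D v u x\<bar> \<le> 0" by (rule field_le_epsilon)
  then show ?thesis by (rule abs_le_zero_iff[THEN iffD1, THEN eq_iff_diff_eq_0[THEN iffD2]])
qed

text \<open>Pairing with a basis vector commutes with differentiation, so the real-valued case
  applies to each component.\<close>

lemma symmetric_second_derivative:
  fixes f :: "'a::real_normed_vector \<Rightarrow> 'b::euclidean_space"
  assumes S: "open S" "x \<in> S" and C2: "Ck_on 2 f S"
  shows "frechet_derivative (\<lambda>y. frechet_derivative f (at y) u) (at x) v =
    frechet_derivative (\<lambda>y. frechet_derivative f (at y) v) (at x) u"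
proof (rule euclidean_eqI)
  fix b :: 'b
  let ?fb = "\<lambda>y. f y \<bullet> b"
  have C: "Ck_on 2 ?fb S"
    by (rule Ck_on_bounded_linear[OF S(1) _ C2]) (simp add: bounded_linear_inner_left)
  have 1: "frechet_derivative ?fb (at y) u = frechet_derivative f (at y) u \<bullet> b" if "y \<in> S" for y u
  proof -
    have "f differentiable (at y)" using C2 that by (simp add: numeral_2_eq_2)
    from has_derivative_inner_left[OF has_derivative_frechet[OF this], of b]
    show ?thesis by (rule frechet_derivative_eqI)
  qed
  have 2: "frechet_derivative (\<lambda>y. frechet_derivative ?fb (at y) u) (at x) v =
      frechet_derivative (\<lambda>y. frechet_derivative f (at y) u) (at x) v \<bullet> b" for u v
  proof (rule frechet_derivative_eqI)
    have "((\<lambda>y. frechet_derivative f (at y) u \<bullet> b) has_derivative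
        (\<lambda>v. frechet_derivative (\<lambda>y. frechet_derivative f (at y) u) (at x) v \<bullet> b)) (at x)"
    proof (intro has_derivative_inner_left has_derivative_frechet)
      have "Ck_on (Suc 1) f S" using C2 by (simp only: Suc_1)
      then have "Ck_on 1 (\<lambda>y. frechet_derivative f (at y) u) S" by (simp only: Ck_on.simps)
      then show "(\<lambda>y. frechet_derivative f (at y) u) differentiable (at x)" using S(2) by simp
    qed
    then show "((\<lambda>y. frechet_derivative ?fb (at y) u) has_derivative
        (\<lambda>v. frechet_derivative (\<lambda>y. frechet_derivative f (at y) u) (at x) v \<bullet> b)) (at x)"
      by (rule has_derivative_transform_within_open[OF _ S]) (simp only: 1)
  qed
  show "frechet_derivative (\<lambda>y. frechet_derivative f (at y) u) (at x) v \<bullet> b =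
    frechet_derivative (\<lambda>y. frechet_derivative f (at y) v) (at x) u \<bullet> b"
    using symmetric_second_derivative_real[OF S C, of u v] unfolding 2 .
qed

section \<open>Riemannian metrics in a coordinate patch\<close>

lemma Ck_on_vec:
  fixes f :: "'a::real_normed_vector \<Rightarrow> real ^ 'n"
  assumes "open S" "\<And>i. Ck_on k (\<lambda>x. f x $ i) S"
  shows "Ck_on k f S"
proof -
  have "Ck_on k (\<lambda>x. \<Sum>i\<in>UNIV. (f x $ i) *\<^sub>R (axis i 1 :: real ^ 'n)) S"
    by (intro Ck_on_sum assms(1) Ck_on_bounded_linear[OF assms(1) bounded_linear_scaleR_left assms(2)])
  moreover have "(\<lambda>x. \<Sum>i\<in>UNIV. (f x $ i) *\<^sub>R axis i 1) = f"
    by (simp add: fun_eq_iff vec_eq_iff axis_def if_distrib cong: if_cong)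
  ultimately show ?thesis by (simp only:)
qed

lemma Ck_on_vec_nth:
  fixes f :: "'a::real_normed_vector \<Rightarrow> 'b::real_normed_vector ^ 'n"
  shows "open S \<Longrightarrow> Ck_on k f S \<Longrightarrow> Ck_on k (\<lambda>x. f x $ i) S"
  by (rule Ck_on_bounded_linear[OF _ bounded_linear_vec_nth])

lemma smooth_on_derivative: "smooth_on f S \<Longrightarrow> Ck_on k (\<lambda>x. frechet_derivative f (at x) v) S"
  unfolding smooth_on_def using Ck_on.simps(2) by blast

lemma smooth_on_has_derivative:
  assumes "smooth_on f S" "x \<in> S"
  shows "(f has_derivative frechet_derivative f (at x)) (at x)"
proof -
  have "Ck_on 1 f S" using assms by (simp add: smooth_on_def)
  then show ?thesis using assms by (intro has_derivative_frechet) simp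
qed

lemma matrix_inv_inverse:
  assumes "invertible (A :: 'a::semiring_1 ^ 'n ^ 'm)"
  shows "A ** matrix_inv A = mat 1" "matrix_inv A ** A = mat 1"
  using someI_ex[OF assms[unfolded invertible_def]] by (simp_all add: matrix_inv_def)

text \<open>Cramer's rule. Written with products and \<open>inverse\<close>, it exhibits the entries
  in a form covered by \<open>Ck_on_mult\<close> and \<open>Ck_on_inverse\<close>.\<close>

lemma matrix_inv_2:
  fixes A :: "real ^ 2 ^ 2"
  assumes "invertible A"
  shows "matrix_inv A $ 1 $ 1 = A $ 2 $ 2 * inverse (A $ 1 $ 1 * A $ 2 $ 2 - A $ 1 $ 2 * A $ 2 $ 1)"
    "matrix_inv A $ 1 $ 2 = - A $ 1 $ 2 * inverse (A $ 1 $ 1 * A $ 2 $ 2 - A $ 1 $ 2 * A $ 2 $ 1)"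
    "matrix_inv A $ 2 $ 1 = - A $ 2 $ 1 * inverse (A $ 1 $ 1 * A $ 2 $ 2 - A $ 1 $ 2 * A $ 2 $ 1)"
    "matrix_inv A $ 2 $ 2 = A $ 1 $ 1 * inverse (A $ 1 $ 1 * A $ 2 $ 2 - A $ 1 $ 2 * A $ 2 $ 1)"
proof -
  have d: "A $ 1 $ 1 * A $ 2 $ 2 - A $ 1 $ 2 * A $ 2 $ 1 \<noteq> 0"
    using assms by (simp add: invertible_det_nz det_2)
  have div: "x = y * inverse (A $ 1 $ 1 * A $ 2 $ 2 - A $ 1 $ 2 * A $ 2 $ 1)"
    if "x * (A $ 1 $ 1 * A $ 2 $ 2 - A $ 1 $ 2 * A $ 2 $ 1) = y" for x y
    using d that by (metis mult.assoc mult.right_neutral right_inverse)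
  have "(A ** matrix_inv A) $ i $ j = mat 1 $ i $ j" for i j
    using matrix_inv_inverse(1)[OF assms] by simp
  then have e: "A $ i $ 1 * matrix_inv A $ 1 $ j + A $ i $ 2 * matrix_inv A $ 2 $ j = (if i = j then 1 else 0)"
    for i j by (simp add: matrix_matrix_mult_def sum_2 mat_def)
  have "matrix_inv A $ 1 $ 1 * (A $ 1 $ 1 * A $ 2 $ 2 - A $ 1 $ 2 * A $ 2 $ 1) = A $ 2 $ 2"
    using e[of 1 1] e[of 2 1] by simp algebra
  moreover have "matrix_inv A $ 1 $ 2 * (A $ 1 $ 1 * A $ 2 $ 2 - A $ 1 $ 2 * A $ 2 $ 1) = - A $ 1 $ 2"
    using e[of 1 2] e[of 2 2] by simp algebra
  moreover have "matrix_inv A $ 2 $ 1 * (A $ 1 $ 1 * A $ 2 $ 2 - A $ 1 $ 2 * A $ 2 $ 1) = - A $ 2 $ 1"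
    using e[of 1 1] e[of 2 1] by simp algebra
  moreover have "matrix_inv A $ 2 $ 2 * (A $ 1 $ 1 * A $ 2 $ 2 - A $ 1 $ 2 * A $ 2 $ 1) = A $ 1 $ 1"
    using e[of 1 2] e[of 2 2] by simp algebra
  ultimately show
    "matrix_inv A $ 1 $ 1 = A $ 2 $ 2 * inverse (A $ 1 $ 1 * A $ 2 $ 2 - A $ 1 $ 2 * A $ 2 $ 1)"
    "matrix_inv A $ 1 $ 2 = - A $ 1 $ 2 * inverse (A $ 1 $ 1 * A $ 2 $ 2 - A $ 1 $ 2 * A $ 2 $ 1)"
    "matrix_inv A $ 2 $ 1 = - A $ 2 $ 1 * inverse (A $ 1 $ 1 * A $ 2 $ 2 - A $ 1 $ 2 * A $ 2 $ 1)"
    "matrix_inv A $ 2 $ 2 = A $ 1 $ 1 * inverse (A $ 1 $ 1 * A $ 2 $ 2 - A $ 1 $ 2 * A $ 2 $ 1)"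
    by - (rule div, assumption)+
qed

section \<open>Levi-Civita calculus of a metric on an open set of the plane\<close>

locale planar_metric =
  fixes U :: "(real ^ 2) set" and G :: "real ^ 2 \<Rightarrow> real ^ 2 ^ 2"
  assumes open_U: "open U" and smooth_G: "smooth_on G U"
    and G_sym: "y \<in> U \<Longrightarrow> transpose (G y) = G y"
    and G_pos: "y \<in> U \<Longrightarrow> v \<noteq> 0 \<Longrightarrow> v \<bullet> (G y *v v) > 0"
begin

definition ip :: "real ^ 2 \<Rightarrow> real ^ 2 \<Rightarrow> real ^ 2 \<Rightarrow> real" where
  "ip y a b = a \<bullet> (G y *v b)"

abbreviation DG :: "real ^ 2 \<Rightarrow> real ^ 2 \<Rightarrow> real ^ 2 ^ 2" where
  "DG y \<equiv> frechet_derivative G (at y)"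

definition dip :: "real ^ 2 \<Rightarrow> real ^ 2 \<Rightarrow> real ^ 2 \<Rightarrow> real ^ 2 \<Rightarrow> real" where
  "dip y v a b = a \<bullet> (DG y v *v b)"

text \<open>The Christoffel symbols as a bilinear map: \<nabla>_v X is the plain derivative plus
  \<open>Gam y v X\<close>, and the geodesic equation reads v' = - \<open>Gam y v v\<close>.\<close>

definition Gam :: "real ^ 2 \<Rightarrow> real ^ 2 \<Rightarrow> real ^ 2 \<Rightarrow> real ^ 2" where
  "Gam y a b = (\<chi> k. \<Sum>i\<in>UNIV. \<Sum>j\<in>UNIV. christoffel G k i j y * a $ i * b $ j)"

lemma G_sym_nth: "y \<in> U \<Longrightarrow> G y $ i $ j = G y $ j $ i"
  using arg_cong[OF G_sym, of y "\<lambda>M. M $ j $ i"] by (simp add: transpose_def)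

lemma ip_commute: "y \<in> U \<Longrightarrow> ip y a b = ip y b a"
  by (simp add: ip_def inner_vec_def matrix_vector_mult_def sum_2 G_sym_nth[of y 2 1] algebra_simps)

lemma ip_simps:
  "ip y (a + b) c = ip y a c + ip y b c" "ip y a (b + c) = ip y a b + ip y a c"
  "ip y (a - b) c = ip y a c - ip y b c" "ip y a (b - c) = ip y a b - ip y a c"
  "ip y (s *\<^sub>R a) b = s * ip y a b" "ip y a (s *\<^sub>R b) = s * ip y a b"
  "ip y (- a) b = - ip y a b" "ip y a (- b) = - ip y a b"
  by (simp_all add: ip_def inner_vec_def matrix_vector_mult_def sum_2 algebra_simps)

lemma ip_eq_0: "y \<in> U \<Longrightarrow> ip y a a = 0 \<Longrightarrow> a = 0"
  using G_pos[of y a] by (force simp: ip_def)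

lemma G_invertible: "y \<in> U \<Longrightarrow> invertible (G y)"
proof -
  assume y: "y \<in> U"
  have "x = 0" if "G y *v x = 0" for x
    using ip_eq_0[OF y, of x] that by (simp add: ip_def)
  then show ?thesis
    by (simp add: invertible_left_inverse matrix_left_invertible_ker)
qed

lemma DG: "y \<in> U \<Longrightarrow> (G has_derivative DG y) (at y)"
  using smooth_on_has_derivative[OF smooth_G] by blast

lemma DG_nth: "y \<in> U \<Longrightarrow> ((\<lambda>z. G z $ i $ j) has_derivative (\<lambda>v. DG y v $ i $ j)) (at y)"
  by (intro bounded_linear.has_derivative[OF bounded_linear_vec_nth] DG)

lemma partial_G: "y \<in> U \<Longrightarrow> partial i (\<lambda>z. G z $ j $ l) y = DG y (axis i 1) $ j $ l"
  unfolding partial_def by (rule frechet_derivative_eqI[OF DG_nth])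

lemma DG_sym_nth: "y \<in> U \<Longrightarrow> DG y v $ i $ j = DG y v $ j $ i"
proof -
  assume y: "y \<in> U"
  have "((\<lambda>z. G z $ i $ j) has_derivative (\<lambda>v. DG y v $ j $ i)) (at y)"
    by (rule has_derivative_transform_within_open[OF DG_nth open_U y]) (use y G_sym_nth in auto)
  from has_derivative_unique[OF this DG_nth[OF y]] show ?thesis by metis
qed

lemma DG_expand: "y \<in> U \<Longrightarrow> DG y v = v $ 1 *\<^sub>R DG y (axis 1 1) + v $ 2 *\<^sub>R DG y (axis 2 1)"
proof -
  assume y: "y \<in> U"
  have lin: "linear (DG y)" using DG[OF y] has_derivative_linear by blast
  have "v = v $ 1 *\<^sub>R axis 1 1 + v $ 2 *\<^sub>R axis 2 1"
    by (simp add: vec_eq_iff forall_2 axis_def)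
  then have "DG y v = DG y (v $ 1 *\<^sub>R axis 1 1 + v $ 2 *\<^sub>R axis 2 1)" by simp
  also have "\<dots> = v $ 1 *\<^sub>R DG y (axis 1 1) + v $ 2 *\<^sub>R DG y (axis 2 1)"
    using lin by (simp add: linear_add linear_scale)
  finally show ?thesis .
qed

lemma dip_expand: "y \<in> U \<Longrightarrow> dip y v a b =
    (\<Sum>i\<in>UNIV. \<Sum>j\<in>UNIV. \<Sum>k\<in>UNIV. DG y (axis i 1) $ j $ k * v $ i * a $ j * b $ k)"
  unfolding dip_def
  by (subst DG_expand) (simp_all add: inner_vec_def matrix_vector_mult_def sum_2 algebra_simps)

text \<open>Lowering the upper index cancels \<open>matrix_inv (G y)\<close> and leaves the
  Christoffel symbols of the first kind.\<close>

lemma christoffel_lower: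
  assumes y: "y \<in> U"
  shows "(\<Sum>k\<in>UNIV. G y $ m $ k * christoffel G k i j y) =
    1/2 * (DG y (axis i 1) $ j $ m + DG y (axis j 1) $ i $ m - DG y (axis m 1) $ i $ j)"
proof -
  define T :: "real ^ 2" where
    "T = (\<chi> l. DG y (axis i 1) $ j $ l + DG y (axis j 1) $ i $ l - DG y (axis l 1) $ i $ j)"
  have c: "(\<chi> k. christoffel G k i j y) = (1/2) *\<^sub>R (matrix_inv (G y) *v T)"
    by (simp add: vec_eq_iff christoffel_def partial_G[OF y] T_def matrix_vector_mult_def)
  have "G y *v (\<chi> k. christoffel G k i j y) = (1/2) *\<^sub>R T"
    unfolding c
    by (simp add: matrix_vector_mult_scaleR matrix_vector_mul_assoc
        matrix_inv_inverse[OF G_invertible[OF y]])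
  then have "(G y *v (\<chi> k. christoffel G k i j y)) $ m = 1/2 * T $ m" by simp
  then show ?thesis by (simp add: matrix_vector_mult_def T_def)
qed

text \<open>Koszul's formula for fields with constant components. It contains the compatibility of
  the connection with the metric, and the identities along curves below are derived from it instead
  of from index computations.\<close>

lemma ip_Gam:
  assumes y: "y \<in> U"
  shows "2 * ip y (Gam y a b) c = dip y a b c + dip y b a c - dip y c a b"
proof -
  have "(G y *v Gam y a b) $ m =
      (\<Sum>i\<in>UNIV. \<Sum>j\<in>UNIV. a $ i * b $ j * (\<Sum>k\<in>UNIV. G y $ m $ k * christoffel G k i j y))" for m
    by (simp add: Gam_def matrix_vector_mult_def sum_2 algebra_simps)
  then have *: "(G y *v Gam y a b) $ m = (\<Sum>i\<in>UNIV. \<Sum>j\<in>UNIV. a $ i * b $ j *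
      (1/2 * (DG y (axis i 1) $ j $ m + DG y (axis j 1) $ i $ m - DG y (axis m 1) $ i $ j)))" for m
    by (simp only: christoffel_lower[OF y])
  have "2 * ip y (Gam y a b) c = 2 * (c \<bullet> (G y *v Gam y a b))"
    using ip_commute[OF y] by (simp add: ip_def)
  also have "\<dots> = dip y a b c + dip y b a c - dip y c a b"
    unfolding dip_expand[OF y] inner_vec_def
    by (simp add: * sum_2 DG_sym_nth[OF y, of _ 2 1] algebra_simps)
  finally show ?thesis .
qed

lemma dip_commute: "y \<in> U \<Longrightarrow> dip y v a b = dip y v b a"
  by (simp add: dip_def inner_vec_def matrix_vector_mult_def sum_2 DG_sym_nth[of y _ 2 1] algebra_simps)

lemma covariant_derivative_eq:
  assumes "(X has_derivative X') (at y)"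
  shows "covariant_derivative G X y *v v = X' v + Gam y v (X y)"
proof -
  have p: "partial j (\<lambda>z. X z $ i) y = X' (axis j 1) $ i" for i j
    unfolding partial_def
    by (intro frechet_derivative_eqI bounded_linear.has_derivative[OF bounded_linear_vec_nth] assms)
  have lin: "linear X'" using assms has_derivative_linear by blast
  have "v = v $ 1 *\<^sub>R axis 1 1 + v $ 2 *\<^sub>R axis 2 1"
    by (simp add: vec_eq_iff forall_2 axis_def)
  then have "X' v = X' (v $ 1 *\<^sub>R axis 1 1 + v $ 2 *\<^sub>R axis 2 1)" by simp
  then have "X' v = v $ 1 *\<^sub>R X' (axis 1 1) + v $ 2 *\<^sub>R X' (axis 2 1)"
    using lin by (simp add: linear_add linear_scale)
  then show ?thesis
    by (simp add: vec_eq_iff covariant_derivative_def p Gam_def matrix_vector_mult_def sum_2 algebra_simps)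
qed

text \<open>Leibniz rule with plain derivatives of \<open>a\<close> and \<open>b\<close>: the
  variation of the Gram matrix along the curve appears as the \<open>dip\<close> term, which later
  cancels against Christoffel terms.\<close>

lemma ip_has_real_derivative:
  assumes \<sigma>: "(\<sigma> has_vector_derivative \<sigma>') (at t)" and U: "\<sigma> t \<in> U"
    and a: "(a has_vector_derivative a') (at t)" and b: "(b has_vector_derivative b') (at t)"
  shows "((\<lambda>s. ip (\<sigma> s) (a s) (b s)) has_real_derivative
    dip (\<sigma> t) \<sigma>' (a t) (b t) + ip (\<sigma> t) a' (b t) + ip (\<sigma> t) (a t) b') (at t)"
proof -
  have "((\<lambda>s. G (\<sigma> s)) has_vector_derivative DG (\<sigma> t) \<sigma>') (at t)"
    using \<sigma> DG[OF U] vector_derivative_diff_chain_within[of \<sigma> \<sigma>' t UNIV G "DG (\<sigma> t)"]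
    by (simp add: o_def has_derivative_at_withinI)
  then have [derivative_intros]: "((\<lambda>s. G (\<sigma> s) $ i $ j) has_real_derivative DG (\<sigma> t) \<sigma>' $ i $ j) (at t)" for i j
    unfolding has_real_derivative_iff_has_vector_derivative
    by (intro bounded_linear.has_vector_derivative[OF bounded_linear_vec_nth])
  have [derivative_intros]: "((\<lambda>s. a s $ i) has_real_derivative a' $ i) (at t)"
     "((\<lambda>s. b s $ i) has_real_derivative b' $ i) (at t)" for i
    using a b unfolding has_real_derivative_iff_has_vector_derivative
    by (auto intro: bounded_linear.has_vector_derivative[OF bounded_linear_vec_nth])
  show ?thesis
    unfolding ip_def dip_def inner_vec_def matrix_vector_mult_def sum_2
    by (auto intro!: derivative_eq_intros simp: sum_2 algebra_simps)
qed

lemma ip_grad: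
  assumes y: "y \<in> U" and h: "(h has_derivative h') (at y)"
  shows "ip y v (grad_chart G h y) = h' v"
proof -
  have p: "partial i h y = h' (axis i 1)" for i
    unfolding partial_def by (rule frechet_derivative_eqI[OF h])
  have lin: "linear h'" using h has_derivative_linear by blast
  have "v = v $ 1 *\<^sub>R axis 1 1 + v $ 2 *\<^sub>R axis 2 1"
    by (simp add: vec_eq_iff forall_2 axis_def)
  then have "h' v = h' (v $ 1 *\<^sub>R axis 1 1 + v $ 2 *\<^sub>R axis 2 1)" by simp
  then have "h' v = v $ 1 * h' (axis 1 1) + v $ 2 * h' (axis 2 1)"
    using lin by (simp add: linear_add linear_scale)
  moreover have "ip y v (grad_chart G h y) = v \<bullet> (\<chi> i. partial i h y)"
    by (simp add: ip_def grad_chart_def matrix_vector_mul_assoc matrix_inv_inverse[OF G_invertible[OF y]])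
  ultimately show ?thesis by (simp add: inner_vec_def sum_2 p)
qed

section \<open>Smoothness of the inverse metric, the Christoffel symbols and the geodesic
  field\<close>

lemma Ck_on_G_nth: "Ck_on k (\<lambda>y. G y $ i $ j) U"
  using smooth_G by (intro Ck_on_vec_nth open_U) (simp add: smooth_on_def)

lemma Ck_on_DG_nth: "Ck_on k (\<lambda>y. DG y v $ i $ j) U"
  by (intro Ck_on_vec_nth open_U smooth_on_derivative smooth_G)

lemma Ck_on_matrix_inv: "Ck_on k (\<lambda>y. matrix_inv (G y) $ i $ j) U"
proof -
  let ?d = "\<lambda>y. G y $ 1 $ 1 * G y $ 2 $ 2 - G y $ 1 $ 2 * G y $ 2 $ 1"
  have minus: "Ck_on k (\<lambda>y. - f y) U" if "Ck_on k f U" for f :: "real ^ 2 \<Rightarrow> real"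
    by (rule Ck_on_bounded_linear[OF open_U bounded_linear_minus[OF bounded_linear_ident] that])
  have "Ck_on k ?d U"
    unfolding diff_conv_add_uminus
    by (intro Ck_on_add minus Ck_on_mult Ck_on_G_nth open_U)
  moreover have "?d y \<noteq> 0" if "y \<in> U" for y
    using G_invertible[OF that] by (simp add: invertible_det_nz det_2)
  ultimately have inv: "Ck_on k (\<lambda>y. inverse (?d y)) U"
    by (intro Ck_on_inverse open_U)
  have 11: "Ck_on k (\<lambda>y. matrix_inv (G y) $ 1 $ 1) U"
    by (rule Ck_on_cong[OF open_U _ Ck_on_mult[OF open_U Ck_on_G_nth[of k 2 2] inv]])
      (simp add: matrix_inv_2 G_invertible)
  have 12: "Ck_on k (\<lambda>y. matrix_inv (G y) $ 1 $ 2) U"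
    by (rule Ck_on_cong[OF open_U _ Ck_on_mult[OF open_U minus[OF Ck_on_G_nth[of k 1 2]] inv]])
      (simp add: matrix_inv_2 G_invertible)
  have 21: "Ck_on k (\<lambda>y. matrix_inv (G y) $ 2 $ 1) U"
    by (rule Ck_on_cong[OF open_U _ Ck_on_mult[OF open_U minus[OF Ck_on_G_nth[of k 2 1]] inv]])
      (simp add: matrix_inv_2 G_invertible)
  have 22: "Ck_on k (\<lambda>y. matrix_inv (G y) $ 2 $ 2) U"
    by (rule Ck_on_cong[OF open_U _ Ck_on_mult[OF open_U Ck_on_G_nth[of k 1 1] inv]])
      (simp add: matrix_inv_2 G_invertible)
  show ?thesis using exhaust_2[of i] exhaust_2[of j] 11 12 21 22 by auto
qed

lemma Ck_on_christoffel: "Ck_on k (christoffel G l i j) U"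
proof -
  have "Ck_on k (\<lambda>y. (1/2) * (\<Sum>m\<in>UNIV. matrix_inv (G y) $ l $ m *
      (DG y (axis i 1) $ j $ m + DG y (axis j 1) $ i $ m + (-1) * DG y (axis m 1) $ i $ j))) U"
    by (intro Ck_on_mult Ck_on_const Ck_on_sum Ck_on_add Ck_on_matrix_inv Ck_on_DG_nth open_U)
  then show ?thesis
    by (rule Ck_on_cong[OF open_U, rotated]) (simp add: christoffel_def partial_G)
qed

lemma Ck_on_grad_chart:
  assumes "smooth_on h U"
  shows "Ck_on k (grad_chart G h) U"
proof (rule Ck_on_vec[OF open_U])
  fix i
  have "Ck_on k (\<lambda>y. \<Sum>j\<in>UNIV. matrix_inv (G y) $ i $ j * frechet_derivative h (at y) (axis j 1)) U"
    using smooth_on_derivative[OF assms]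
    by (intro Ck_on_sum Ck_on_mult Ck_on_matrix_inv open_U)
  then show "Ck_on k (\<lambda>y. grad_chart G h y $ i) U"
    by (simp add: grad_chart_def matrix_vector_mult_def partial_def)
qed

text \<open>Geodesics are the integral curves of this field on pairs of position and velocity. It is
  controlled over \<open>U\<close> only, so uniqueness comes from
  \<open>ode_unique_local\<close>.\<close>

lemma Ck_on_geodesic_field: "Ck_on k (\<lambda>z. (snd z, - Gam (fst z) (snd z) (snd z))) (U \<times> UNIV)"
proof -
  let ?S = "U \<times> (UNIV :: (real ^ 2) set)"
  have S: "open ?S" by (simp add: open_U open_Times)
  have chr: "Ck_on k (\<lambda>z. christoffel G l i j (fst z)) ?S" for l i j
    by (rule Ck_on_compose_linear[OF open_U bounded_linear_fst Ck_on_christoffel S]) auto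
  have snd: "Ck_on k (\<lambda>z. snd z $ i) ?S" for i
    by (intro Ck_on_vec_nth S Ck_on_linear bounded_linear_snd)
  have "Ck_on k (\<lambda>z. \<Sum>i\<in>UNIV. \<Sum>j\<in>UNIV. christoffel G l i j (fst z) * snd z $ i * snd z $ j) ?S" for l
    by (intro Ck_on_sum Ck_on_mult chr snd S)
  then have Gam: "Ck_on k (\<lambda>z. Gam (fst z) (snd z) (snd z)) ?S"
    by (intro Ck_on_vec S) (simp add: Gam_def)
  have L: "bounded_linear (\<lambda>x :: real ^ 2. (0 :: real ^ 2, - x))"
    by (intro bounded_linear_Pair bounded_linear_zero bounded_linear_minus bounded_linear_ident)
  from Gam have "Ck_on k (\<lambda>z. (0, - Gam (fst z) (snd z) (snd z)) :: (real^2) \<times> (real^2)) ?S"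
    by (rule Ck_on_bounded_linear[OF S L])
  moreover have "Ck_on k (\<lambda>z. (snd z, 0) :: (real^2) \<times> (real^2)) ?S"
    by (intro Ck_on_linear S bounded_linear_Pair bounded_linear_zero bounded_linear_snd)
  ultimately have "Ck_on k (\<lambda>z. (snd z, 0) + (0, - Gam (fst z) (snd z) (snd z))) ?S"
    by (intro Ck_on_add S)
  then show ?thesis by simp
qed

lemma geodesic_unique_local:
  assumes ab: "a < b" and U: "\<sigma>1 a \<in> U"
    and 1: "\<And>t. t \<in> {a..b} \<Longrightarrow> (\<sigma>1 has_vector_derivative v1 t) (at t)"
      "\<And>t. t \<in> {a..b} \<Longrightarrow> (v1 has_vector_derivative - Gam (\<sigma>1 t) (v1 t) (v1 t)) (at t)"
    and 2: "\<And>t. t \<in> {a..b} \<Longrightarrow> (\<sigma>2 has_vector_derivative v2 t) (at t)"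
      "\<And>t. t \<in> {a..b} \<Longrightarrow> (v2 has_vector_derivative - Gam (\<sigma>2 t) (v2 t) (v2 t)) (at t)"
    and init: "\<sigma>1 a = \<sigma>2 a" "v1 a = v2 a"
  shows "\<exists>\<delta>>0. \<forall>t\<in>{a..a+\<delta>}. \<sigma>1 t = \<sigma>2 t"
proof -
  have "\<exists>\<delta>>0. \<forall>t\<in>{a..a+\<delta>}. (\<sigma>1 t, v1 t) = (\<sigma>2 t, v2 t)"
    by (rule ode_unique_local[OF Ck_on_geodesic_field, where b = b])
      (use assms open_U in \<open>auto intro: has_vector_derivative_Pair open_Times\<close>)
  then show ?thesis by auto
qed

end

section \<open>The equation \<open>Hess h = F(h) Id\<close> along geodesics\<close>

lemma real_derivative_zero_imp_const:
  fixes f :: "real \<Rightarrow> real"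
  assumes "a \<le> t" "\<And>s. s \<in> {a..t} \<Longrightarrow> (f has_real_derivative 0) (at s)"
  shows "f t = f a"
proof (cases "a = t")
  case False
  then have "a < t" using assms(1) by simp
  moreover have "continuous_on {a..t} f"
    using assms(2) by (intro continuous_at_imp_continuous_on ballI) (rule DERIV_isCont)
  ultimately show ?thesis
    using assms by (intro DERIV_isconst2[of a t f t]) auto
qed simp

lemma has_vector_derivative_compose:
  assumes "(\<sigma> has_vector_derivative \<sigma>') (at t)" "(f has_derivative f') (at (\<sigma> t))"
  shows "((\<lambda>s. f (\<sigma> s)) has_vector_derivative f' \<sigma>') (at t)"
  using vector_derivative_diff_chain_within[of \<sigma> \<sigma>' t UNIV f f'] assms
  by (simp add: o_def has_derivative_at_withinI)

text \<open>Only the shape of the Hessian equation is kept. Since the factor depends on the point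
  through \<open>h\<close> alone, the equation for \<open>h\<close> along a unit speed geodesic is
  autonomous and the same for all geodesics.\<close>

locale planar_hessian = planar_metric +
  fixes h F :: "_ \<Rightarrow> real"
  assumes h_smooth: "smooth_on h U"
    and F: "Ck_on 1 F UNIV"
    and hess: "y \<in> U \<Longrightarrow> covariant_derivative G (grad_chart G h) y = mat (F (h y))"
begin

abbreviation N :: "real ^ 2 \<Rightarrow> real ^ 2" where
  "N \<equiv> grad_chart G h"

abbreviation DN :: "real ^ 2 \<Rightarrow> real ^ 2 \<Rightarrow> real ^ 2" where
  "DN y \<equiv> frechet_derivative N (at y)"

lemma DN: "y \<in> U \<Longrightarrow> (N has_derivative DN y) (at y)"
  using Ck_on_grad_chart[OF h_smooth, of 1] by (intro has_derivative_frechet) simp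

text \<open>The Hessian equation solved for the plain derivative of the gradient, as the Leibniz
  rule along curves requires.\<close>

lemma DN_eq: "y \<in> U \<Longrightarrow> DN y v = F (h y) *\<^sub>R v - Gam y v (N y)"
proof -
  assume y: "y \<in> U"
  have "mat (F (h y)) *v v = F (h y) *\<^sub>R v"
    by (simp add: vec_eq_iff matrix_vector_mult_def mat_def sum_2 forall_2)
  then show ?thesis
    using covariant_derivative_eq[OF DN[OF y], of v] hess[OF y] by (simp add: algebra_simps)
qed

lemma ip_N: "y \<in> U \<Longrightarrow> ip y v (N y) = frechet_derivative h (at y) v"
  by (intro ip_grad smooth_on_has_derivative[OF h_smooth])

context
  fixes \<sigma> v :: "real \<Rightarrow> real ^ 2" and t :: real
  assumes U: "\<sigma> t \<in> U" and \<sigma>: "(\<sigma> has_vector_derivative v t) (at t)"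
begin

lemma N_along: "((\<lambda>s. N (\<sigma> s)) has_vector_derivative DN (\<sigma> t) (v t)) (at t)"
  by (rule has_vector_derivative_compose[OF \<sigma> DN[OF U]])

lemma h_along: "((\<lambda>s. h (\<sigma> s)) has_real_derivative ip (\<sigma> t) (v t) (N (\<sigma> t))) (at t)"
  unfolding has_real_derivative_iff_has_vector_derivative ip_N[OF U]
  by (rule has_vector_derivative_compose[OF \<sigma> smooth_on_has_derivative[OF h_smooth U]])

text \<open>This is 2 \<langle>\<nabla>_v N, N\<rangle> with \<nabla>_v N = F v; it holds along any
  curve with velocity v.\<close>

lemma norm_N_along:
  "((\<lambda>s. ip (\<sigma> s) (N (\<sigma> s)) (N (\<sigma> s))) has_real_derivative
    2 * F (h (\<sigma> t)) * ip (\<sigma> t) (v t) (N (\<sigma> t))) (at t)"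
  using ip_has_real_derivative[OF \<sigma> U N_along N_along]
  by (rule back_subst[where P = "\<lambda>d. (_ has_real_derivative d) _"])
    (use ip_Gam[OF U, of "v t" "N (\<sigma> t)" "N (\<sigma> t)"] dip_commute[OF U, of "N (\<sigma> t)" "v t" "N (\<sigma> t)"]
      ip_commute[OF U, of "N (\<sigma> t)"] in \<open>simp add: DN_eq[OF U] ip_simps algebra_simps\<close>)

text \<open>The hypothesis on \<open>Y'\<close> is \<nabla>_v Y = (F/k') Y in disguise: by symmetry
  of the Christoffel symbols, adding the term \<open>Gam\<close> of \<open>N\<close> and
  \<open>Y\<close> to both sides turns \<open>DN\<close> applied to \<open>Y\<close> into F Y. It
  arises by differentiating the relation N = k' v in the direction of \<open>Y\<close>.\<close>

lemma norm_transported_along: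
  assumes N: "N (\<sigma> t) = k' *\<^sub>R v t" and Y: "(Y has_vector_derivative Y') (at t)"
    and Y': "k' *\<^sub>R Y' = DN (\<sigma> t) (Y t)" and k': "k' \<noteq> 0"
  shows "((\<lambda>s. ip (\<sigma> s) (Y s) (Y s)) has_real_derivative
    2 * F (h (\<sigma> t)) / k' * ip (\<sigma> t) (Y t) (Y t)) (at t)"
proof -
  let ?y = "\<sigma> t"
  have "k' * dip ?y (v t) (Y t) (Y t) = dip ?y (N ?y) (Y t) (Y t)"
  proof -
    have "DG ?y (N ?y) = k' *\<^sub>R DG ?y (v t)"
      unfolding N by (rule linear_scale[OF has_derivative_linear[OF DG[OF U]]])
    then show ?thesis by (simp add: dip_def scaleR_matrix_vector_assoc[symmetric])
  qed
  moreover have "k' * ip ?y Y' (Y t) = F (h ?y) * ip ?y (Y t) (Y t) - ip ?y (Gam ?y (Y t) (N ?y)) (Y t)"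
    unfolding ip_simps(5)[symmetric] Y' DN_eq[OF U] by (simp add: ip_simps)
  moreover have "2 * ip ?y (Gam ?y (Y t) (N ?y)) (Y t) = dip ?y (N ?y) (Y t) (Y t)"
    using ip_Gam[OF U, of "Y t" "N ?y" "Y t"] dip_commute[OF U, of "Y t" "Y t"] by simp
  ultimately have "k' * (dip ?y (v t) (Y t) (Y t) + ip ?y Y' (Y t) + ip ?y (Y t) Y') =
      2 * F (h ?y) * ip ?y (Y t) (Y t)"
    using ip_commute[OF U, of Y' "Y t"] by (simp add: algebra_simps)
  then have "dip ?y (v t) (Y t) (Y t) + ip ?y Y' (Y t) + ip ?y (Y t) Y' =
      2 * F (h ?y) / k' * ip ?y (Y t) (Y t)"
    using k' by (simp add: field_simps)
  then show ?thesis using ip_has_real_derivative[OF \<sigma> U Y Y] by simp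
qed

context
  assumes v: "(v has_vector_derivative - Gam (\<sigma> t) (v t) (v t)) (at t)"
begin

lemma speed_along: "((\<lambda>s. ip (\<sigma> s) (v s) (v s)) has_real_derivative 0) (at t)"
  using ip_has_real_derivative[OF \<sigma> U v v]
  by (rule back_subst[where P = "\<lambda>d. (_ has_real_derivative d) _"])
    (use ip_Gam[OF U, of "v t" "v t" "v t"] ip_commute[OF U, of "v t"] in \<open>simp add: ip_simps\<close>)

text \<open>Along a geodesic the second derivative of \<open>h\<close> is the Hessian form
  \<langle>\<nabla>_v N, v\<rangle>, which is F |v|^2 here.\<close>

lemma h'_along:
  "((\<lambda>s. ip (\<sigma> s) (v s) (N (\<sigma> s))) has_real_derivative F (h (\<sigma> t)) * ip (\<sigma> t) (v t) (v t)) (at t)"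
  using ip_has_real_derivative[OF \<sigma> U v N_along]
  by (rule back_subst[where P = "\<lambda>d. (_ has_real_derivative d) _"])
    (use ip_Gam[OF U, of "v t" "v t" "N (\<sigma> t)"] ip_Gam[OF U, of "v t" "N (\<sigma> t)" "v t"]
      ip_commute[OF U, of "v t" "Gam (\<sigma> t) (v t) (N (\<sigma> t))"] dip_commute[OF U, of "v t" "v t" "N (\<sigma> t)"]
      in \<open>simp add: DN_eq[OF U] ip_simps\<close>)

end

end

text \<open>The squared length of \<open>N\<close> and the square of \<open>\<langle>v, N\<rangle>\<close> have the same derivative along
  the geodesic, which forces equality in the Cauchy-Schwarz inequality.\<close>

lemma radial_geodesic:
  assumes geo: "\<And>s. s \<in> {0..<\<epsilon>} \<Longrightarrow> \<sigma> s \<in> U"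
      "\<And>s. s \<in> {0..<\<epsilon>} \<Longrightarrow> (\<sigma> has_vector_derivative v s) (at s)"
      "\<And>s. s \<in> {0..<\<epsilon>} \<Longrightarrow> (v has_vector_derivative - Gam (\<sigma> s) (v s) (v s)) (at s)"
    and unit: "ip (\<sigma> 0) (v 0) (v 0) = 1" and crit: "N (\<sigma> 0) = 0"
    and t: "t \<in> {0..<\<epsilon>}"
  shows "ip (\<sigma> t) (v t) (v t) = 1"
    and "((\<lambda>s. ip (\<sigma> s) (v s) (N (\<sigma> s))) has_real_derivative F (h (\<sigma> t))) (at t)"
    and "N (\<sigma> t) = ip (\<sigma> t) (v t) (N (\<sigma> t)) *\<^sub>R v t"
proof -
  have 1: "ip (\<sigma> s) (v s) (v s) = 1" if "s \<in> {0..<\<epsilon>}" for s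
    using real_derivative_zero_imp_const[of 0 s "\<lambda>s. ip (\<sigma> s) (v s) (v s)"]
      speed_along[of \<sigma> _ v] geo unit that by simp
  then show "ip (\<sigma> t) (v t) (v t) = 1" using t .
  let ?k' = "\<lambda>s. ip (\<sigma> s) (v s) (N (\<sigma> s))"
  have 2: "(?k' has_real_derivative F (h (\<sigma> s))) (at s)" if "s \<in> {0..<\<epsilon>}" for s
    using h'_along[of \<sigma> s v] geo 1 that by simp
  then show "(?k' has_real_derivative F (h (\<sigma> t))) (at t)" using t .
  have "((\<lambda>s. ip (\<sigma> s) (N (\<sigma> s)) (N (\<sigma> s)) - ?k' s * ?k' s) has_real_derivative 0) (at s)"
    if "s \<in> {0..<\<epsilon>}" for s
    by (rule DERIV_cong[OF DERIV_diff[OF norm_N_along[of \<sigma> s v] DERIV_mult[OF 2[OF that] 2[OF that]]]])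
      (use geo that in auto)
  from real_derivative_zero_imp_const[OF _ this, of 0 t] t
  have 3: "ip (\<sigma> t) (N (\<sigma> t)) (N (\<sigma> t)) = ?k' t * ?k' t"
    using crit by (simp add: ip_def)
  have U: "\<sigma> t \<in> U" using geo t by blast
  have "ip (\<sigma> t) (N (\<sigma> t) - ?k' t *\<^sub>R v t) (N (\<sigma> t) - ?k' t *\<^sub>R v t) = 0"
    using 1[OF t] 3 ip_commute[OF U, of "N (\<sigma> t)" "v t"] by (simp add: ip_simps algebra_simps)
  from ip_eq_0[OF U this] show "N (\<sigma> t) = ?k' t *\<^sub>R v t" by simp
qed

text \<open>The equation k'' = F(k) is treated as a first-order system for (k, k'). As
  \<open>F\<close> is C1 on the whole line, uniqueness holds on the full interval at once.\<close>

lemma radial_unique: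
  assumes 1: "\<And>s. s \<in> {0..t} \<Longrightarrow> (k1 has_real_derivative l1 s) (at s)"
      "\<And>s. s \<in> {0..t} \<Longrightarrow> (l1 has_real_derivative F (k1 s)) (at s)"
    and 2: "\<And>s. s \<in> {0..t} \<Longrightarrow> (k2 has_real_derivative l2 s) (at s)"
      "\<And>s. s \<in> {0..t} \<Longrightarrow> (l2 has_real_derivative F (k2 s)) (at s)"
    and init: "k1 0 = k2 0" "l1 0 = l2 0" and t: "t \<ge> 0"
  shows "k1 t = k2 t \<and> l1 t = l2 t"
proof -
  have "Ck_on 1 (\<lambda>z. (snd z, 0) + (0, F (fst z)) :: real \<times> real) UNIV"
  proof (rule Ck_on_add)
    show "Ck_on 1 (\<lambda>z::real \<times> real. (snd z, 0::real)) UNIV"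
      by (intro Ck_on_linear open_UNIV bounded_linear_Pair bounded_linear_zero bounded_linear_snd)
    have L: "bounded_linear (\<lambda>x::real. (0::real, x))"
      by (intro bounded_linear_Pair bounded_linear_zero bounded_linear_ident)
    show "Ck_on 1 (\<lambda>z::real \<times> real. (0::real, F (fst z))) UNIV"
      by (intro Ck_on_bounded_linear[OF open_UNIV L]
          Ck_on_compose_linear[OF open_UNIV bounded_linear_fst F]) auto
  qed simp
  then have F2: "Ck_on 1 (\<lambda>z. (snd z, F (fst z)) :: real \<times> real) UNIV" by simp
  have "(k1 t, l1 t) = (k2 t, l2 t)"
    by (rule ode_unique_UNIV[OF F2, where a = 0 and b = t])
      (use assms in \<open>auto intro!: has_vector_derivative_Pair simp: has_real_derivative_iff_has_vector_derivative\<close>)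
  then show ?thesis by simp
qed

end

section \<open>Geodesic polar coordinates in a patch\<close>

text \<open>A one-sided neighbourhood already determines a derivative. This matters at endpoints,
  where two curves are known to agree on one side only.\<close>

lemma has_vector_derivative_unique_on_interval:
  assumes "a < b" "t \<in> {a..b}" "(f has_vector_derivative f') (at t)" "(g has_vector_derivative g') (at t)"
    "\<And>s. s \<in> {a..b} \<Longrightarrow> f s = g s"
  shows "f' = g'"
proof (rule vector_derivative_unique_within_closed_interval)
  show "(f has_vector_derivative f') (at t within cbox a b)"
    using assms(3) by (rule has_vector_derivative_at_within)
  show "(f has_vector_derivative g') (at t within cbox a b)"
    by (rule has_vector_derivative_transform[OF _ _ has_vector_derivative_at_within[OF assms(4)]])
      (use assms in auto)
qed (use assms in auto)

text \<open>Here \<open>\<phi>\<close> is the exponential map in coordinates, composed with an orthonormal frame.\<close>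

locale planar_polar = planar_hessian +
  fixes \<phi> :: "complex \<Rightarrow> real ^ 2" and \<epsilon> :: real
  assumes eps: "\<epsilon> > 0"
    and \<phi>_C2: "Ck_on 2 \<phi> (ball 0 \<epsilon>)"
    and \<phi>_U: "z \<in> ball 0 \<epsilon> \<Longrightarrow> \<phi> z \<in> U"
    and rays: "norm \<omega> = 1 \<Longrightarrow> \<exists>\<sigma> v. \<forall>t\<in>{0..<\<epsilon>}. \<sigma> t = \<phi> (t *\<^sub>R \<omega>) \<and>
      (\<sigma> has_vector_derivative v t) (at t) \<and>
      (v has_vector_derivative - Gam (\<sigma> t) (v t) (v t)) (at t)"
    and isometry: "norm w = 1 \<Longrightarrow>
      ip (\<phi> 0) (frechet_derivative \<phi> (at 0) w) (frechet_derivative \<phi> (at 0) w) = 1"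
    and crit: "N (\<phi> 0) = 0"
    and nondegenerate: "F (h (\<phi> 0)) \<noteq> 0"
begin

abbreviation D\<phi> :: "complex \<Rightarrow> complex \<Rightarrow> real ^ 2" where
  "D\<phi> z \<equiv> frechet_derivative \<phi> (at z)"

lemma D\<phi>: "z \<in> ball 0 \<epsilon> \<Longrightarrow> (\<phi> has_derivative D\<phi> z) (at z)"
  using \<phi>_C2 by (intro has_derivative_frechet) (simp add: numeral_2_eq_2)

lemma ray_in_ball: "norm \<omega> = 1 \<Longrightarrow> t \<in> {0..<\<epsilon>} \<Longrightarrow> t *\<^sub>R \<omega> \<in> ball 0 \<epsilon>"
  by simp

lemma D\<phi>_ray:
  assumes "norm \<omega> = 1" "t \<in> {0..<\<epsilon>}"
  shows "((\<lambda>s. \<phi> (s *\<^sub>R \<omega>)) has_vector_derivative D\<phi> (t *\<^sub>R \<omega>) \<omega>) (at t)"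
proof -
  have "((\<lambda>s. s *\<^sub>R \<omega>) has_vector_derivative \<omega>) (at t)"
    by (auto intro!: derivative_eq_intros)
  from has_vector_derivative_compose[OF this D\<phi>[OF ray_in_ball[OF assms]]] show ?thesis .
qed

text \<open>The direction 1 serves as reference; \<open>radial\<close> shows that every unit
  direction yields the same profile.\<close>

definition k :: "real \<Rightarrow> real" where
  "k t = h (\<phi> (t *\<^sub>R 1))"

definition k' :: "real \<Rightarrow> real" where
  "k' t = ip (\<phi> (t *\<^sub>R 1)) (D\<phi> (t *\<^sub>R 1) 1) (N (\<phi> (t *\<^sub>R 1)))"

text \<open>\<open>\<sigma>\<close> and \<open>v\<close> are separate functions because their
  agreement with the ray of \<open>\<phi>\<close> is known for 0 \<le> t < \<epsilon> only, whereas
  derivatives at t = 0 also involve negative t.\<close>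

definition unit_ray :: "complex \<Rightarrow> (real \<Rightarrow> real ^ 2) \<Rightarrow> (real \<Rightarrow> real ^ 2) \<Rightarrow> bool" where
  "unit_ray \<omega> \<sigma> v \<longleftrightarrow> (\<forall>t\<in>{0..<\<epsilon>}. \<sigma> t = \<phi> (t *\<^sub>R \<omega>) \<and> v t = D\<phi> (t *\<^sub>R \<omega>) \<omega> \<and>
    ip (\<sigma> t) (v t) (v t) = 1 \<and> N (\<sigma> t) = ip (\<sigma> t) (v t) (N (\<sigma> t)) *\<^sub>R v t \<and>
    ((\<lambda>s. h (\<sigma> s)) has_real_derivative ip (\<sigma> t) (v t) (N (\<sigma> t))) (at t) \<and>
    ((\<lambda>s. ip (\<sigma> s) (v s) (N (\<sigma> s))) has_real_derivative F (h (\<sigma> t))) (at t))"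

lemma unit_rayD:
  assumes "unit_ray \<omega> \<sigma> v" "t \<in> {0..<\<epsilon>}"
  shows "\<sigma> t = \<phi> (t *\<^sub>R \<omega>)" "v t = D\<phi> (t *\<^sub>R \<omega>) \<omega>"
    and "ip (\<sigma> t) (v t) (v t) = 1" "N (\<sigma> t) = ip (\<sigma> t) (v t) (N (\<sigma> t)) *\<^sub>R v t"
    and "((\<lambda>s. h (\<sigma> s)) has_real_derivative ip (\<sigma> t) (v t) (N (\<sigma> t))) (at t)"
    and "((\<lambda>s. ip (\<sigma> s) (v s) (N (\<sigma> s))) has_real_derivative F (h (\<sigma> t))) (at t)"
  using assms unfolding unit_ray_def by blast+

lemma unit_ray_exists:
  assumes \<omega>: "norm \<omega> = 1"
  shows "\<exists>\<sigma> v. unit_ray \<omega> \<sigma> v"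
proof -
  obtain \<sigma> v where *: "\<And>t. t \<in> {0..<\<epsilon>} \<Longrightarrow> \<sigma> t = \<phi> (t *\<^sub>R \<omega>)"
      "\<And>t. t \<in> {0..<\<epsilon>} \<Longrightarrow> (\<sigma> has_vector_derivative v t) (at t)"
      "\<And>t. t \<in> {0..<\<epsilon>} \<Longrightarrow> (v has_vector_derivative - Gam (\<sigma> t) (v t) (v t)) (at t)"
    using rays[OF \<omega>] by blast
  have U: "\<sigma> t \<in> U" if "t \<in> {0..<\<epsilon>}" for t
    unfolding *(1)[OF that] by (intro \<phi>_U ray_in_ball \<omega> that)
  have v: "v t = D\<phi> (t *\<^sub>R \<omega>) \<omega>" if "t \<in> {0..<\<epsilon>}" for t
  proof (rule has_vector_derivative_unique_on_interval[OF _ _ *(2)[OF that] D\<phi>_ray[OF \<omega> that]])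
    \<comment> \<open>The interval extends to the right of \<open>t\<close>, since at t = 0 nothing
      is known on the left.\<close>
    show "t < (t + \<epsilon>) / 2" "t \<in> {t..(t + \<epsilon>) / 2}" using that by simp_all
    show "\<sigma> s = \<phi> (s *\<^sub>R \<omega>)" if "s \<in> {t..(t + \<epsilon>) / 2}" for s
      using that \<open>t \<in> {0..<\<epsilon>}\<close> by (intro *(1)) auto
  qed
  have unit: "ip (\<sigma> 0) (v 0) (v 0) = 1" and crit': "N (\<sigma> 0) = 0"
    using eps *(1)[of 0] v[of 0] isometry[of \<omega>] \<omega> crit by simp_all
  have "((\<lambda>s. h (\<sigma> s)) has_real_derivative ip (\<sigma> t) (v t) (N (\<sigma> t))) (at t)"
    if "t \<in> {0..<\<epsilon>}" for t
    by (rule h_along[of \<sigma> t v, OF U[OF that] *(2)[OF that]])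
  then have "unit_ray \<omega> \<sigma> v"
    using *(1) v radial_geodesic[OF U *(2,3) unit crit'] unfolding unit_ray_def by blast
  then show ?thesis by blast
qed

lemma radial:
  assumes "norm \<omega> = 1" "t \<in> {0..<\<epsilon>}"
  shows "h (\<phi> (t *\<^sub>R \<omega>)) = k t"
    and "ip (\<phi> (t *\<^sub>R \<omega>)) (D\<phi> (t *\<^sub>R \<omega>) \<omega>) (D\<phi> (t *\<^sub>R \<omega>) \<omega>) = 1"
    and "N (\<phi> (t *\<^sub>R \<omega>)) = k' t *\<^sub>R D\<phi> (t *\<^sub>R \<omega>) \<omega>"
proof -
  obtain \<sigma> v where "unit_ray \<omega> \<sigma> v" using unit_ray_exists[OF assms(1)] by blast
  note * = unit_rayD[OF this]
  obtain \<sigma>1 v1 where "unit_ray 1 \<sigma>1 v1" using unit_ray_exists[of 1] by auto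
  note 1 = unit_rayD[OF this]
  have z: "0 \<in> {0..<\<epsilon>}" using eps by simp
  have "h (\<sigma> t) = h (\<sigma>1 t) \<and> ip (\<sigma> t) (v t) (N (\<sigma> t)) = ip (\<sigma>1 t) (v1 t) (N (\<sigma>1 t))"
  proof (rule radial_unique[where ?k1.0 = "\<lambda>s. h (\<sigma> s)" and ?k2.0 = "\<lambda>s. h (\<sigma>1 s)" and
        ?l1.0 = "\<lambda>s. ip (\<sigma> s) (v s) (N (\<sigma> s))" and ?l2.0 = "\<lambda>s. ip (\<sigma>1 s) (v1 s) (N (\<sigma>1 s))"])
    show "h (\<sigma> 0) = h (\<sigma>1 0)" using *(1)[OF z] 1(1)[OF z] by simp
    show "ip (\<sigma> 0) (v 0) (N (\<sigma> 0)) = ip (\<sigma>1 0) (v1 0) (N (\<sigma>1 0))"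
      using *(1)[OF z] 1(1)[OF z] crit by (simp add: ip_def)
  qed (use *(5,6) 1(5,6) assms(2) in auto)
  then show "h (\<phi> (t *\<^sub>R \<omega>)) = k t" "N (\<phi> (t *\<^sub>R \<omega>)) = k' t *\<^sub>R D\<phi> (t *\<^sub>R \<omega>) \<omega>"
    using *(1,2,4)[OF assms(2)] 1(1,2)[OF assms(2)] by (simp_all only: k_def k'_def)
  show "ip (\<phi> (t *\<^sub>R \<omega>)) (D\<phi> (t *\<^sub>R \<omega>) \<omega>) (D\<phi> (t *\<^sub>R \<omega>) \<omega>) = 1"
    using *(1-3)[OF assms(2)] by (simp only:)
qed

text \<open>The statements near 0 come from k'(0) = 0 and k''(0) = \<open>F (h (\<phi> 0))\<close>,
  which is nonzero. The sign will allow a square root to be taken, and the limit normalises the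
  length of \<partial>_\<phi> at the centre.\<close>

lemma k_derivatives:
  assumes "t \<in> {0<..<\<epsilon>}"
  shows "(k has_real_derivative k' t) (at t)" "(k' has_real_derivative F (k t)) (at t)"
    and "\<exists>d>0. \<forall>s\<in>{0<..<d}. k' s / F (h (\<phi> 0)) > 0"
    and "((\<lambda>s. k' s / s) \<longlongrightarrow> F (h (\<phi> 0))) (at_right 0)"
proof -
  obtain \<sigma> v where "unit_ray 1 \<sigma> v" using unit_ray_exists[of 1] by auto
  note 1 = unit_rayD[OF this]
  \<comment> \<open>\<open>l\<close> coincides with \<open>k'\<close> on [0, \<epsilon>) and has the
    two-sided derivative at 0 from which the one-sided statements about \<open>k'\<close>
    follow.\<close>
  define l where "l s = ip (\<sigma> s) (v s) (N (\<sigma> s))" for s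
  have k: "h (\<sigma> s) = k s" and l: "l s = k' s" if "s \<in> {0..<\<epsilon>}" for s
    using 1(1,2)[OF that] by (simp_all only: k_def k'_def l_def)
  have dk: "((\<lambda>s. h (\<sigma> s)) has_real_derivative l s) (at s)"
    and dl: "(l has_real_derivative F (h (\<sigma> s))) (at s)" if "s \<in> {0..<\<epsilon>}" for s
    using 1(5,6)[OF that] unfolding l_def[abs_def] .
  have t: "t \<in> {0..<\<epsilon>}" using assms by auto
  have "(k has_real_derivative l t) (at t)"
    by (rule has_field_derivative_transform_within_open[OF dk[OF t], where S = "{0<..<\<epsilon>}"])
      (use assms k in auto)
  then show "(k has_real_derivative k' t) (at t)" using l[OF t] by simp
  have "(k' has_real_derivative F (h (\<sigma> t))) (at t)"
    by (rule has_field_derivative_transform_within_open[OF dl[OF t], where S = "{0<..<\<epsilon>}"])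
      (use assms l in auto)
  then show "(k' has_real_derivative F (k t)) (at t)" using k[OF t] by simp
  have z: "0 \<in> {0..<\<epsilon>}" using eps by simp
  let ?f = "F (h (\<phi> 0))"
  have l0: "l 0 = 0" using 1(1)[OF z] crit by (simp add: l_def ip_def)
  have d0: "(l has_real_derivative ?f) (at 0)" using dl[OF z] 1(1)[OF z] by simp
  \<comment> \<open>Division by \<open>?f\<close> makes the derivative 1, so both signs of
    \<open>?f\<close> are treated at once.\<close>
  have "((\<lambda>s. l s / ?f) has_real_derivative ?f / ?f) (at 0)"
    by (rule DERIV_cdivide[OF d0])
  then obtain d where d: "d > 0" "\<And>s. s > 0 \<Longrightarrow> s < d \<Longrightarrow> l 0 / ?f < l (0 + s) / ?f"
    using DERIV_pos_inc_right[of "\<lambda>s. l s / ?f" "?f / ?f" 0] nondegenerate by auto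
  have "\<forall>s\<in>{0<..<min d \<epsilon>}. k' s / ?f > 0"
    using d(2) l l0 by fastforce
  then show "\<exists>d>0. \<forall>s\<in>{0<..<d}. k' s / ?f > 0"
    using d(1) eps by (intro exI[of _ "min d \<epsilon>"]) auto
  have "((\<lambda>s. (l (0 + s) - l 0) / s) \<longlongrightarrow> ?f) (at 0)"
    using d0 by (simp add: DERIV_def)
  then have "((\<lambda>s. l s / s) \<longlongrightarrow> ?f) (at_right 0)"
    using l0 by (auto intro: tendsto_within_subset simp: filterlim_at_split)
  moreover have "\<forall>\<^sub>F s in at_right 0. l s / s = k' s / s"
    unfolding eventually_at_right_field using eps l by auto
  ultimately show "((\<lambda>s. k' s / s) \<longlongrightarrow> ?f) (at_right 0)"
    by (rule Lim_transform_eventually)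
qed

section \<open>The angular field along rays\<close>

abbreviation D2\<phi> :: "complex \<Rightarrow> complex \<Rightarrow> complex \<Rightarrow> real ^ 2" where
  "D2\<phi> z u w \<equiv> frechet_derivative (\<lambda>y. D\<phi> y u) (at z) w"

lemma D2\<phi>: "z \<in> ball 0 \<epsilon> \<Longrightarrow> ((\<lambda>y. D\<phi> y u) has_derivative D2\<phi> z u) (at z)"
  using \<phi>_C2 by (intro has_derivative_frechet) (simp add: numeral_2_eq_2)

lemma D2\<phi>_commute: "z \<in> ball 0 \<epsilon> \<Longrightarrow> D2\<phi> z u w = D2\<phi> z w u"
  by (rule symmetric_second_derivative[OF open_ball _ \<phi>_C2])

lemma D\<phi>_linear: "z \<in> ball 0 \<epsilon> \<Longrightarrow> linear (D\<phi> z)"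
  using D\<phi> has_derivative_linear by blast

lemma D2\<phi>_linear: "z \<in> ball 0 \<epsilon> \<Longrightarrow> linear (D2\<phi> z u)"
  using D2\<phi> has_derivative_linear by blast

lemma complex_scaleR_expand: "z = Re z *\<^sub>R 1 + Im z *\<^sub>R \<i>"
  by (simp add: complex_eq_iff)

text \<open>Differentiating \<open>\<bar>z\<bar> N(\<phi>(z)) = k'(\<bar>z\<bar>) D\<phi>(z) z\<close> along the circle through \<open>z\<close>.\<close>

lemma tangential_derivative:
  assumes \<omega>: "norm \<omega> = 1" and t: "t \<in> {0<..<\<epsilon>}"
  shows "t *\<^sub>R DN (\<phi> (t *\<^sub>R \<omega>)) (D\<phi> (t *\<^sub>R \<omega>) (\<i> * (t *\<^sub>R \<omega>))) =
    k' t *\<^sub>R (D2\<phi> (t *\<^sub>R \<omega>) (\<i> * (t *\<^sub>R \<omega>)) (t *\<^sub>R \<omega>) + D\<phi> (t *\<^sub>R \<omega>) (\<i> * (t *\<^sub>R \<omega>)))"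
    and "ip (\<phi> (t *\<^sub>R \<omega>)) (D\<phi> (t *\<^sub>R \<omega>) (\<i> * (t *\<^sub>R \<omega>))) (N (\<phi> (t *\<^sub>R \<omega>))) = 0"
proof -
  define z where "z = t *\<^sub>R \<omega>"
  have t': "t \<in> {0..<\<epsilon>}" using t by auto
  have z: "z \<in> ball 0 \<epsilon>" unfolding z_def by (rule ray_in_ball[OF \<omega> t'])
  \<comment> \<open>On this circle of radius \<open>t\<close> both \<open>h\<close> and the factor
    \<open>k' t\<close> are constant.\<close>
  define \<zeta> where "\<zeta> s = z * cis s" for s
  have \<zeta>0: "\<zeta> 0 = z" by (simp add: \<zeta>_def)
  have \<zeta>: "(\<zeta> has_vector_derivative \<i> * z) (at 0)"
  proof -
    have "((\<lambda>w. z * exp (\<i> * w)) has_field_derivative \<i> * z) (at (of_real 0))"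
      by (auto intro!: derivative_eq_intros)
    from has_vector_derivative_real_field[OF this] show ?thesis
      by (simp add: \<zeta>_def[abs_def] cis_conv_exp)
  qed
  have \<zeta>_eq: "\<zeta> s = t *\<^sub>R (\<omega> * cis s)" "norm (\<omega> * cis s) = 1" for s
    using \<omega> by (simp_all add: \<zeta>_def z_def norm_mult)
  have \<zeta>_ball: "\<zeta> s \<in> ball 0 \<epsilon>" for s
    unfolding \<zeta>_eq(1) by (rule ray_in_ball[OF \<zeta>_eq(2) t'])
  have d\<phi>: "((\<lambda>s. \<phi> (\<zeta> s)) has_vector_derivative D\<phi> z (\<i> * z)) (at 0)"
    using has_vector_derivative_compose[OF \<zeta>, of \<phi> "D\<phi> z"] D\<phi>[OF z] by (simp add: \<zeta>0)
  have U: "\<phi> z \<in> U" by (rule \<phi>_U[OF z])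
  have "((\<lambda>s. t *\<^sub>R N (\<phi> (\<zeta> s))) has_vector_derivative t *\<^sub>R DN (\<phi> z) (D\<phi> z (\<i> * z))) (at 0)"
    using has_vector_derivative_compose[OF d\<phi>, of N "DN (\<phi> z)"] DN[OF U]
    by (intro bounded_linear.has_vector_derivative[OF bounded_linear_scaleR_right]) (simp add: \<zeta>0)
  \<comment> \<open>\<open>D2\<phi>\<close> differentiates \<open>D\<phi>\<close> in a fixed
    direction argument, so the moving direction \<open>\<zeta> s\<close> is first expanded in the
    basis 1, \<i>.\<close>
  moreover have "t *\<^sub>R N (\<phi> (\<zeta> s)) = k' t *\<^sub>R (Re (\<zeta> s) *\<^sub>R D\<phi> (\<zeta> s) 1 + Im (\<zeta> s) *\<^sub>R D\<phi> (\<zeta> s) \<i>)" for s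
  proof -
    have "N (\<phi> (\<zeta> s)) = k' t *\<^sub>R D\<phi> (\<zeta> s) (\<omega> * cis s)"
      using radial(3)[OF \<zeta>_eq(2) t'] by (simp only: \<zeta>_eq(1))
    then have "t *\<^sub>R N (\<phi> (\<zeta> s)) = k' t *\<^sub>R (t *\<^sub>R D\<phi> (\<zeta> s) (\<omega> * cis s))" by simp
    also have "t *\<^sub>R D\<phi> (\<zeta> s) (\<omega> * cis s) = D\<phi> (\<zeta> s) (t *\<^sub>R (\<omega> * cis s))"
      by (rule linear_scale[OF D\<phi>_linear[OF \<zeta>_ball], symmetric])
    also have "\<dots> = D\<phi> (\<zeta> s) (\<zeta> s)" by (simp only: \<zeta>_eq(1))
    also have "\<dots> = D\<phi> (\<zeta> s) (Re (\<zeta> s) *\<^sub>R 1 + Im (\<zeta> s) *\<^sub>R \<i>)"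
      by (rule arg_cong[OF complex_scaleR_expand])
    also have "\<dots> = Re (\<zeta> s) *\<^sub>R D\<phi> (\<zeta> s) 1 + Im (\<zeta> s) *\<^sub>R D\<phi> (\<zeta> s) \<i>"
      by (simp only: linear_add[OF D\<phi>_linear[OF \<zeta>_ball]] linear_scale[OF D\<phi>_linear[OF \<zeta>_ball]])
    finally show ?thesis .
  qed
  ultimately have 1: "((\<lambda>s. k' t *\<^sub>R (Re (\<zeta> s) *\<^sub>R D\<phi> (\<zeta> s) 1 + Im (\<zeta> s) *\<^sub>R D\<phi> (\<zeta> s) \<i>)) has_vector_derivative
      t *\<^sub>R DN (\<phi> z) (D\<phi> z (\<i> * z))) (at 0)" by (simp only:)
  have re: "((\<lambda>s. Re (\<zeta> s)) has_vector_derivative Re (\<i> * z)) (at 0)"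
    and im: "((\<lambda>s. Im (\<zeta> s)) has_vector_derivative Im (\<i> * z)) (at 0)"
    by (rule bounded_linear.has_vector_derivative[OF bounded_linear_Re \<zeta>]
        bounded_linear.has_vector_derivative[OF bounded_linear_Im \<zeta>])+
  have d: "((\<lambda>s. D\<phi> (\<zeta> s) u) has_vector_derivative D2\<phi> z u (\<i> * z)) (at 0)" for u
    using has_vector_derivative_compose[OF \<zeta>, of "\<lambda>y. D\<phi> y u" "D2\<phi> z u"] D2\<phi>[OF z] by (simp add: \<zeta>0)
  have "((\<lambda>s. k' t *\<^sub>R (Re (\<zeta> s) *\<^sub>R D\<phi> (\<zeta> s) 1 + Im (\<zeta> s) *\<^sub>R D\<phi> (\<zeta> s) \<i>)) has_vector_derivative
      k' t *\<^sub>R ((Re (\<zeta> 0) *\<^sub>R D2\<phi> z 1 (\<i> * z) + Re (\<i> * z) *\<^sub>R D\<phi> (\<zeta> 0) 1) +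
        (Im (\<zeta> 0) *\<^sub>R D2\<phi> z \<i> (\<i> * z) + Im (\<i> * z) *\<^sub>R D\<phi> (\<zeta> 0) \<i>))) (at 0)"
    using re im
    by (intro bounded_linear.has_vector_derivative[OF bounded_linear_scaleR_right]
        has_vector_derivative_add has_vector_derivative_scaleR d)
      (simp_all only: has_real_derivative_iff_has_vector_derivative)
  from vector_derivative_unique_at[OF 1 this]
  have "t *\<^sub>R DN (\<phi> z) (D\<phi> z (\<i> * z)) =
      k' t *\<^sub>R ((Re z *\<^sub>R D2\<phi> z (\<i> * z) 1 + Im z *\<^sub>R D2\<phi> z (\<i> * z) \<i>) +
        (Re (\<i> * z) *\<^sub>R D\<phi> z 1 + Im (\<i> * z) *\<^sub>R D\<phi> z \<i>))"
    by (simp add: \<zeta>0 D2\<phi>_commute[OF z, of _ "\<i> * z"] add_ac)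
  also have "Re z *\<^sub>R D2\<phi> z (\<i> * z) 1 + Im z *\<^sub>R D2\<phi> z (\<i> * z) \<i> = D2\<phi> z (\<i> * z) (Re z *\<^sub>R 1 + Im z *\<^sub>R \<i>)"
    by (simp only: linear_add[OF D2\<phi>_linear[OF z]] linear_scale[OF D2\<phi>_linear[OF z]])
  also have "Re z *\<^sub>R 1 + Im z *\<^sub>R \<i> = z" by (rule complex_scaleR_expand[symmetric])
  also have "Re (\<i> * z) *\<^sub>R D\<phi> z 1 + Im (\<i> * z) *\<^sub>R D\<phi> z \<i> =
      D\<phi> z (Re (\<i> * z) *\<^sub>R 1 + Im (\<i> * z) *\<^sub>R \<i>)"
    by (simp only: linear_add[OF D\<phi>_linear[OF z]] linear_scale[OF D\<phi>_linear[OF z]])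
  also have "Re (\<i> * z) *\<^sub>R 1 + Im (\<i> * z) *\<^sub>R \<i> = \<i> * z" by (rule complex_scaleR_expand[symmetric])
  finally show "t *\<^sub>R DN (\<phi> (t *\<^sub>R \<omega>)) (D\<phi> (t *\<^sub>R \<omega>) (\<i> * (t *\<^sub>R \<omega>))) =
    k' t *\<^sub>R (D2\<phi> (t *\<^sub>R \<omega>) (\<i> * (t *\<^sub>R \<omega>)) (t *\<^sub>R \<omega>) + D\<phi> (t *\<^sub>R \<omega>) (\<i> * (t *\<^sub>R \<omega>)))"
    unfolding z_def .
  have "((\<lambda>s. h (\<phi> (\<zeta> s))) has_vector_derivative frechet_derivative h (at (\<phi> z)) (D\<phi> z (\<i> * z))) (at 0)"
    using has_vector_derivative_compose[OF d\<phi>, of h "frechet_derivative h (at (\<phi> z))"]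
      smooth_on_has_derivative[OF h_smooth U] by (simp add: \<zeta>0)
  moreover have "h (\<phi> (\<zeta> s)) = k t" for s
    using radial(1)[OF \<zeta>_eq(2) t'] by (simp only: \<zeta>_eq(1))
  ultimately have "((\<lambda>s::real. k t) has_vector_derivative frechet_derivative h (at (\<phi> z)) (D\<phi> z (\<i> * z))) (at 0)"
    by (simp only:)
  from vector_derivative_unique_at[OF this has_vector_derivative_const]
  show "ip (\<phi> (t *\<^sub>R \<omega>)) (D\<phi> (t *\<^sub>R \<omega>) (\<i> * (t *\<^sub>R \<omega>))) (N (\<phi> (t *\<^sub>R \<omega>))) = 0"
    using ip_N[OF U] unfolding z_def by simp
qed

text \<open>The squares |Y|^2 and k'^2 both have logarithmic derivative 2F/k', so their quotient
  \<open>Q\<close> is constant on (0, d). At the centre it has the form 0/0 and is reached only as a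
  limit.\<close>

lemma tangential_norm:
  assumes \<omega>: "norm \<omega> = 1" and d: "d \<le> \<epsilon>" and nz: "\<And>s. s \<in> {0<..<d} \<Longrightarrow> k' s \<noteq> 0" and t: "t \<in> {0<..<d}"
  shows "ip (\<phi> (t *\<^sub>R \<omega>)) (D\<phi> (t *\<^sub>R \<omega>) (\<i> * (t *\<^sub>R \<omega>))) (D\<phi> (t *\<^sub>R \<omega>) (\<i> * (t *\<^sub>R \<omega>))) =
    (k' t / F (h (\<phi> 0)))\<^sup>2"
proof -
  define \<sigma> where "\<sigma> s = \<phi> (s *\<^sub>R \<omega>)" for s
  define v where "v s = D\<phi> (s *\<^sub>R \<omega>) \<omega>" for s
  \<comment> \<open>\<open>Y\<close> is \<partial>_\<phi> and vanishes at the centre; with the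
    factor s split off, \<open>y\<close> stays regular there.\<close>
  define y where "y s = D\<phi> (s *\<^sub>R \<omega>) (\<i> * \<omega>)" for s
  define Y where "Y s = s *\<^sub>R y s" for s
  define Q where "Q s = ip (\<sigma> s) (Y s) (Y s) / (k' s)\<^sup>2" for s
  have Y_eq: "D\<phi> (s *\<^sub>R \<omega>) (\<i> * (s *\<^sub>R \<omega>)) = Y s" if "s \<in> {0..<\<epsilon>}" for s
  proof -
    have "\<i> * (s *\<^sub>R \<omega>) = s *\<^sub>R (\<i> * \<omega>)" by simp
    then show ?thesis
      unfolding Y_def y_def by (simp only: linear_scale[OF D\<phi>_linear[OF ray_in_ball[OF \<omega> that]]])
  qed
  have ray: "((\<lambda>s. s *\<^sub>R \<omega>) has_vector_derivative \<omega>) (at s)" for s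
    by (auto intro!: derivative_eq_intros)
  have dQ: "(Q has_real_derivative 0) (at s)" if s: "s \<in> {0<..<d}" for s
  proof -
    have s': "s \<in> {0..<\<epsilon>}" "s \<in> {0<..<\<epsilon>}" using s d by auto
    let ?z = "s *\<^sub>R \<omega>"
    have z: "?z \<in> ball 0 \<epsilon>" by (rule ray_in_ball[OF \<omega> s'(1)])
    have U: "\<sigma> s \<in> U" unfolding \<sigma>_def by (rule \<phi>_U[OF z])
    have \<sigma>: "(\<sigma> has_vector_derivative v s) (at s)"
      using D\<phi>_ray[OF \<omega> s'(1)] by (simp only: \<sigma>_def[abs_def] v_def)
    have N: "N (\<sigma> s) = k' s *\<^sub>R v s" unfolding \<sigma>_def v_def by (rule radial(3)[OF \<omega> s'(1)])
    have "(y has_vector_derivative D2\<phi> ?z (\<i> * \<omega>) \<omega>) (at s)"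
      unfolding y_def[abs_def] by (rule has_vector_derivative_compose[OF ray D2\<phi>[OF z]])
    then have "(Y has_vector_derivative s *\<^sub>R D2\<phi> ?z (\<i> * \<omega>) \<omega> + 1 *\<^sub>R y s) (at s)"
      unfolding Y_def[abs_def] by (intro has_vector_derivative_scaleR DERIV_ident)
    \<comment> \<open>This is \<open>tangential_derivative\<close> with a common factor s cancelled,
      in the form that \<open>norm_transported_along\<close> expects.\<close>
    moreover have "k' s *\<^sub>R (s *\<^sub>R D2\<phi> ?z (\<i> * \<omega>) \<omega> + 1 *\<^sub>R y s) = DN (\<sigma> s) (Y s)"
    proof -
      \<comment> \<open>\<open>D2\<phi>_linear\<close> gives linearity in the last argument; scaling
        in the other one is obtained by swapping the two arguments and swapping back.\<close>
      have "D2\<phi> ?z (\<i> * ?z) ?z = D2\<phi> ?z (s *\<^sub>R (\<i> * \<omega>)) (s *\<^sub>R \<omega>)" by simp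
      also have "\<dots> = s *\<^sub>R D2\<phi> ?z (s *\<^sub>R (\<i> * \<omega>)) \<omega>"
        by (rule linear_scale[OF D2\<phi>_linear[OF z]])
      also have "D2\<phi> ?z (s *\<^sub>R (\<i> * \<omega>)) \<omega> = D2\<phi> ?z \<omega> (s *\<^sub>R (\<i> * \<omega>))" by (rule D2\<phi>_commute[OF z])
      also have "\<dots> = s *\<^sub>R D2\<phi> ?z \<omega> (\<i> * \<omega>)" by (rule linear_scale[OF D2\<phi>_linear[OF z]])
      also have "D2\<phi> ?z \<omega> (\<i> * \<omega>) = D2\<phi> ?z (\<i> * \<omega>) \<omega>" by (rule D2\<phi>_commute[OF z])
      finally have "s *\<^sub>R DN (\<sigma> s) (Y s) = s *\<^sub>R (k' s *\<^sub>R (s *\<^sub>R D2\<phi> ?z (\<i> * \<omega>) \<omega> + y s))"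
        using tangential_derivative(1)[OF \<omega> s'(2)]
        unfolding Y_eq[OF s'(1)] \<sigma>_def Y_def by (simp add: algebra_simps)
      from scaleR_left_imp_eq[OF _ this] show ?thesis using s by simp
    qed
    ultimately have "((\<lambda>r. ip (\<sigma> r) (Y r) (Y r)) has_real_derivative
        2 * F (h (\<sigma> s)) / k' s * ip (\<sigma> s) (Y s) (Y s)) (at s)"
      using norm_transported_along[of \<sigma> s v, OF U \<sigma> N] nz[OF s] by blast
    moreover have "((\<lambda>r. (k' r)\<^sup>2) has_real_derivative 2 * k' s * F (h (\<sigma> s))) (at s)"
      using k_derivatives(2)[OF s'(2)] radial(1)[OF \<omega> s'(1)]
      by (auto intro!: derivative_eq_intros simp: \<sigma>_def)
    ultimately have "(Q has_real_derivative (2 * F (h (\<sigma> s)) / k' s * ip (\<sigma> s) (Y s) (Y s) * (k' s)\<^sup>2 -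
        ip (\<sigma> s) (Y s) (Y s) * (2 * k' s * F (h (\<sigma> s)))) / ((k' s)\<^sup>2 * (k' s)\<^sup>2)) (at s)"
      unfolding Q_def[abs_def] by (intro DERIV_divide) (use nz[OF s] in auto)
    then show ?thesis
      by (rule DERIV_cong) (use nz[OF s] in \<open>simp add: power2_eq_square\<close>)
  qed
  have Q_const: "Q s = Q t" if "s \<in> {0<..<d}" for s
  proof -
    have "Q b = Q a" if "0 < a" "a \<le> b" "b < d" for a b
    proof (rule real_derivative_zero_imp_const[OF that(2)])
      show "(Q has_real_derivative 0) (at r)" if "r \<in> {a..b}" for r
        using that \<open>0 < a\<close> \<open>b < d\<close> by (intro dQ) simp
    qed
    then show ?thesis using that t by (metis greaterThanLessThan_iff linear)
  qed
  \<comment> \<open>Numerator and denominator of \<open>Q\<close> divided by s^2: the first is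
    continuous at 0, the second tends to the square of \<open>F (h (\<phi> 0))\<close>.\<close>
  have lim: "((\<lambda>s. ip (\<sigma> s) (y s) (y s) / (k' s / s)\<^sup>2) \<longlongrightarrow> ip (\<sigma> 0) (y 0) (y 0) / (F (h (\<phi> 0)))\<^sup>2) (at_right 0)"
  proof (intro tendsto_divide tendsto_power k_derivatives(4))
    have 0: "0 *\<^sub>R \<omega> \<in> ball 0 \<epsilon>" using eps by simp
    have y: "(y has_vector_derivative D2\<phi> (0 *\<^sub>R \<omega>) (\<i> * \<omega>) \<omega>) (at 0)"
      unfolding y_def[abs_def] by (rule has_vector_derivative_compose[OF ray D2\<phi>[OF 0]])
    have \<sigma>: "(\<sigma> has_vector_derivative v 0) (at 0)"
      using D\<phi>_ray[OF \<omega>, of 0] eps by (simp add: \<sigma>_def[abs_def] v_def)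
    have "\<sigma> 0 \<in> U" unfolding \<sigma>_def by (rule \<phi>_U[OF 0])
    from DERIV_isCont[OF ip_has_real_derivative[OF \<sigma> this y y]]
    show "((\<lambda>s. ip (\<sigma> s) (y s) (y s)) \<longlongrightarrow> ip (\<sigma> 0) (y 0) (y 0)) (at_right 0)"
      by (simp add: isCont_def filterlim_at_split)
    show "\<epsilon> / 2 \<in> {0<..<\<epsilon>}" using eps by simp
  qed (use nondegenerate in simp)
  have y0: "ip (\<sigma> 0) (y 0) (y 0) = 1"
    using isometry[of "\<i> * \<omega>"] \<omega> by (simp add: \<sigma>_def y_def norm_mult)
  have ev: "\<forall>\<^sub>F s in at_right 0. ip (\<sigma> s) (y s) (y s) / (k' s / s)\<^sup>2 = Q t"
  proof -
    have "ip (\<sigma> s) (y s) (y s) / (k' s / s)\<^sup>2 = Q s" if "s \<in> {0<..<d}" for s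
      using that by (simp add: Q_def Y_def ip_simps power_divide power2_eq_square)
    from trans[OF this Q_const] show ?thesis
      using t by (intro eventually_at_rightI[of 0 d]) auto
  qed
  have "((\<lambda>s::real. Q t) \<longlongrightarrow> 1 / (F (h (\<phi> 0)))\<^sup>2) (at_right 0)"
    using Lim_transform_eventually[OF lim ev] unfolding y0 .
  then have "Q t = 1 / (F (h (\<phi> 0)))\<^sup>2"
    by (simp add: tendsto_const_iff)
  then have "ip (\<sigma> t) (Y t) (Y t) = (k' t / F (h (\<phi> 0)))\<^sup>2"
    using nz[OF t] by (simp add: Q_def field_simps)
  then show ?thesis using Y_eq[of t] t d by (simp add: \<sigma>_def)
qed

end

section \<open>Geodesics and the exponential map on a surface\<close>

lemma is_chart_inv: "is_chart c \<Longrightarrow> q \<in> chart_dom c \<Longrightarrow> chart_inv c (chart_map c q) = q"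
  unfolding is_chart_def by (blast intro: homeomorphism_apply1)

lemma is_chart_map_inv: "is_chart c \<Longrightarrow> y \<in> chart_map c ` chart_dom c \<Longrightarrow> chart_map c (chart_inv c y) = y"
  by (auto simp: is_chart_inv)

lemma is_chart_inv_dom: "is_chart c \<Longrightarrow> y \<in> chart_map c ` chart_dom c \<Longrightarrow> chart_inv c y \<in> chart_dom c"
  by (auto simp: is_chart_inv)

lemma open_chart_image:
  assumes "is_chart c" "open W" "W \<subseteq> chart_dom c"
  shows "open (chart_map c ` W)"
proof -
  have "homeomorphism (chart_dom c) (chart_map c ` chart_dom c) (chart_map c) (chart_inv c)"
    and "open (chart_map c ` chart_dom c)"
    using assms(1) by (simp_all add: is_chart_def)
  moreover have "openin (top_of_set (chart_dom c)) W"
    using assms by (simp add: open_openin_trans open_subset)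
  ultimately show ?thesis
    using homeomorphism_imp_open_map openin_open_trans by blast
qed

lemma eventually_in_open:
  fixes t :: real
  assumes "continuous_on I \<gamma>" "open I" "open W" "t \<in> I" "\<gamma> t \<in> W"
  shows "\<exists>d>0. \<forall>s. \<bar>s - t\<bar> < d \<longrightarrow> s \<in> I \<and> \<gamma> s \<in> W"
proof -
  have "open (I \<inter> \<gamma> -` W)"
    using assms continuous_on_open_vimage[OF assms(2), of \<gamma>] by (simp add: Int_commute)
  then obtain d where "d > 0" "\<And>s. dist s t < d \<Longrightarrow> s \<in> I \<inter> \<gamma> -` W"
    using assms(4,5) unfolding open_dist by (metis IntI vimageI)
  then show ?thesis by (intro exI[of _ d]) (auto simp: dist_real_def)
qed

locale riemannian_surface =
  fixes A :: "'m::{second_countable_topology,t2_space} chart set" and g :: "'m metric"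
  assumes surface: "oriented_riemannian_surface A g"
begin

lemma chart: "c \<in> A \<Longrightarrow> is_chart c"
  using surface by (simp add: oriented_riemannian_surface_def oriented_smooth_surface_def)

lemma chart_exists: "\<exists>c\<in>A. q \<in> chart_dom c"
  using surface by (auto simp: oriented_riemannian_surface_def oriented_smooth_surface_def)

lemma open_dom: "c \<in> A \<Longrightarrow> open (chart_dom c)"
  using chart by (auto simp: is_chart_def)

lemma planar_metric_chart: "c \<in> A \<Longrightarrow> planar_metric (chart_map c ` chart_dom c) (g c)"
  using surface chart[of c]
  by unfold_locales (auto simp: oriented_riemannian_surface_def riemannian_metric_def is_chart_def)

abbreviation Gamma :: "'m chart \<Rightarrow> real ^ 2 \<Rightarrow> real ^ 2 \<Rightarrow> real ^ 2 \<Rightarrow> real ^ 2" where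
  "Gamma c \<equiv> planar_metric.Gam (g c)"

section \<open>Reparametrisation and uniqueness of geodesics\<close>

lemma Gamma_scale:
  "c \<in> A \<Longrightarrow> Gamma c y (s *\<^sub>R v) (s *\<^sub>R v) = (s * s) *\<^sub>R Gamma c y v v"
  by (simp add: planar_metric.Gam_def[OF planar_metric_chart] vec_eq_iff sum_2 algebra_simps)

abbreviation velocity :: "'m chart \<Rightarrow> (real \<Rightarrow> 'm) \<Rightarrow> real \<Rightarrow> real ^ 2" where
  "velocity c \<gamma> t \<equiv> vector_derivative (chart_map c \<circ> \<gamma>) (at t)"

lemma geodesic_on_iff:
  "geodesic_on A g \<gamma> I \<longleftrightarrow> continuous_on I \<gamma> \<and> (\<forall>c\<in>A. \<forall>t\<in>I. \<gamma> t \<in> chart_dom c \<longrightarrow>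
    ((chart_map c \<circ> \<gamma>) has_vector_derivative velocity c \<gamma> t) (at t) \<and>
    (velocity c \<gamma> has_vector_derivative
      - Gamma c (chart_map c (\<gamma> t)) (velocity c \<gamma> t) (velocity c \<gamma> t)) (at t))"
proof -
  have "(\<chi> k. - (\<Sum>i\<in>UNIV. \<Sum>j\<in>UNIV. christoffel (g c) k i j y * v $ i * v $ j)) = - Gamma c y v v"
    if "c \<in> A" for c y v
    by (simp add: planar_metric.Gam_def[OF planar_metric_chart[OF that]] vec_eq_iff)
  moreover have "\<sigma> differentiable (at t) \<longleftrightarrow> (\<sigma> has_vector_derivative vector_derivative \<sigma> (at t)) (at t)"
    for \<sigma> :: "real \<Rightarrow> real ^ 2" and t
    using vector_derivative_works by blast
  ultimately show ?thesis
    unfolding geodesic_on_def Let_def by simp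
qed

lemma geodesic_on_continuous: "geodesic_on A g \<gamma> I \<Longrightarrow> continuous_on I \<gamma>"
  by (simp add: geodesic_on_def)

lemma geodesic_onD:
  assumes "geodesic_on A g \<gamma> I" "c \<in> A" "t \<in> I" "\<gamma> t \<in> chart_dom c"
  shows "((chart_map c \<circ> \<gamma>) has_vector_derivative velocity c \<gamma> t) (at t)"
    and "(velocity c \<gamma> has_vector_derivative
      - Gamma c ((chart_map c \<circ> \<gamma>) t) (velocity c \<gamma> t) (velocity c \<gamma> t)) (at t)"
proof -
  note * = assms(1)[unfolded geodesic_on_iff, THEN conjunct2, rule_format, OF assms(2-4)]
  show "((chart_map c \<circ> \<gamma>) has_vector_derivative velocity c \<gamma> t) (at t)"
    by (rule *[THEN conjunct1])
  show "(velocity c \<gamma> has_vector_derivative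
      - Gamma c ((chart_map c \<circ> \<gamma>) t) (velocity c \<gamma> t) (velocity c \<gamma> t)) (at t)"
    unfolding o_apply by (rule *[THEN conjunct2, unfolded o_def])
qed

text \<open>The Christoffel term is quadratic in the velocity, so both sides of the geodesic
  equation scale by s^2.\<close>

lemma geodesic_rescale:
  assumes geo: "geodesic_on A g \<gamma> I" and I: "open I" "open J" "\<And>t. t \<in> J \<Longrightarrow> s * t \<in> I"
  shows "geodesic_on A g (\<lambda>t. \<gamma> (s * t)) J"
    and "c \<in> A \<Longrightarrow> t \<in> J \<Longrightarrow> \<gamma> (s * t) \<in> chart_dom c \<Longrightarrow>
      ((chart_map c \<circ> (\<lambda>t. \<gamma> (s * t))) has_vector_derivative s *\<^sub>R velocity c \<gamma> (s * t)) (at t)"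
proof -
  let ?\<gamma> = "\<lambda>t. \<gamma> (s * t)"
  have cont: "continuous_on J ?\<gamma>"
    using I(3) by (intro continuous_on_compose2[OF geodesic_on_continuous[OF geo]] continuous_intros) auto
  have lin: "((\<lambda>t. s * t) has_vector_derivative s) (at t)" for t
    by (auto intro!: derivative_eq_intros)
  have d: "((chart_map c \<circ> ?\<gamma>) has_vector_derivative s *\<^sub>R velocity c \<gamma> (s * t)) (at t)"
    if "c \<in> A" "t \<in> J" "?\<gamma> t \<in> chart_dom c" for c t
  proof -
    note geodesic_onD(1)[OF geo that(1) I(3)[OF that(2)] that(3)]
    from vector_diff_chain_at[OF lin this] show ?thesis by (simp add: o_def)
  qed
  then show "((chart_map c \<circ> ?\<gamma>) has_vector_derivative s *\<^sub>R velocity c \<gamma> (s * t)) (at t)"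
    if "c \<in> A" "t \<in> J" "?\<gamma> t \<in> chart_dom c" using that by blast
  have vel: "velocity c ?\<gamma> t = s *\<^sub>R velocity c \<gamma> (s * t)" if "c \<in> A" "t \<in> J" "?\<gamma> t \<in> chart_dom c" for c t
    by (rule vector_derivative_at[OF d[OF that]])
  have "(velocity c ?\<gamma> has_vector_derivative
      - Gamma c (chart_map c (?\<gamma> t)) (velocity c ?\<gamma> t) (velocity c ?\<gamma> t)) (at t)"
    if c: "c \<in> A" and t: "t \<in> J" "?\<gamma> t \<in> chart_dom c" for c t
  proof -
    \<comment> \<open>The velocity formula holds while the curve stays in the chart; differentiating
      it takes a whole interval around \<open>t\<close>.\<close>
    obtain e where e: "e > 0" "\<And>r. \<bar>r - t\<bar> < e \<Longrightarrow> r \<in> J \<and> ?\<gamma> r \<in> chart_dom c"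
      using eventually_in_open[OF cont I(2) open_dom[OF c] t] by blast
    note geodesic_onD(2)[OF geo c I(3)[OF t(1)] t(2)]
    from vector_diff_chain_at[OF lin this]
    have "((\<lambda>t. s *\<^sub>R velocity c \<gamma> (s * t)) has_vector_derivative
        s *\<^sub>R s *\<^sub>R - Gamma c (chart_map c (?\<gamma> t)) (velocity c \<gamma> (s * t)) (velocity c \<gamma> (s * t))) (at t)"
      by (intro bounded_linear.has_vector_derivative[OF bounded_linear_scaleR_right]) (simp add: o_def)
    then have "((\<lambda>t. s *\<^sub>R velocity c \<gamma> (s * t)) has_vector_derivative
        - Gamma c (chart_map c (?\<gamma> t)) (velocity c ?\<gamma> t) (velocity c ?\<gamma> t)) (at t)"
      unfolding vel[OF c t] Gamma_scale[OF c] by simp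
    then show ?thesis
      by (rule has_vector_derivative_transform_within_open[where S = "{t - e<..<t + e}"])
        (use e vel c in \<open>auto simp: abs_less_iff\<close>)
  qed
  then show "geodesic_on A g ?\<gamma> J"
    unfolding geodesic_on_iff using cont d vel by simp
qed

lemma geodesic_unique_forward:
  assumes geo: "geodesic_on A g \<gamma>1 I" "geodesic_on A g \<gamma>2 I" and I: "open I" "t \<in> I"
    and c: "c \<in> A" "\<gamma>1 t \<in> chart_dom c"
    and init: "\<gamma>1 t = \<gamma>2 t" "velocity c \<gamma>1 t = velocity c \<gamma>2 t"
  shows "\<exists>\<delta>>0. \<forall>s\<in>{t..t + \<delta>}. \<gamma>1 s = \<gamma>2 s"
proof -
  have cont: "continuous_on I \<gamma>1" "continuous_on I \<gamma>2" using geo by (simp_all add: geodesic_on_continuous)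
  obtain d1 where d1: "d1 > 0" "\<And>s. \<bar>s - t\<bar> < d1 \<Longrightarrow> s \<in> I \<and> \<gamma>1 s \<in> chart_dom c"
    using eventually_in_open[OF cont(1) I(1) open_dom[OF c(1)] I(2) c(2)] by blast
  obtain d2 where d2: "d2 > 0" "\<And>s. \<bar>s - t\<bar> < d2 \<Longrightarrow> s \<in> I \<and> \<gamma>2 s \<in> chart_dom c"
    using eventually_in_open[OF cont(2) I(1) open_dom[OF c(1)] I(2)] c(2) init(1) by metis
  define b where "b = t + min d1 d2 / 2"
  have tb: "t < b" using d1(1) d2(1) by (simp add: b_def)
  have dom: "s \<in> I" "\<gamma>1 s \<in> chart_dom c" "\<gamma>2 s \<in> chart_dom c" if "s \<in> {t..b}" for s
    using d1(2)[of s] d2(2)[of s] d1(1) d2(1) that by (auto simp: b_def)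
  interpret planar_metric "chart_map c ` chart_dom c" "g c" by (rule planar_metric_chart[OF c(1)])
  have "\<exists>\<delta>>0. \<forall>s\<in>{t..t + \<delta>}. (chart_map c \<circ> \<gamma>1) s = (chart_map c \<circ> \<gamma>2) s"
    by (rule geodesic_unique_local[OF tb _ geodesic_onD(1)[OF geo(1) c(1)] geodesic_onD(2)[OF geo(1) c(1)]
          geodesic_onD(1)[OF geo(2) c(1)] geodesic_onD(2)[OF geo(2) c(1)]])
      (use c init dom in \<open>auto\<close>)
  then obtain \<delta> where \<delta>: "\<delta> > 0" "\<And>s. s \<in> {t..t + \<delta>} \<Longrightarrow> chart_map c (\<gamma>1 s) = chart_map c (\<gamma>2 s)"
    by auto
  have "\<gamma>1 s = \<gamma>2 s" if "s \<in> {t..t + min \<delta> (b - t)}" for s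
  proof -
    have "s \<in> {t..t + \<delta>}" "s \<in> {t..b}" using that by auto
    then show ?thesis
      using arg_cong[OF \<delta>(2), of s "chart_inv c"] dom[of s] by (simp add: is_chart_inv[OF chart[OF c(1)]])
  qed
  then show ?thesis using \<delta>(1) tb by (intro exI[of _ "min \<delta> (b - t)"]) auto
qed

text \<open>The curves may leave every single chart, so the first time of disagreement is examined:
  by continuity (points are separated) and by the one-sided derivative, position and velocity still
  agree there, and local uniqueness pushes the agreement further.\<close>

lemma geodesic_unique:
  assumes geo: "geodesic_on A g \<gamma>1 I" "geodesic_on A g \<gamma>2 I" and I: "open I" "{0..1} \<subseteq> I"
    and c: "c \<in> A" "\<gamma>1 0 \<in> chart_dom c"
    and init: "\<gamma>1 0 = \<gamma>2 0" "velocity c \<gamma>1 0 = velocity c \<gamma>2 0"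
    and t: "t \<in> {0..1}"
  shows "\<gamma>1 t = \<gamma>2 t"
proof (rule ccontr)
  assume neq: "\<gamma>1 t \<noteq> \<gamma>2 t"
  define S where "S = {s \<in> {0..1}. \<gamma>1 s \<noteq> \<gamma>2 s}"
  define T where "T = Inf S"
  have S: "S \<noteq> {}" "bdd_below S" using neq t by (auto simp: S_def intro: bdd_belowI[of _ 0])
  have T: "T \<in> {0..1}"
  proof -
    have "0 \<le> T" unfolding T_def by (rule cInf_greatest) (use S in \<open>auto simp: S_def\<close>)
    moreover have "T \<le> t" unfolding T_def by (rule cInf_lower) (use S neq t in \<open>auto simp: S_def\<close>)
    ultimately show ?thesis using t by simp
  qed
  have before: "\<gamma>1 s = \<gamma>2 s" if "s \<in> {0..<T}" for s
  proof (rule ccontr)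
    assume "\<gamma>1 s \<noteq> \<gamma>2 s"
    then have "s \<in> S" using that T by (simp add: S_def)
    then show False using cInf_lower[OF _ S(2)] that by (fastforce simp: T_def)
  qed
  have cont: "continuous_on I \<gamma>1" "continuous_on I \<gamma>2" using geo by (simp_all add: geodesic_on_continuous)
  have TI: "T \<in> I" using T I by blast
  have eq: "\<gamma>1 T = \<gamma>2 T"
  proof (cases "T = 0")
    case False
    then have "T > 0" using T by simp
    have lim: "(\<gamma>1 \<longlongrightarrow> \<gamma>1 T) (at_left T)" "(\<gamma>2 \<longlongrightarrow> \<gamma>2 T) (at_left T)"
      using cont TI I(1) by (auto simp: continuous_on_eq_continuous_at isCont_def filterlim_at_split)
    have "\<forall>\<^sub>F s in at_left T. \<gamma>1 s = \<gamma>2 s"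
      unfolding eventually_at_left_field using \<open>T > 0\<close> before by (intro exI[of _ 0]) auto
    from Lim_transform_eventually[OF lim(1) this] lim(2) show ?thesis
      by (intro tendsto_unique[of "at_left T"]) auto
  qed (simp add: init)
  \<comment> \<open>At T = 0 the velocities agree by hypothesis in the given chart. For T > 0 the
    agreement to the left of \<open>T\<close> determines both velocities, in any chart around the
    common point.\<close>
  obtain d where d: "d \<in> A" "\<gamma>1 T \<in> chart_dom d" "velocity d \<gamma>1 T = velocity d \<gamma>2 T"
  proof (cases "T = 0")
    case True
    then show ?thesis using that c init by blast
  next
    case False
    obtain d where d: "d \<in> A" "\<gamma>1 T \<in> chart_dom d" using chart_exists by blast
    have "velocity d \<gamma>1 T = velocity d \<gamma>2 T"
    proof (rule has_vector_derivative_unique_on_interval)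
      show "0 < T" "T \<in> {0..T}" using False T by simp_all
      show "((chart_map d \<circ> \<gamma>1) has_vector_derivative velocity d \<gamma>1 T) (at T)"
        "((chart_map d \<circ> \<gamma>2) has_vector_derivative velocity d \<gamma>2 T) (at T)"
        by (rule geodesic_onD(1)[OF geo(1) d(1) TI d(2)] geodesic_onD(1)[OF geo(2) d(1) TI d(2)[unfolded eq]])+
      show "(chart_map d \<circ> \<gamma>1) s = (chart_map d \<circ> \<gamma>2) s" if "s \<in> {0..T}" for s
        using before[of s] eq that by (cases "s = T") auto
    qed
    then show ?thesis using that d by blast
  qed
  obtain \<delta> where \<delta>: "\<delta> > 0" "\<And>s. s \<in> {T..T + \<delta>} \<Longrightarrow> \<gamma>1 s = \<gamma>2 s"
    using geodesic_unique_forward[OF geo I(1) TI d(1,2) eq d(3)] by blast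
  have "T + \<delta> \<le> T"
    unfolding T_def
  proof (rule cInf_greatest[OF S(1)])
    fix s assume s: "s \<in> S"
    then have "T \<le> s" unfolding T_def by (rule cInf_lower[OF _ S(2)])
    then show "Inf S + \<delta> \<le> s" using \<delta>(2)[of s] s unfolding T_def[symmetric] by (force simp: S_def)
  qed
  then show False using \<delta>(1) by simp
qed

section \<open>The exponential map and its rays\<close>

lemma is_exp_unique:
  assumes c: "c \<in> A" "p \<in> chart_dom c" and "is_exp A g c p v q1" "is_exp A g c p v q2"
  shows "q1 = q2"
proof -
  obtain \<gamma>1 a1 b1 where 1: "a1 < 0" "1 < b1" "geodesic_on A g \<gamma>1 {a1<..<b1}" "\<gamma>1 0 = p"
    "((chart_map c \<circ> \<gamma>1) has_vector_derivative v) (at 0)" "\<gamma>1 1 = q1"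
    using assms(3) by (auto simp: is_exp_def)
  obtain \<gamma>2 a2 b2 where 2: "a2 < 0" "1 < b2" "geodesic_on A g \<gamma>2 {a2<..<b2}" "\<gamma>2 0 = p"
    "((chart_map c \<circ> \<gamma>2) has_vector_derivative v) (at 0)" "\<gamma>2 1 = q2"
    using assms(4) by (auto simp: is_exp_def)
  \<comment> \<open>Each witness lives on its own interval; uniqueness is applied on the common one,
    which contains [0, 1].\<close>
  let ?I = "{max a1 a2<..<min b1 b2}"
  have sub: "geodesic_on A g \<gamma> J" if "geodesic_on A g \<gamma> I" "J \<subseteq> I" for \<gamma> I J
    using that unfolding geodesic_on_def by (blast intro: continuous_on_subset)
  have "\<gamma>1 1 = \<gamma>2 1"
  proof (rule geodesic_unique)
    show "geodesic_on A g \<gamma>1 ?I" "geodesic_on A g \<gamma>2 ?I" by (rule sub[OF 1(3)] sub[OF 2(3)]; auto)+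
    show "velocity c \<gamma>1 0 = velocity c \<gamma>2 0"
      using vector_derivative_at[OF 1(5)] vector_derivative_at[OF 2(5)] by simp
  qed (use 1 2 c in auto)
  then show ?thesis using 1 2 by simp
qed

text \<open>\<open>is_exp\<close> provides an unrelated geodesic for every multiple of
  \<open>v\<close>. Rescaling the one for \<open>v\<close>, together with uniqueness, shows that
  this single curve serves for the whole segment.\<close>

lemma exp_map_ray:
  assumes c: "c \<in> A" "p \<in> chart_dom c" and v: "v \<in> exp_domain A g c p"
  shows "\<exists>\<gamma> a b. a < 0 \<and> 1 < b \<and> geodesic_on A g \<gamma> {a<..<b} \<and> \<gamma> 0 = p \<and>
    ((chart_map c \<circ> \<gamma>) has_vector_derivative v) (at 0) \<and>
    (\<forall>s\<in>{0..1}. exp_map A g c p (s *\<^sub>R v) = \<gamma> s)"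
proof -
  obtain \<gamma> a b where 1: "a < 0" "1 < b" and geo: "geodesic_on A g \<gamma> {a<..<b}" and
    2: "\<gamma> 0 = p" "((chart_map c \<circ> \<gamma>) has_vector_derivative v) (at 0)"
    using v by (auto simp: exp_domain_def is_exp_def)
  have vel: "velocity c \<gamma> 0 = v" by (rule vector_derivative_at[OF 2(2)])
  have "exp_map A g c p (s *\<^sub>R v) = \<gamma> s" if s: "s \<in> {0..1}" for s
  proof -
    \<comment> \<open>An interval around 0 is mapped into itself by multiplication with a number
      from [0, 1].\<close>
    have in_I: "s * t \<in> {a<..<b}" if "t \<in> {a<..<b}" for t
    proof -
      have "s * t \<le> max t 0" "s * t \<ge> min t 0"
        using s by (auto simp: max_def min_def mult_left_le_one_le mult_le_0_iff mult_nonneg_nonpos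
            zero_le_mult_iff mult_le_cancel_right1 mult_le_cancel_right2)
      then show ?thesis using that 1 by auto
    qed
    note rescaled = geodesic_rescale[OF geo open_greaterThanLessThan open_greaterThanLessThan in_I]
    have "((chart_map c \<circ> (\<lambda>t. \<gamma> (s * t))) has_vector_derivative s *\<^sub>R velocity c \<gamma> (s * 0)) (at 0)"
      by (rule rescaled(2)) (use 1 2 c in auto)
    then have "((chart_map c \<circ> (\<lambda>t. \<gamma> (s * t))) has_vector_derivative s *\<^sub>R v) (at 0)"
      by (simp only: mult_zero_right vel)
    then have "is_exp A g c p (s *\<^sub>R v) (\<gamma> s)"
      unfolding is_exp_def
      using 1 2 rescaled(1)
      by (intro exI[of _ "\<lambda>t. \<gamma> (s * t)"] exI[of _ a] exI[of _ b]) auto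
    then show ?thesis
      unfolding exp_map_def using is_exp_unique[OF c] by blast
  qed
  then show ?thesis using 1 2 geo by blast
qed

end

section \<open>Geodesic polar coordinates on a surface\<close>

context riemannian_surface
begin

lemma smooth_transition: "c \<in> A \<Longrightarrow> d \<in> A \<Longrightarrow>
    smooth_on (transition c d) (chart_map c ` (chart_dom c \<inter> chart_dom d))"
  using surface by (simp add: oriented_riemannian_surface_def oriented_smooth_surface_def)

lemma metric_at_transition:
  assumes "c \<in> A" "d \<in> A" "q \<in> chart_dom c" "q \<in> chart_dom d"
  shows "metric_at g c q a b = metric_at g d q
    (frechet_derivative (transition c d) (at (chart_map c q)) a)
    (frechet_derivative (transition c d) (at (chart_map c q)) b)"
proof -
  let ?y = "chart_map c q" and ?J = "jacobian (transition c d) (chart_map c q)"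
  have y: "?y \<in> chart_map c ` (chart_dom c \<inter> chart_dom d)" using assms by blast
  have "linear (frechet_derivative (transition c d) (at ?y))"
    using smooth_on_has_derivative[OF smooth_transition[OF assms(1,2)] y] has_derivative_linear by blast
  then have J: "?J *v v = frechet_derivative (transition c d) (at ?y) v" for v
    by (simp add: jacobian_def matrix_works)
  have T: "transition c d ?y = chart_map d q"
    using assms by (simp add: transition_def is_chart_inv chart)
  have "g c ?y = transpose ?J ** g d (transition c d ?y) ** ?J"
    using surface y assms(1,2) unfolding oriented_riemannian_surface_def riemannian_metric_def by blast
  then have "metric_at g c q a b = a \<bullet> (transpose ?J *v (g d (chart_map d q) *v (?J *v b)))"
    by (simp add: metric_at_def T matrix_vector_mul_assoc matrix_mul_assoc)
  also have "\<dots> = metric_at g d q (?J *v a) (?J *v b)"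
    unfolding metric_at_def transpose_matrix_vector
    by (metis dot_lmul_matrix inner_commute)
  finally show ?thesis by (simp only: J)
qed

end

locale hessian_surface = riemannian_surface A g
  for A :: "'m::{second_countable_topology,t2_space} chart set" and g :: "'m metric" +
  fixes H :: "'m \<Rightarrow> real" and F :: "real \<Rightarrow> real" and R :: real and p :: 'm
    and c0 :: "'m chart" and e1 e2 :: "real ^ 2" and V :: "'m set" and r :: "'m \<Rightarrow> real"
    and u :: "'m \<Rightarrow> complex"
  assumes H_smooth: "smooth_from A H UNIV"
    and F_C1: "Ck_on 1 F UNIV"
    and H_hessian: "c \<in> A \<Longrightarrow> q \<in> chart_dom c \<Longrightarrow> hessian g H c q = mat (F (H q))"
    and p: "regular_critical_point A g H p"
    and c0: "c0 \<in> A" "p \<in> chart_dom c0"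
    and basis: "orthonormal_basis_at g c0 p e1 e2"
    and polar: "geodesic_polar_coordinates A g c0 p e1 e2 R V r u"
begin

abbreviation frame :: "complex \<Rightarrow> real ^ 2" where
  "frame z \<equiv> Re z *\<^sub>R e1 + Im z *\<^sub>R e2"

abbreviation E :: "complex \<Rightarrow> 'm" where
  "E \<equiv> exp_frame A g c0 p e1 e2"

abbreviation B :: "complex set" where
  "B \<equiv> ball 0 R"

abbreviation \<psi> :: "'m \<Rightarrow> complex" where
  "\<psi> \<equiv> inv_into B E"

lemma polar_unfolded:
  "0 < R" "z \<in> B \<Longrightarrow> frame z \<in> exp_domain A g c0 p" "inj_on E B" "open (E ` B)"
  "smooth_into A E B" "smooth_from A \<psi> (E ` B)" "V = E ` (B - {0})"
  "z \<in> B \<Longrightarrow> z \<noteq> 0 \<Longrightarrow> r (E z) = cmod z" "z \<in> B \<Longrightarrow> z \<noteq> 0 \<Longrightarrow> u (E z) = sgn z"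
  using polar unfolding geodesic_polar_coordinates_def Let_def by blast+

lemma E_continuous: "continuous_on B E"
  using polar_unfolded(5) by (simp add: smooth_into_def)

lemma open_preimage: "c \<in> A \<Longrightarrow> open (B \<inter> E -` chart_dom c)"
  using E_continuous open_dom continuous_on_open_vimage[OF open_ball, where f = E]
  by (simp add: Int_commute)

lemma smooth_E: "c \<in> A \<Longrightarrow> smooth_on (chart_map c \<circ> E) (B \<inter> E -` chart_dom c)"
  using polar_unfolded(5) by (simp add: smooth_into_def)

abbreviation DE :: "'m chart \<Rightarrow> complex \<Rightarrow> complex \<Rightarrow> real ^ 2" where
  "DE c z \<equiv> frechet_derivative (chart_map c \<circ> E) (at z)"

lemma DE:
  "c \<in> A \<Longrightarrow> z \<in> B \<Longrightarrow> E z \<in> chart_dom c \<Longrightarrow> ((chart_map c \<circ> E) has_derivative DE c z) (at z)"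
  using smooth_on_has_derivative[OF smooth_E] by blast

lemma DE_transition:
  assumes c: "c \<in> A" "E z \<in> chart_dom c" and d: "d \<in> A" "E z \<in> chart_dom d" and z: "z \<in> B"
  shows "DE d z w = frechet_derivative (transition c d) (at (chart_map c (E z))) (DE c z w)"
proof (rule frechet_derivative_eqI)
  have "chart_map c (E z) \<in> chart_map c ` (chart_dom c \<inter> chart_dom d)" using c d by blast
  from smooth_on_has_derivative[OF smooth_transition[OF c(1) d(1)] this]
  have T: "(transition c d has_derivative frechet_derivative (transition c d) (at (chart_map c (E z))))
      (at ((chart_map c \<circ> E) z))" by simp
  have "((transition c d \<circ> (chart_map c \<circ> E)) has_derivative
      frechet_derivative (transition c d) (at (chart_map c (E z))) \<circ> DE c z) (at z)"
    by (rule diff_chain_at[OF DE[OF c(1) z c(2)] T])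
  then have "((transition c d \<circ> (chart_map c \<circ> E)) has_derivative
      (\<lambda>w. frechet_derivative (transition c d) (at (chart_map c (E z))) (DE c z w))) (at z)"
    by (simp only: o_def)
  then show "((chart_map d \<circ> E) has_derivative
      (\<lambda>w. frechet_derivative (transition c d) (at (chart_map c (E z))) (DE c z w))) (at z)"
  proof (rule has_derivative_transform_within_open)
    show "open ((B \<inter> E -` chart_dom c) \<inter> (B \<inter> E -` chart_dom d))"
      by (intro open_Int open_preimage c d)
  qed (use z c d in \<open>auto simp: transition_def is_chart_inv chart\<close>)
qed

text \<open>Transports metric computations made in the chart \<open>c0\<close> to every other chart
  at the same point.\<close>

lemma metric_DE_transition:
  assumes "c \<in> A" "E z \<in> chart_dom c" "d \<in> A" "E z \<in> chart_dom d" "z \<in> B"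
  shows "metric_at g d (E z) (DE d z v) (DE d z w) = metric_at g c (E z) (DE c z v) (DE c z w)"
  unfolding DE_transition[OF assms] by (rule metric_at_transition[symmetric]) (use assms in auto)

text \<open>The ray to \<open>\<epsilon> *\<^sub>R \<omega>\<close>, run at speed 1/\<epsilon>, has
  initial velocity \<open>frame \<omega>\<close>. The bound \<epsilon> < R places its end in
  \<open>B\<close>, where the exponential map is known to be defined.\<close>

lemma exp_ray_rescaled:
  assumes \<omega>: "norm \<omega> = 1" and \<epsilon>: "0 < \<epsilon>" "\<epsilon> < R"
  shows "\<exists>\<gamma> J. open J \<and> {0..\<epsilon>} \<subseteq> J \<and> geodesic_on A g \<gamma> J \<and> \<gamma> 0 = p \<and>
    ((chart_map c0 \<circ> \<gamma>) has_vector_derivative frame \<omega>) (at 0) \<and>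
    (\<forall>t\<in>{0..\<epsilon>}. E (t *\<^sub>R \<omega>) = \<gamma> t)"
proof -
  have "\<epsilon> *\<^sub>R \<omega> \<in> B" using \<omega> \<epsilon> by simp
  from exp_map_ray[OF c0 polar_unfolded(2)[OF this]]
  obtain \<gamma> a b where ab: "a < 0" "1 < b" and geo: "geodesic_on A g \<gamma> {a<..<b}" and \<gamma>0: "\<gamma> 0 = p"
    and v: "((chart_map c0 \<circ> \<gamma>) has_vector_derivative frame (\<epsilon> *\<^sub>R \<omega>)) (at 0)"
    and ray: "\<forall>s\<in>{0..1}. exp_map A g c0 p (s *\<^sub>R frame (\<epsilon> *\<^sub>R \<omega>)) = \<gamma> s"
    by blast
  define s where "s = inverse \<epsilon>"
  define J where "J = {a * \<epsilon><..<b * \<epsilon>}"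
  have s: "s * \<epsilon> = 1" "s > 0" using \<epsilon> by (simp_all add: s_def)
  have J: "s * t \<in> {a<..<b}" if "t \<in> J" for t
    using that \<epsilon> by (simp add: J_def s_def field_simps)
  have "open J" by (simp add: J_def)
  note rescaled = geodesic_rescale[OF geo open_greaterThanLessThan \<open>open J\<close> J]
  have J0: "{0..\<epsilon>} \<subseteq> J"
  proof -
    have "a * \<epsilon> < 0" "\<epsilon> < b * \<epsilon>" using ab \<epsilon> by (simp_all add: mult_neg_pos)
    then show ?thesis by (auto simp: J_def)
  qed
  have "((chart_map c0 \<circ> (\<lambda>t. \<gamma> (s * t))) has_vector_derivative s *\<^sub>R velocity c0 \<gamma> (s * 0)) (at 0)"
    by (rule rescaled(2)) (use J0 \<gamma>0 c0 \<epsilon> in auto)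
  moreover have "s *\<^sub>R velocity c0 \<gamma> (s * 0) = frame \<omega>"
  proof -
    have "frame (\<epsilon> *\<^sub>R \<omega>) = \<epsilon> *\<^sub>R frame \<omega>" by (simp add: scaleR_add_right)
    then have "s *\<^sub>R velocity c0 \<gamma> (s * 0) = (s * \<epsilon>) *\<^sub>R frame \<omega>"
      using vector_derivative_at[OF v] by simp
    then show ?thesis unfolding s(1) by simp
  qed
  moreover have "E (t *\<^sub>R \<omega>) = \<gamma> (s * t)" if "t \<in> {0..\<epsilon>}" for t
  proof -
    have st: "s * t \<in> {0..1}" using that \<epsilon> by (simp add: s_def field_simps)
    have "s * t * \<epsilon> = t" using s(1) by (metis mult.commute mult.left_commute mult_1_right)
    moreover have "(s * t) *\<^sub>R frame (\<epsilon> *\<^sub>R \<omega>) = (s * t * \<epsilon>) *\<^sub>R frame \<omega>"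
      by (simp add: scaleR_add_right mult.assoc)
    moreover have "frame (t *\<^sub>R \<omega>) = t *\<^sub>R frame \<omega>"
      by (simp add: scaleR_add_right)
    ultimately have "frame (t *\<^sub>R \<omega>) = (s * t) *\<^sub>R frame (\<epsilon> *\<^sub>R \<omega>)"
      by (simp only:)
    then show ?thesis using ray st by (simp add: exp_frame_def)
  qed
  ultimately show ?thesis
    using \<open>open J\<close> J0 rescaled(1) \<gamma>0 by (intro exI[of _ "\<lambda>t. \<gamma> (s * t)"] exI[of _ J]) simp
qed

lemma E_0: "E 0 = p"
proof -
  obtain \<gamma> where "\<gamma> 0 = p" "\<forall>t\<in>{0..R/2}. E (t *\<^sub>R 1) = \<gamma> t"
    using exp_ray_rescaled[of 1 "R/2"] polar_unfolded(1) by auto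
  then show ?thesis using polar_unfolded(1) by force
qed

abbreviation U :: "(real ^ 2) set" where
  "U \<equiv> chart_map c0 ` chart_dom c0"

abbreviation h :: "real ^ 2 \<Rightarrow> real" where
  "h \<equiv> H \<circ> chart_inv c0"

lemma planar_hessian: "planar_hessian U (g c0) h F"
proof -
  interpret planar_metric U "g c0" by (rule planar_metric_chart[OF c0(1)])
  show ?thesis
  proof unfold_locales
    show "smooth_on h U" using H_smooth c0(1) by (simp add: smooth_from_def)
    show "Ck_on 1 F UNIV" by (rule F_C1)
    fix y assume y: "y \<in> U"
    note inv = is_chart_inv_dom[OF chart[OF c0(1)] y] is_chart_map_inv[OF chart[OF c0(1)] y]
    show "covariant_derivative (g c0) (grad_chart (g c0) h) y = mat (F (h y))"
      using H_hessian[OF c0(1) inv(1)] by (simp add: hessian_def inv(2))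
  qed
qed

lemma frame_unit: "norm \<omega> = 1 \<Longrightarrow> metric_at g c0 p (frame \<omega>) (frame \<omega>) = 1"
proof -
  assume \<omega>: "norm \<omega> = 1"
  interpret planar_metric U "g c0" by (rule planar_metric_chart[OF c0(1)])
  let ?y = "chart_map c0 p"
  have y: "?y \<in> U" using c0 by blast
  have m: "metric_at g c0 p a b = ip ?y a b" for a b by (simp add: metric_at_def ip_def)
  have "ip ?y e1 e1 = 1" "ip ?y e2 e2 = 1" "ip ?y e1 e2 = 0" "ip ?y e2 e1 = 0"
    using basis ip_commute[OF y, of e1 e2] by (simp_all add: orthonormal_basis_at_def m)
  then have "ip ?y (frame \<omega>) (frame \<omega>) = (Re \<omega>)\<^sup>2 + (Im \<omega>)\<^sup>2"
    by (simp add: ip_simps power2_eq_square)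
  then show ?thesis using \<omega> by (simp add: m flip: cmod_power2)
qed

text \<open>By continuity \<open>E\<close> maps a small ball into the domain of \<open>c0\<close>,
  where the planar results apply to its coordinate expression.\<close>

lemma planar_polar_exists:
  "\<exists>\<epsilon>>0. \<epsilon> < R \<and> (\<forall>z\<in>ball 0 \<epsilon>. E z \<in> chart_dom c0) \<and>
    planar_polar U (g c0) h F (chart_map c0 \<circ> E) \<epsilon>"
proof -
  have "0 \<in> B \<inter> E -` chart_dom c0" using polar_unfolded(1) c0 E_0 by simp
  then obtain e where e: "e > 0" "ball 0 e \<subseteq> B \<inter> E -` chart_dom c0"
    using open_preimage[OF c0(1)] open_contains_ball by blast
  \<comment> \<open>R/2 keeps \<epsilon> strictly below R, as \<open>exp_ray_rescaled\<close>
    demands.\<close>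
  define \<epsilon> where "\<epsilon> = min e (R / 2)"
  have \<epsilon>: "0 < \<epsilon>" "\<epsilon> < R" using e polar_unfolded(1) by (auto simp: \<epsilon>_def)
  have ball: "ball 0 \<epsilon> \<subseteq> B \<inter> E -` chart_dom c0" using e(2) by (auto simp: \<epsilon>_def)
  interpret planar_hessian U "g c0" h F by (rule planar_hessian)
  have z0: "0 \<in> B" "E 0 \<in> chart_dom c0" using polar_unfolded(1) c0 E_0 by simp_all
  have p0: "(chart_map c0 \<circ> E) 0 = chart_map c0 p" using E_0 by simp
  have hp: "h (chart_map c0 p) = H p" using is_chart_inv[OF chart[OF c0(1)] c0(2)] by simp
  have "planar_polar U (g c0) h F (chart_map c0 \<circ> E) \<epsilon>"
  proof unfold_locales
    show "0 < \<epsilon>" by (rule \<epsilon>(1))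
    show "Ck_on 2 (chart_map c0 \<circ> E) (ball 0 \<epsilon>)"
      using smooth_E[OF c0(1)] ball by (auto simp: smooth_on_def intro: Ck_on_subset)
    show "(chart_map c0 \<circ> E) z \<in> U" if "z \<in> ball 0 \<epsilon>" for z using ball that by auto
    show "\<exists>\<sigma> v. \<forall>t\<in>{0..<\<epsilon>}. \<sigma> t = (chart_map c0 \<circ> E) (t *\<^sub>R \<omega>) \<and>
        (\<sigma> has_vector_derivative v t) (at t) \<and>
        (v has_vector_derivative - Gam (\<sigma> t) (v t) (v t)) (at t)"
      and "ip ((chart_map c0 \<circ> E) 0) (DE c0 0 \<omega>) (DE c0 0 \<omega>) = 1"
      if \<omega>: "norm \<omega> = 1" for \<omega>
    proof -
      obtain \<gamma> J where \<gamma>: "open J" "{0..\<epsilon>} \<subseteq> J" "geodesic_on A g \<gamma> J" "\<gamma> 0 = p"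
        "((chart_map c0 \<circ> \<gamma>) has_vector_derivative frame \<omega>) (at 0)"
        "\<And>t. t \<in> {0..\<epsilon>} \<Longrightarrow> E (t *\<^sub>R \<omega>) = \<gamma> t"
        using exp_ray_rescaled[OF \<omega> \<epsilon>] by blast
      have dom: "\<gamma> t \<in> chart_dom c0" if "t \<in> {0..<\<epsilon>}" for t
      proof -
        have "t *\<^sub>R \<omega> \<in> ball 0 \<epsilon>" using that \<omega> by simp
        then have "E (t *\<^sub>R \<omega>) \<in> chart_dom c0" using ball by blast
        then show ?thesis using \<gamma>(6)[of t] that by simp
      qed
      have inJ: "t \<in> J" if "t \<in> {0..<\<epsilon>}" for t using \<gamma>(2) that by auto
      have "(chart_map c0 \<circ> \<gamma>) t = (chart_map c0 \<circ> E) (t *\<^sub>R \<omega>)" if "t \<in> {0..<\<epsilon>}" for t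
        using \<gamma>(6)[of t] that by simp
      then show "\<exists>\<sigma> v. \<forall>t\<in>{0..<\<epsilon>}. \<sigma> t = (chart_map c0 \<circ> E) (t *\<^sub>R \<omega>) \<and>
          (\<sigma> has_vector_derivative v t) (at t) \<and>
          (v has_vector_derivative - Gam (\<sigma> t) (v t) (v t)) (at t)"
        using geodesic_onD[OF \<gamma>(3) c0(1) inJ dom]
        by (intro exI[of _ "chart_map c0 \<circ> \<gamma>"] exI[of _ "velocity c0 \<gamma>"] ballI conjI)
      \<comment> \<open>The differential of the exponential map at 0 is the identity, read off from
        the initial velocity of the ray; as the frame is orthonormal, this yields the isometry
        condition.\<close>
      have "DE c0 0 \<omega> = frame \<omega>"
      proof (rule has_vector_derivative_unique_on_interval)
        show "0 < \<epsilon>" "0 \<in> {0..\<epsilon>}" using \<epsilon> by simp_all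
        have ray: "((\<lambda>s. s *\<^sub>R \<omega>) has_vector_derivative \<omega>) (at 0)"
          by (auto intro!: derivative_eq_intros)
        have D: "((chart_map c0 \<circ> E) has_derivative DE c0 0) (at (0 *\<^sub>R \<omega>))"
          using DE[OF c0(1) z0] by simp
        from has_vector_derivative_compose[OF ray D]
        show "((\<lambda>s. (chart_map c0 \<circ> E) (s *\<^sub>R \<omega>)) has_vector_derivative DE c0 0 \<omega>) (at 0)" .
        show "((chart_map c0 \<circ> \<gamma>) has_vector_derivative frame \<omega>) (at 0)" by (rule \<gamma>(5))
        show "(chart_map c0 \<circ> E) (s *\<^sub>R \<omega>) = (chart_map c0 \<circ> \<gamma>) s" if "s \<in> {0..\<epsilon>}" for s
          using \<gamma>(6)[OF that] by simp
      qed
      then show "ip ((chart_map c0 \<circ> E) 0) (DE c0 0 \<omega>) (DE c0 0 \<omega>) = 1"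
        using frame_unit[OF \<omega>] unfolding p0 by (simp add: metric_at_def ip_def)
    qed
    have "frechet_derivative h (at (chart_map c0 p)) v = 0" for v
      using p c0 by (simp add: regular_critical_point_def critical_point_def differential_def)
    then have "grad_chart (g c0) h (chart_map c0 p) = 0"
      by (simp add: grad_chart_def partial_def vec_eq_iff matrix_vector_mult_def)
    then show "grad_chart (g c0) h ((chart_map c0 \<circ> E) 0) = 0" unfolding p0 .
    have "invertible (mat (F (H p)) :: real ^ 2 ^ 2)"
      using p c0 H_hessian[OF c0] by (auto simp: regular_critical_point_def)
    then have "F (H p) \<noteq> 0" by (auto simp: invertible_det_nz det_2 mat_def)
    then show "F (h ((chart_map c0 \<circ> E) 0)) \<noteq> 0" unfolding p0 hp .
  qed
  then show ?thesis using \<epsilon> ball by blast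
qed

text \<open>The images of sgn z and \<i> z under the differential of \<open>E\<close> are
  \<partial>_r and \<partial>_\<phi>, with dual coframe dr, d\<phi>. To see it, the image w of v
  under the differential of \<open>\<psi>\<close> is expanded in the orthonormal basis \<omega>,
  \<i> \<omega> of the plane with \<omega> = sgn z.\<close>

lemma coordinate_derivatives:
  assumes c: "c \<in> A" "E z \<in> chart_dom c" and z: "z \<in> B" "z \<noteq> 0"
  shows "DE c z (differential r c (E z) v *\<^sub>R sgn z + angle_form u c (E z) v *\<^sub>R (\<i> * z)) = v"
proof -
  let ?y = "chart_map c (E z)" and ?f = "\<psi> \<circ> chart_inv c"
  let ?W = "chart_map c ` (chart_dom c \<inter> E ` B)"
  have W: "open ?W"
    by (rule open_chart_image[OF chart[OF c(1)]]) (use open_dom[OF c(1)] polar_unfolded(4) in auto)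
  have y: "?y \<in> ?W" using c z by blast
  have "smooth_on ?f ?W" using polar_unfolded(6) c(1) by (simp add: smooth_from_def)
  from smooth_on_has_derivative[OF this y] obtain P where P: "(?f has_derivative P) (at ?y)" by blast
  have \<psi>E: "\<psi> (E x) = x" if "x \<in> B" for x using polar_unfolded(3) that by simp
  have f: "\<exists>x\<in>B. E x \<in> chart_dom c \<and> y' = chart_map c (E x) \<and> chart_inv c y' = E x \<and> ?f y' = x"
    if "y' \<in> ?W" for y'
    using that \<psi>E by (auto simp: is_chart_inv[OF chart[OF c(1)]])
  have fy: "?f ?y = z" using \<psi>E z is_chart_inv[OF chart[OF c(1)] c(2)] by simp
  have "(((chart_map c \<circ> E) \<circ> ?f) has_derivative DE c z \<circ> P) (at ?y)"
    by (rule diff_chain_at[OF P]) (use DE[OF c(1) z(1) c(2)] fy in simp)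
  then have "((\<lambda>y. y) has_derivative DE c z \<circ> P) (at ?y)"
    by (rule has_derivative_transform_within_open[OF _ W y]) (use f in fastforce)
  from has_derivative_unique[OF this has_derivative_ident] have DP: "DE c z (P v) = v"
    by (metis o_apply)
  define w where "w = P v"
  \<comment> \<open>\<open>r\<close> and \<open>u\<close> are prescribed off the centre only, so r =
    cmod \<circ> \<open>\<psi>\<close> and u = sgn \<circ> \<open>\<psi>\<close> are differentiated
    on the punctured image.\<close>
  let ?W' = "?f -` (- {0}) \<inter> ?W"
  have "continuous_on ?W ?f"
    using \<open>smooth_on ?f ?W\<close> unfolding smooth_on_def by (metis Ck_on.simps(1))
  then have W': "open ?W'"
    using continuous_on_open_vimage[OF W, of ?f] open_Compl[OF closed_singleton[of 0]] by blast
  have y': "?y \<in> ?W'" using y fy z by simp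
  have "(cmod has_derivative (\<lambda>w. inner w (sgn z))) (at (?f ?y))"
    unfolding fy by (rule has_derivative_norm[OF z(2)])
  from diff_chain_at[OF P this]
  have "((r \<circ> chart_inv c) has_derivative (\<lambda>w. inner w (sgn z)) \<circ> P) (at ?y)"
    by (rule has_derivative_transform_within_open[OF _ W' y']) (use f polar_unfolded(8) in fastforce)
  then have dr: "differential r c (E z) v = inner w (sgn z)"
    unfolding differential_def w_def by (rule frechet_derivative_eqI[THEN trans]) simp
  let ?Ds = "\<lambda>w. w /\<^sub>R cmod z - (inner w (sgn z) / (cmod z)\<^sup>2) *\<^sub>R z"
  have "(sgn has_derivative ?Ds) (at (?f ?y))"
  proof -
    have "cmod z \<noteq> 0" using z by simp
    from has_derivative_scaleR[OF Deriv.has_derivative_inverse[OF this has_derivative_norm[OF z(2)]] has_derivative_ident]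
    have "((\<lambda>z. inverse (cmod z) *\<^sub>R z) has_derivative ?Ds) (at z)"
      by (rule has_derivative_eq_rhs)
        (use z in \<open>simp add: fun_eq_iff power2_eq_square divide_inverse mult_ac\<close>)
    then show ?thesis unfolding fy by (simp add: sgn_div_norm[abs_def])
  qed
  from diff_chain_at[OF P this]
  have "((u \<circ> chart_inv c) has_derivative ?Ds \<circ> P) (at ?y)"
    by (rule has_derivative_transform_within_open[OF _ W' y']) (use f polar_unfolded(9) in fastforce)
  then have du: "differential u c (E z) v = ?Ds w"
    unfolding differential_def w_def by (rule frechet_derivative_eqI[THEN trans]) simp
  define t where "t = cmod z"
  define \<omega> where "\<omega> = sgn z"
  have t: "t > 0" and z_eq: "z = t *\<^sub>R \<omega>"
    using z by (simp_all add: t_def \<omega>_def sgn_div_norm)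
  have "cmod \<omega> = 1" using z by (simp add: \<omega>_def norm_sgn)
  then have \<omega>: "(Re \<omega>)\<^sup>2 + (Im \<omega>)\<^sup>2 = 1" using cmod_power2[of \<omega>] by simp
  have ang: "angle_form u c (E z) v = Im (cnj \<omega> * w) / t"
  proof -
    \<comment> \<open>The subtracted term is a real multiple of \<omega> and disappears in the
      imaginary part after multiplication by \<open>cnj \<omega>\<close>.\<close>
    have "angle_form u c (E z) v = Im (cnj \<omega> * (w /\<^sub>R t - (inner w \<omega> / t\<^sup>2) *\<^sub>R z))"
      unfolding angle_form_def du using polar_unfolded(9)[OF z] by (simp add: t_def \<omega>_def)
    also have "\<dots> = Im (cnj \<omega> * w) / t" using t by (simp add: z_eq field_simps)
    finally show ?thesis .
  qed
  have "differential r c (E z) v *\<^sub>R sgn z + angle_form u c (E z) v *\<^sub>R (\<i> * z) = w"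
  proof -
    have "inner w \<omega> *\<^sub>R \<omega> + (Im (cnj \<omega> * w) / t) *\<^sub>R (\<i> * z) =
        inner w \<omega> *\<^sub>R \<omega> + Im (cnj \<omega> * w) *\<^sub>R (\<i> * \<omega>)"
      using t by (simp add: z_eq)
    also have "\<dots> = ((Re \<omega>)\<^sup>2 + (Im \<omega>)\<^sup>2) *\<^sub>R w"
      by (simp add: complex_eq_iff inner_complex_def power2_eq_square algebra_simps)
    finally show ?thesis unfolding dr ang by (simp add: \<omega> \<omega>_def[symmetric])
  qed
  then show ?thesis using DP by (simp add: w_def)
qed

text \<open>The Gram matrix of \<partial>_r, \<partial>_\<phi> in all charts at once; the witness
  for \<open>f\<close> is the value of \<open>F\<close> at H(p).\<close>

lemma polar_metric:
  "\<exists>\<epsilon>>0. \<epsilon> < R \<and> (\<exists>k k' f. f \<noteq> 0 \<and>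
    (\<forall>t. 0 < t \<and> t < \<epsilon> \<longrightarrow> (k has_real_derivative k' t) (at t) \<and> k' t / f > 0) \<and>
    (\<forall>z. 0 < cmod z \<and> cmod z < \<epsilon> \<longrightarrow> H (E z) = k (cmod z) \<and>
      (\<forall>c\<in>A. E z \<in> chart_dom c \<longrightarrow>
        metric_at g c (E z) (DE c z (sgn z)) (DE c z (sgn z)) = 1 \<and>
        metric_at g c (E z) (DE c z (sgn z)) (DE c z (\<i> * z)) = 0 \<and>
        metric_at g c (E z) (DE c z (\<i> * z)) (DE c z (\<i> * z)) = (k' (cmod z) / f)\<^sup>2)))"
proof -
  obtain \<epsilon> where \<epsilon>: "0 < \<epsilon>" "\<epsilon> < R" "\<forall>z\<in>ball 0 \<epsilon>. E z \<in> chart_dom c0"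
    and pp: "planar_polar U (g c0) h F (chart_map c0 \<circ> E) \<epsilon>"
    using planar_polar_exists by blast
  interpret planar_polar U "g c0" h F "chart_map c0 \<circ> E" \<epsilon> by (rule pp)
  let ?f = "F (h ((chart_map c0 \<circ> E) 0))"
  obtain d where d: "d > 0" "\<forall>s\<in>{0<..<d}. k' s / ?f > 0"
    using k_derivatives(3)[of "\<epsilon>/2"] \<epsilon>(1) by auto
  \<comment> \<open>Below \<open>\<epsilon>\<close> the image stays in the chart \<open>c0\<close>;
    below \<open>d\<close> the quotient k'/f is positive, so in particular k' has no zero.\<close>
  define \<delta> where "\<delta> = min d \<epsilon>"
  have \<delta>: "0 < \<delta>" "\<delta> \<le> \<epsilon>" using d \<epsilon> by (simp_all add: \<delta>_def)
  have pos: "k' s / ?f > 0" if "s \<in> {0<..<\<delta>}" for s using d(2) that by (simp add: \<delta>_def)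
  then have nz: "k' s \<noteq> 0" if "s \<in> {0<..<\<delta>}" for s using that by force
  have main: "H (E z) = k (cmod z) \<and> (\<forall>c\<in>A. E z \<in> chart_dom c \<longrightarrow>
        metric_at g c (E z) (DE c z (sgn z)) (DE c z (sgn z)) = 1 \<and>
        metric_at g c (E z) (DE c z (sgn z)) (DE c z (\<i> * z)) = 0 \<and>
        metric_at g c (E z) (DE c z (\<i> * z)) (DE c z (\<i> * z)) = (k' (cmod z) / ?f)\<^sup>2)"
    if z: "0 < cmod z" "cmod z < \<delta>" for z
  proof -
    define t where "t = cmod z"
    define \<omega> where "\<omega> = sgn z"
    have \<omega>: "norm \<omega> = 1" and z_eq: "t *\<^sub>R \<omega> = z"
      using z by (simp_all add: \<omega>_def t_def norm_sgn sgn_div_norm)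
    have t: "t \<in> {0<..<\<delta>}" "t \<in> {0..<\<epsilon>}" "t \<in> {0<..<\<epsilon>}" using z \<delta> by (simp_all add: t_def)
    have zB: "z \<in> B" "E z \<in> chart_dom c0" using z \<delta> \<epsilon> by auto
    note rad = radial[OF \<omega> t(2), unfolded z_eq]
    have y: "(chart_map c0 \<circ> E) z \<in> U" using zB by auto
    have m: "metric_at g c0 (E z) a b = ip ((chart_map c0 \<circ> E) z) a b" for a b
      by (simp add: metric_at_def ip_def)
    \<comment> \<open>The vanishing derivative of \<open>h\<close> along the circle is \<langle>Y,
      N\<rangle> = 0, rewritten with N = k' \<partial>_r.\<close>
    have "k' t * ip ((chart_map c0 \<circ> E) z) (DE c0 z (\<i> * z)) (DE c0 z \<omega>) = 0"
      using tangential_derivative(2)[OF \<omega> t(3), unfolded z_eq] unfolding rad(3) ip_simps(6) .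
    then have orth: "ip ((chart_map c0 \<circ> E) z) (DE c0 z \<omega>) (DE c0 z (\<i> * z)) = 0"
      using nz[OF t(1)] ip_commute[OF y, of "DE c0 z \<omega>"] by simp
    note tang = tangential_norm[OF \<omega> \<delta>(2) nz t(1), unfolded z_eq]
    have "H (E z) = k t"
      using rad(1) is_chart_inv[OF chart[OF c0(1)] zB(2)] by simp
    moreover have "metric_at g c (E z) (DE c z \<omega>) (DE c z \<omega>) = 1 \<and>
        metric_at g c (E z) (DE c z \<omega>) (DE c z (\<i> * z)) = 0 \<and>
        metric_at g c (E z) (DE c z (\<i> * z)) (DE c z (\<i> * z)) = (k' t / ?f)\<^sup>2"
      if c: "c \<in> A" "E z \<in> chart_dom c" for c
      unfolding metric_DE_transition[OF c0(1) zB(2) c zB(1)] m using rad(2) orth tang by blast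
    ultimately show ?thesis unfolding t_def \<omega>_def by blast
  qed
  have "(k has_real_derivative k' t) (at t) \<and> k' t / ?f > 0" if "0 < t \<and> t < \<delta>" for t
    using k_derivatives(1)[of t] pos[of t] that \<delta> by simp
  then show ?thesis
    using main \<delta> \<epsilon> nondegenerate
    by (intro exI[of _ \<delta>] exI[of _ k] exI[of _ k'] exI[of _ ?f] conjI allI impI) auto
qed

text \<open>The velocity of the circle at angle \<theta> is the image of \<i> z, of constant norm
  \<open>s\<close>. The chart in \<open>curve_speed\<close> is an arbitrary choice, hence the
  assumption about all charts.\<close>

lemma circle_length:
  assumes \<rho>: "0 < \<rho>" "\<rho> < R" and s: "s \<ge> 0"
    and norm: "\<And>z c. cmod z = \<rho> \<Longrightarrow> c \<in> A \<Longrightarrow> E z \<in> chart_dom c \<Longrightarrow>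
      metric_at g c (E z) (DE c z (\<i> * z)) (DE c z (\<i> * z)) = s\<^sup>2"
  shows "geodesic_circle_length A g c0 p e1 e2 \<rho> = 2 * pi * s"
proof -
  let ?\<gamma> = "\<lambda>\<theta>. E (complex_of_real \<rho> * cis \<theta>)"
  have "curve_speed A g ?\<gamma> \<theta> = s" for \<theta>
  proof -
    define c where "c = (SOME c. c \<in> A \<and> ?\<gamma> \<theta> \<in> chart_dom c)"
    have "\<exists>c. c \<in> A \<and> ?\<gamma> \<theta> \<in> chart_dom c" using chart_exists by blast
    from someI_ex[OF this] have c: "c \<in> A" "?\<gamma> \<theta> \<in> chart_dom c" by (simp_all add: c_def)
    define z where "z = complex_of_real \<rho> * cis \<theta>"
    have z: "cmod z = \<rho>" "z \<in> B" using \<rho> by (simp_all add: z_def norm_mult)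
    have "((\<lambda>w. complex_of_real \<rho> * exp (\<i> * w)) has_field_derivative \<i> * z) (at (of_real \<theta>))"
      by (auto intro!: derivative_eq_intros simp: z_def cis_conv_exp)
    from has_vector_derivative_real_field[OF this]
    have circ: "((\<lambda>\<theta>. complex_of_real \<rho> * cis \<theta>) has_vector_derivative \<i> * z) (at \<theta>)"
      by (simp add: cis_conv_exp)
    have D: "((chart_map c \<circ> E) has_derivative DE c z) (at (complex_of_real \<rho> * cis \<theta>))"
      using DE[OF c(1) z(2)] c(2) by (simp add: z_def)
    have "((chart_map c \<circ> ?\<gamma>) has_vector_derivative DE c z (\<i> * z)) (at \<theta>)"
      using has_vector_derivative_compose[OF circ D] by (simp only: o_def)
    from vector_derivative_at[OF this]
    have "curve_speed A g ?\<gamma> \<theta> = sqrt (metric_at g c (E z) (DE c z (\<i> * z)) (DE c z (\<i> * z)))"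
      by (simp add: curve_speed_def Let_def c_def[symmetric] z_def)
    also have "\<dots> = s" using norm[OF z(1) c(1)] c(2) s by (simp add: z_def)
    finally show ?thesis .
  qed
  then have "curve_speed A g ?\<gamma> = (\<lambda>\<theta>. s)" by (rule ext)
  then show ?thesis
    by (simp add: geodesic_circle_length_def curve_length_def)
qed

end

theorem proposition11:
  fixes A :: "'m::{second_countable_topology,t2_space} chart set"
    and g :: "'m metric"
    and K H :: "'m \<Rightarrow> real"
    and \<alpha> R :: real
    and p :: 'm
    and c\<^sub>p :: "'m chart"
    and e1 e2 :: "real ^ 2"
    and V :: "'m set"
    and r :: "'m \<Rightarrow> real"
    and u :: "'m \<Rightarrow> complex"
    and L :: "real \<Rightarrow> real"
  assumes surface: "oriented_riemannian_surface A g"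
    and K: "gauss_curvature A g K"
    and H_smooth: "smooth_from A H UNIV"
    and H_hessian: "\<forall>c\<in>A. \<forall>q\<in>chart_dom c. hessian g H c q = mat (H q * ((H q)\<^sup>2 - K q))"
    and H_K: "\<forall>q. 2 * K q - 3 * (H q)\<^sup>2 = \<alpha>"
    and p: "regular_critical_point A g H p"
    and chart_p: "c\<^sub>p \<in> A" "p \<in> chart_dom c\<^sub>p"
    and basis_p: "orthonormal_basis_at g c\<^sub>p p e1 e2"
    and polar: "geodesic_polar_coordinates A g c\<^sub>p p e1 e2 R V r u"
    and L: "\<forall>\<rho>. L \<rho> = geodesic_circle_length A g c\<^sub>p p e1 e2 \<rho>"
  shows "\<exists>\<epsilon>>0. \<epsilon> \<le> R \<and>
    (\<forall>q\<in>V. r q < \<epsilon> \<longrightarrow> (\<forall>c\<in>A. q \<in> chart_dom c \<longrightarrow> (\<forall>v w.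
       metric_at g c q v w =
         differential r c q v * differential r c q w +
         (L (r q) / (2 * pi))\<^sup>2 * (angle_form u c q v * angle_form u c q w)))) \<and>
    (\<exists>h k. k \<noteq> 0 \<and>
       (\<forall>q\<in>V. r q < \<epsilon> \<longrightarrow> H q = h (r q)) \<and>
       (\<forall>\<rho>. 0 < \<rho> \<and> \<rho> < \<epsilon> \<longrightarrow> h differentiable (at \<rho>) \<and> L \<rho> = k * deriv h \<rho>))"
proof -
  \<comment> \<open>Substituting K = (3 H^2 + \<alpha>)/2 into H (H^2 - K) gives - H (H^2 +
    \<alpha>)/2; it is spelled with products so that \<open>Ck_on_mult\<close> applies
    directly.\<close>
  define F :: "real \<Rightarrow> real" where "F x = x * (- (1/2) * (x * x + \<alpha>))" for x
  have "Ck_on 1 F UNIV"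
    unfolding F_def[abs_def]
    by (intro Ck_on_mult Ck_on_add Ck_on_const Ck_on_linear bounded_linear_ident open_UNIV)
  moreover have "H q * ((H q)\<^sup>2 - K q) = F (H q)" for q
  proof -
    have "K q = (3 * (H q)\<^sup>2 + \<alpha>) / 2" using H_K[rule_format, of q] by simp
    then show ?thesis by (simp add: F_def power2_eq_square field_simps)
  qed
  ultimately interpret hessian_surface A g H F R p c\<^sub>p e1 e2 V r u
    using assms by unfold_locales simp_all
  obtain \<epsilon> h h' f where \<epsilon>: "0 < \<epsilon>" "\<epsilon> < R" and f: "f \<noteq> 0"
    and dh: "\<And>t. 0 < t \<Longrightarrow> t < \<epsilon> \<Longrightarrow> (h has_real_derivative h' t) (at t)"
      "\<And>t. 0 < t \<Longrightarrow> t < \<epsilon> \<Longrightarrow> h' t / f > 0"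
    and Hh: "\<And>z. 0 < cmod z \<Longrightarrow> cmod z < \<epsilon> \<Longrightarrow> H (E z) = h (cmod z)"
    and met: "\<And>z c. 0 < cmod z \<Longrightarrow> cmod z < \<epsilon> \<Longrightarrow> c \<in> A \<Longrightarrow> E z \<in> chart_dom c \<Longrightarrow>
        metric_at g c (E z) (DE c z (sgn z)) (DE c z (sgn z)) = 1 \<and>
        metric_at g c (E z) (DE c z (sgn z)) (DE c z (\<i> * z)) = 0 \<and>
        metric_at g c (E z) (DE c z (\<i> * z)) (DE c z (\<i> * z)) = (h' (cmod z) / f)\<^sup>2"
    using polar_metric by blast
  \<comment> \<open>\<open>circle_length\<close> takes a nonnegative root of the squared norm;
    positivity of h'/f selects h'/f itself.\<close>
  have L_eq: "L \<rho> = 2 * pi * (h' \<rho> / f)" if "0 < \<rho>" "\<rho> < \<epsilon>" for \<rho>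
    unfolding L[rule_format]
    by (rule circle_length) (use that \<epsilon> dh(2)[OF that] met in auto)
  have V: "\<exists>z. q = E z \<and> z \<in> B \<and> 0 < cmod z \<and> cmod z < \<epsilon> \<and> r q = cmod z" if "q \<in> V" "r q < \<epsilon>" for q
    using that polar_unfolded(7,8) by auto
  have "metric_at g c q v w = differential r c q v * differential r c q w +
      (L (r q) / (2 * pi))\<^sup>2 * (angle_form u c q v * angle_form u c q w)"
    if q: "q \<in> V" "r q < \<epsilon>" and c: "c \<in> A" "q \<in> chart_dom c" for q c v w
  proof -
    obtain z where z: "q = E z" "z \<in> B" "0 < cmod z" "cmod z < \<epsilon>" "r q = cmod z" using V[OF q] by blast
    interpret planar_metric "chart_map c ` chart_dom c" "g c" by (rule planar_metric_chart[OF c(1)])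
    have y: "chart_map c q \<in> chart_map c ` chart_dom c" using c by blast
    have m: "metric_at g c q a b = ip (chart_map c q) a b" for a b
      by (simp add: metric_at_def ip_def)
    let ?X = "DE c z (sgn z)" and ?Y = "DE c z (\<i> * z)"
    have "linear (DE c z)" using DE[OF c(1) z(2)] c(2) z(1) has_derivative_linear by blast
    moreover have "DE c z (differential r c q v *\<^sub>R sgn z + angle_form u c q v *\<^sub>R (\<i> * z)) = v" for v
      using coordinate_derivatives[OF c(1) _ z(2)] c(2) z(1,3) by simp
    \<comment> \<open>Every tangent vector in the polar frame; bilinearity then reduces the metric
      to the Gram matrix of \<open>?X\<close> and \<open>?Y\<close>.\<close>
    ultimately have expand: "differential r c q v *\<^sub>R ?X + angle_form u c q v *\<^sub>R ?Y = v" for v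
      by (simp only: linear_add linear_scale)
    have XY: "ip (chart_map c q) ?X ?X = 1" "ip (chart_map c q) ?X ?Y = 0"
        "ip (chart_map c q) ?Y ?X = 0" "ip (chart_map c q) ?Y ?Y = (h' (r q) / f)\<^sup>2"
      using met[OF z(3,4) c(1)] c(2) ip_commute[OF y, of ?Y ?X] unfolding z(1,5)[symmetric] m by simp_all
    have "L (r q) / (2 * pi) = h' (r q) / f" using L_eq[of "r q"] z by simp
    moreover have "ip (chart_map c q) (differential r c q v *\<^sub>R ?X + angle_form u c q v *\<^sub>R ?Y)
        (differential r c q w *\<^sub>R ?X + angle_form u c q w *\<^sub>R ?Y) =
      differential r c q v * differential r c q w + (h' (r q) / f)\<^sup>2 * (angle_form u c q v * angle_form u c q w)"
      unfolding ip_simps XY by simp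
    ultimately show ?thesis unfolding expand m by simp
  qed
  moreover have "H q = h (r q)" if "q \<in> V" "r q < \<epsilon>" for q
    using V[OF that] Hh by metis
  moreover have "h differentiable (at \<rho>) \<and> L \<rho> = (2 * pi / f) * deriv h \<rho>" if "0 < \<rho>" "\<rho> < \<epsilon>" for \<rho>
    using dh(1)[OF that] L_eq[OF that] DERIV_imp_deriv[OF dh(1)[OF that]] real_differentiable_def by auto
  moreover have "2 * pi / f \<noteq> 0" using f by simp
  ultimately show ?thesis
    using \<epsilon> by (intro exI[of _ \<epsilon>] conjI exI[of _ h] exI[of _ "2 * pi / f"]) auto
qed

end
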